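(* Let $H$ be the finitely presented group $$H=\langle a,b \mid a^{b^2}=a\,a^{3b},\ [a,a^b]=1\rangle,$$ where $x^y=y^{-1}xy$, $[x,y]=x^{-1}y^{-1}xy$ and $a^{3b}=(a^b)^3=b^{-1}a^3b$. Then the Vogel-Levine localization (algebraic closure) $L(H)$ of $H$ is not transfinitely nilpotent; that is, $\gamma_\alpha(L(H))\neq 1$ for every ordinal $\alpha$.
   Context: A group homomorphism $f:G\to K$ is called 2-connected if it induces an isomorphism on $H_1(-,\mathbb Z)$ and a surjection on $H_2(-,\mathbb Z)$ (integral group homology). Let $\Omega$ be the collection of all 2-connected homomorphisms $f:G\to K$ such that both $G$ and $K$ are finitely presented groups. A group $\Gamma$ is called local if for every homomorphism $f:G\to K$ in $\Omega$ and every homomorphism $g:G\to\Gamma$ there is a unique homomorphism $h:K\to\Gamma$ with $h\circ f=g$. The Vogel-Levine localization (also called algebraic closure) of a group $G$ is a group $L(G)$ together with a homomorphism $l:G\to L(G)$ such that $L(G)$ is local and, for every local group $\Gamma$ and every homomorphism $f:G\to\Gamma$, there is a unique homomorphism $p:L(G)\to\Gamma$ with $p\circ l=f$. It is known that $L(G)$ exists for every group $G$; by the universal property it is unique up to unique isomorphism compatible with $l$. The transfinite lower central series of a group $G$ is defined by $\gamma_1(G)=G$, $\gamma_{\alpha+1}(G)=[\gamma_\alpha(G),G]$ for every ordinal $\alpha\ge 1$, and $\gamma_\tau(G)=\bigcap_{\alpha<\tau}\gamma_\alpha(G)$ for a limit ordinal $\tau$ (the intersection over ordinals $1\le\alpha<\tau$).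 A group $G$ is called transfinitely nilpotent if $\gamma_\alpha(G)=1$ for some ordinal $\alpha$. *)

theory Defs
  imports "HOL-Algebra.Free_Abelian_Groups"
begin

text \<open>
  Integral group homology, computed from the (unnormalised, inhomogeneous) bar complex with
  trivial coefficients: in degree n it is the free abelian group on the n-tuples of elements
  of the group, and
  \<open>d [g\<^sub>1|\<dots>|g\<^sub>n] = [g\<^sub>2|\<dots>|g\<^sub>n] + (\<Sum>0<i<n. (-1)^i [g\<^sub>1|\<dots>|g\<^sub>i g\<^sub>i\<^sub>+\<^sub>1|\<dots>|g\<^sub>n]) + (-1)^n [g\<^sub>1|\<dots>|g\<^sub>n\<^sub>-\<^sub>1]\<close>.
\<close>

definition bar_simplices :: "nat \<Rightarrow> ('a, 'm) monoid_scheme \<Rightarrow> 'a list set"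
  where "bar_simplices n G = {xs. length xs = n \<and> set xs \<subseteq> carrier G}"

definition bar_chain_group :: "nat \<Rightarrow> ('a, 'm) monoid_scheme \<Rightarrow> ('a list \<Rightarrow>\<^sub>0 int) monoid"
  where "bar_chain_group n G = free_Abelian_group (bar_simplices n G)"

definition bar_simplex_boundary :: "('a, 'm) monoid_scheme \<Rightarrow> 'a list \<Rightarrow> ('a list \<Rightarrow>\<^sub>0 int)"
  where "bar_simplex_boundary G xs =
    (if xs = [] then 0
     else frag_of (tl xs)
        + (\<Sum>i\<in>{0<..<length xs}. frag_cmul ((-1) ^ i)
             (frag_of (take (i - 1) xs @ [xs ! (i - 1) \<otimes>\<^bsub>G\<^esub> xs ! i] @ drop (i + 1) xs)))
        + frag_cmul ((-1) ^ length xs) (frag_of (butlast xs)))"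

definition bar_boundary :: "('a, 'm) monoid_scheme \<Rightarrow> ('a list \<Rightarrow>\<^sub>0 int) \<Rightarrow> ('a list \<Rightarrow>\<^sub>0 int)"
  where "bar_boundary G = frag_extend (bar_simplex_boundary G)"

definition bar_cycles :: "nat \<Rightarrow> ('a, 'm) monoid_scheme \<Rightarrow> ('a list \<Rightarrow>\<^sub>0 int) set"
  where "bar_cycles n G = {c \<in> carrier (bar_chain_group n G). bar_boundary G c = 0}"

definition bar_boundaries :: "nat \<Rightarrow> ('a, 'm) monoid_scheme \<Rightarrow> ('a list \<Rightarrow>\<^sub>0 int) set"
  where "bar_boundaries n G = bar_boundary G ` carrier (bar_chain_group (Suc n) G)"

definition group_homology ::
    "nat \<Rightarrow> ('a, 'm) monoid_scheme \<Rightarrow> ('a list \<Rightarrow>\<^sub>0 int) set monoid"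
  where "group_homology n G =
    (bar_chain_group n G) \<lparr>carrier := bar_cycles n G\<rparr> Mod bar_boundaries n G"

definition bar_chain_map :: "('a \<Rightarrow> 'b) \<Rightarrow> ('a list \<Rightarrow>\<^sub>0 int) \<Rightarrow> ('b list \<Rightarrow>\<^sub>0 int)"
  where "bar_chain_map f = frag_extend (\<lambda>xs. frag_of (map f xs))"

text \<open>
  The chain map sends a homology class \<open>z\<close> of the domain into a single homology class of
  \<open>K\<close>; adding all boundaries of \<open>K\<close> to its image yields that whole class.
\<close>

definition group_homology_map ::
    "nat \<Rightarrow> ('b, 'm) monoid_scheme \<Rightarrow> ('a \<Rightarrow> 'b) \<Rightarrow> ('a list \<Rightarrow>\<^sub>0 int) set \<Rightarrow> ('b list \<Rightarrow>\<^sub>0 int) set"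
  where "group_homology_map n K f z =
    bar_boundaries n K <#>\<^bsub>bar_chain_group n K\<^esub> (bar_chain_map f ` z)"

definition two_connected ::
    "('a, 'm) monoid_scheme \<Rightarrow> ('b, 'k) monoid_scheme \<Rightarrow> ('a \<Rightarrow> 'b) \<Rightarrow> bool"
  where "two_connected G K f \<longleftrightarrow>
    f \<in> hom G K \<and>
    group_homology_map 1 K f \<in> iso (group_homology 1 G) (group_homology 1 K) \<and>
    group_homology_map 2 K f ` carrier (group_homology 2 G) = carrier (group_homology 2 K)"


text \<open>
  Words in generators and their formal inverses: \<open>(x, True)\<close> is the generator \<open>x\<close> and
  \<open>(x, False)\<close> is its inverse. Relations are pairs \<open>(u, v)\<close> of words, read as \<open>u = v\<close>.
\<close>

type_synonym 'x word = "('x \<times> bool) list"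

definition words :: "'x set \<Rightarrow> 'x word set"
  where "words S = lists (S \<times> UNIV)"

inductive pres_eq :: "'x set \<Rightarrow> ('x word \<times> 'x word) set \<Rightarrow> 'x word \<Rightarrow> 'x word \<Rightarrow> bool"
  for S R
  where
    refl: "pres_eq S R u u"
  | sym: "pres_eq S R u v \<Longrightarrow> pres_eq S R v u"
  | trans: "pres_eq S R u v \<Longrightarrow> pres_eq S R v w \<Longrightarrow> pres_eq S R u w"
  | append: "pres_eq S R u u' \<Longrightarrow> pres_eq S R v v' \<Longrightarrow> pres_eq S R (u @ v) (u' @ v')"
  | cancel: "x \<in> S \<Longrightarrow> pres_eq S R [(x, e), (x, \<not> e)] []"
  | relation: "(u, v) \<in> R \<Longrightarrow> pres_eq S R u v"

definition pres_class :: "'x set \<Rightarrow> ('x word \<times> 'x word) set \<Rightarrow> 'x word \<Rightarrow> 'x word set"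
  where "pres_class S R u = {v. pres_eq S R u v}"

definition presented_group :: "'x set \<Rightarrow> ('x word \<times> 'x word) set \<Rightarrow> 'x word set monoid"
  where "presented_group S R =
    \<lparr>carrier = pres_class S R ` words S,
     monoid.mult = (\<lambda>A B. \<Union>u\<in>A. \<Union>v\<in>B. pres_class S R (u @ v)),
     one = pres_class S R []\<rparr>"

definition finitely_presented :: "('a, 'm) monoid_scheme \<Rightarrow> bool"
  where "finitely_presented G \<longleftrightarrow>
    group G \<and>
    (\<exists>(n::nat) R. finite R \<and> R \<subseteq> words {..<n} \<times> words {..<n} \<and>
       G \<cong> presented_group {..<n} R)"


text \<open>
  Homomorphisms are only determined on the carrier, so uniqueness is expressed within the
  extensional functions. Every finitely presented group is isomorphic to one whose elements
  are sets of words over natural numbers, namely a \<open>presented_group\<close>; hence letting \<open>G\<close> and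
  \<open>K\<close> range over this one type loses no member of the class of 2-connected homomorphisms
  between finitely presented groups.
\<close>

definition local_group :: "('a, 'm) monoid_scheme \<Rightarrow> bool"
  where "local_group \<Gamma> \<longleftrightarrow>
    group \<Gamma> \<and>
    (\<forall>(G :: nat word set monoid) (K :: nat word set monoid) f.
       finitely_presented G \<and> finitely_presented K \<and> two_connected G K f \<longrightarrow>
       (\<forall>g \<in> hom G \<Gamma>. \<exists>!h. h \<in> hom K \<Gamma> \<inter> extensional (carrier K) \<and>
          (\<forall>x \<in> carrier G. h (f x) = g x)))"

text \<open>
  Types cannot be quantified inside a definition, so the local groups \<open>\<Gamma>\<close> range over one type
  of elements. The sum type \<open>'a + nat\<close> contains a copy of every countable group and of every
  group on \<open>'a\<close>, in particular of \<open>L\<close> itself.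
\<close>

definition vogel_levine_localization ::
    "('g, 'm) monoid_scheme \<Rightarrow> 'a monoid \<Rightarrow> ('g \<Rightarrow> 'a) \<Rightarrow> bool"
  where "vogel_levine_localization G L l \<longleftrightarrow>
    local_group L \<and> l \<in> hom G L \<and>
    (\<forall>\<Gamma> :: ('a + nat) monoid. local_group \<Gamma> \<longrightarrow>
       (\<forall>f \<in> hom G \<Gamma>. \<exists>!p. p \<in> hom L \<Gamma> \<inter> extensional (carrier L) \<and>
          (\<forall>x \<in> carrier G. p (l x) = f x)))"


definition commutator :: "('a, 'm) monoid_scheme \<Rightarrow> 'a \<Rightarrow> 'a \<Rightarrow> 'a"
  where "commutator G x y = inv\<^bsub>G\<^esub> x \<otimes>\<^bsub>G\<^esub> inv\<^bsub>G\<^esub> y \<otimes>\<^bsub>G\<^esub> x \<otimes>\<^bsub>G\<^esub> y"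

definition commutator_subgroup :: "('a, 'm) monoid_scheme \<Rightarrow> 'a set \<Rightarrow> 'a set \<Rightarrow> 'a set"
  where "commutator_subgroup G A B = generate G {commutator G x y | x y. x \<in> A \<and> y \<in> B}"

text \<open>
  Ordinals are represented by the elements of the field of a well-order \<open>r\<close>, an element
  standing for its position in \<open>r\<close>; positions are counted from 1, so the least element
  stands for the ordinal 1. An element \<open>\<alpha>\<close> is the successor of \<open>\<beta>\<close> iff the elements
  strictly below \<open>\<alpha>\<close> (\<open>underS r \<alpha>\<close>) are exactly those at or below \<open>\<beta>\<close> (\<open>under r \<beta>\<close>).
\<close>

definition lower_central :: "('a, 'm) monoid_scheme \<Rightarrow> 'o rel \<Rightarrow> 'o \<Rightarrow> 'a set"
  where "lower_central G r = wfrec (r - Id) (\<lambda>\<gamma> \<alpha>.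
    if underS r \<alpha> = {} then carrier G
    else if \<exists>\<beta> \<in> underS r \<alpha>. underS r \<alpha> = under r \<beta>
      then commutator_subgroup G (\<gamma> (THE \<beta>. \<beta> \<in> underS r \<alpha> \<and> underS r \<alpha> = under r \<beta>)) (carrier G)
    else (\<Inter>\<beta> \<in> underS r \<alpha>. \<gamma> \<beta>))"

text \<open>
  The type argument supplies the ordinals: \<open>r\<close> ranges over the well-orders on subsets of \<open>'o\<close>.
  Every ordinal is covered once \<open>'o\<close> is left arbitrary.
\<close>

definition transfinitely_nilpotent :: "'o itself \<Rightarrow> ('a, 'm) monoid_scheme \<Rightarrow> bool"
  where "transfinitely_nilpotent TYPE('o) G \<longleftrightarrow>
    (\<exists>(r :: 'o rel) \<alpha>. Well_order r \<and> \<alpha> \<in> Field r \<and> lower_central G r \<alpha> = {\<one>\<^bsub>G\<^esub>})"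


definition word_inv :: "'x word \<Rightarrow> 'x word"
  where "word_inv u = rev (map (\<lambda>(x, e). (x, \<not> e)) u)"

definition word_conj :: "'x word \<Rightarrow> 'x word \<Rightarrow> 'x word"
  where "word_conj u v = word_inv v @ u @ v"

definition word_comm :: "'x word \<Rightarrow> 'x word \<Rightarrow> 'x word"
  where "word_comm u v = word_inv u @ word_inv v @ u @ v"

text \<open>
  \<open>\<langle>a, b | a^(b^2) = a a^(3b), [a, a^b] = 1\<rangle>\<close>, where \<open>a^(3b)\<close> is the conjugate of \<open>a^3\<close> by \<open>b\<close>.
\<close>

definition H_group :: "nat word set monoid"
  where "H_group =
    (let a = [(0, True)]; b = [(1, True)]
     in presented_group {0, 1}
          {(word_conj a (b @ b), a @ word_conj (a @ a @ a) b),
           (word_comm a (word_conj a b), [])})"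

end

theory Submission
  imports Defs "HOL-Algebra.Weak_Morphisms"
begin

text \<open>
  \<open>H\<close> is the semidirect product of \<open>M = \<int>[t]/(t\<^sup>2 - 3t - 1)\<close>, free abelian of rank 2, with the infinite
  cyclic group of \<open>b\<close>, which acts on \<open>M\<close> as multiplication by \<open>t\<close>, hence with determinant \<open>-1\<close>. The proof
  finds in \<open>L(H)\<close> a subgroup \<open>N \<noteq> 1\<close> with \<open>N \<subseteq> [N, L(H)]\<close>; by transfinite induction
  such an \<open>N\<close> lies in every term of the lower central series (\<open>le_lower_central\<close>).

  For \<open>n\<close> prime to 3 let \<open>K\<^sub>n = \<langle>x, b | x^(b\<^sup>2) = x x^(3b), [z, x] = [z, x^b] = 1, z^(n\<^sup>2) = 1\<rangle>\<close> with
  \<open>z = [x, x^b]\<close>: here \<open>M\<close> is replaced by a Heisenberg group with derived subgroup of order \<open>n\<^sup>2\<close>. Sending \<open>a\<close> to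
  \<open>x^n z^(n(n-1)/2)\<close> and \<open>b\<close> to \<open>b\<close> gives a homomorphism \<open>H \<rightarrow> K\<^sub>n\<close>, which is 2-connected: on first homology
  because \<open>n\<close> is invertible modulo 3, and on second homology because the order of \<open>z\<close> is exactly what
  \<open>[a, a^b] = 1\<close> forces upon \<open>[x, x^b]\<close>. The latter is proved by solving the relations of \<open>K\<^sub>n\<close> in
  every central extension to which \<open>H\<close> lifts (\<open>heisenberg_rel_central_lift\<close>), and a chain-level
  universal coefficient argument turns this lifting property into 2-connectedness (\<open>two_connectedI\<close>).
  So in a local group \<open>a\<close> has a unique "\<open>n\<close>-th root" \<open>X\<^sub>n\<close> in the sense of the relations of \<open>K\<^sub>n\<close>
  (\<open>local_group_unique_root\<close>). Uniqueness gives \<open>X\<^sub>n = X\<^sub>2\<^sub>n\<^sup>2 Z\<^sub>2\<^sub>n\<close> for \<open>Z\<^sub>n = [X\<^sub>n, X\<^sub>n^b]\<close>, whence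
  \<open>Z\<^sub>n = Z\<^sub>2\<^sub>n^4\<close>. As \<open>b\<close> inverts each \<open>Z\<^sub>n\<close>, one has \<open>[Z\<^sub>2\<^sub>n^(-2), b] = Z\<^sub>2\<^sub>n^4 = Z\<^sub>n\<close>, and the powers of the
  \<open>Z\<^sub>n\<close> with \<open>n\<close> a power of 2 form the required \<open>N\<close>.

  That \<open>N \<noteq> 1\<close> is seen in one local group \<open>\<Gamma>\<close> (\<open>local_heisenberg_group_exists\<close>): an extension of a
  group of units of the field \<open>\<rat>[t]/(t\<^sup>2 - 3t - 1)\<close>, acting on the additive group of that field, by the quasicyclic 2-group
  on which a unit acts through its norm. It contains a root for \<open>n = 2\<close> whose \<open>Z\<close> is nontrivial.

  The local groups are recognised by a criterion of Levine type: a group is local as soon as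
  each finite system \<open>x\<^sub>i = w\<^sub>i(x)\<close>, whose terms may contain constants but have exponent sum 0 in every
  variable, has exactly one solution (\<open>uniquely_solvable_imp_local\<close>). Uniqueness of extensions is then
  immediate from surjectivity on first homology. For existence one solves the system which the generators have
  to satisfy; the subgroup of \<open>K \<times> \<Gamma>\<close> generated by the solution is a graph because the kernel
  of its projection to \<open>K\<close> equals its own commutator with that subgroup by a theorem of Stallings
  (\<open>two_connected_kernel_le_commutator\<close>): finitely many elements whose normal closure contains the kernel
  therefore solve a system that has the trivial solution. The criterion passes
  through extensions by abelian kernels on which the differences \<open>g - 1\<close> generate a radical ring, by Gaussian
  elimination (\<open>uniquely_solvable_extension\<close>).
\<close>

section \<open>Presentations by generators and relations\<close>

fun word_value :: "('t, 'm) monoid_scheme \<Rightarrow> ('x \<Rightarrow> 't) \<Rightarrow> 'x word \<Rightarrow> 't"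
  where
    "word_value T \<xi> [] = \<one>\<^bsub>T\<^esub>"
  | "word_value T \<xi> ((x, e) # u) = (if e then \<xi> x else inv\<^bsub>T\<^esub> \<xi> x) \<otimes>\<^bsub>T\<^esub> word_value T \<xi> u"

lemma words_simps [simp]:
  "[] \<in> words S"
  "(x, e) # u \<in> words S \<longleftrightarrow> x \<in> S \<and> u \<in> words S"
  "u @ v \<in> words S \<longleftrightarrow> u \<in> words S \<and> v \<in> words S"
  "word_inv u \<in> words S \<longleftrightarrow> u \<in> words S"
  by (auto simp: words_def word_inv_def)

lemma words_UNIV [simp]: "u \<in> words UNIV"
  by (auto simp: words_def)

lemma words_conj_comm [simp]:
  "word_conj u v \<in> words S \<longleftrightarrow> u \<in> words S \<and> v \<in> words S"
  "word_comm u v \<in> words S \<longleftrightarrow> u \<in> words S \<and> v \<in> words S"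
  by (auto simp: word_conj_def word_comm_def)

lemma word_value_cong:
  "u \<in> words S \<Longrightarrow> (\<And>x. x \<in> S \<Longrightarrow> \<xi> x = \<zeta> x) \<Longrightarrow> word_value T \<xi> u = word_value T \<zeta> u"
  by (induction T \<xi> u rule: word_value.induct) auto

context group
begin

context
  fixes S :: "'x set" and \<xi> :: "'x \<Rightarrow> 'a"
  assumes \<xi>: "\<And>x. x \<in> S \<Longrightarrow> \<xi> x \<in> carrier G"
begin

lemma word_value_closed [simp]: "u \<in> words S \<Longrightarrow> word_value G \<xi> u \<in> carrier G"
proof (induction u)
  case (Cons a u)
  then show ?case using \<xi> by (cases a) auto
qed simp

lemma word_value_append [simp]:
  "u \<in> words S \<Longrightarrow> v \<in> words S \<Longrightarrow>
    word_value G \<xi> (u @ v) = word_value G \<xi> u \<otimes> word_value G \<xi> v"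
proof (induction u)
  case (Cons a u)
  then show ?case using \<xi> by (cases a) (auto simp: m_assoc)
qed simp

lemma word_value_inv [simp]:
  "u \<in> words S \<Longrightarrow> word_value G \<xi> (word_inv u) = inv word_value G \<xi> u"
proof (induction u)
  case (Cons a u)
  obtain x e where a: "a = (x, e)" by fastforce
  have "word_inv (a # u) = word_inv u @ [(x, \<not> e)]" by (simp add: word_inv_def a)
  then show ?case using Cons \<xi>[of x] a by (simp add: inv_mult_group)
qed (simp add: word_inv_def)

lemma word_value_conj [simp]:
  "u \<in> words S \<Longrightarrow> v \<in> words S \<Longrightarrow> word_value G \<xi> (word_conj u v) =
    inv word_value G \<xi> v \<otimes> (word_value G \<xi> u \<otimes> word_value G \<xi> v)"
  by (simp add: word_conj_def)

lemma word_value_comm [simp]: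
  "u \<in> words S \<Longrightarrow> v \<in> words S \<Longrightarrow> word_value G \<xi> (word_comm u v) =
    commutator G (word_value G \<xi> u) (word_value G \<xi> v)"
  by (simp add: word_comm_def commutator_def m_assoc)

end

lemma word_value_pres_eq:
  assumes "pres_eq S R u v" "\<And>x. \<xi> x \<in> carrier G"
    and "\<And>u v. (u, v) \<in> R \<Longrightarrow> word_value G \<xi> u = word_value G \<xi> v"
  shows "word_value G \<xi> u = word_value G \<xi> v"
  using assms(1)
proof induction
  case (append u u' v v')
  then show ?case using word_value_append[of UNIV \<xi>] assms(2) by simp
next
  case (cancel x e)
  then show ?case using assms(2) by (cases e) auto
qed (use assms(3) in auto)

end

lemma hom_word_value:
  assumes "h \<in> hom G T" "group G" "group T" "\<And>x. x \<in> S \<Longrightarrow> \<xi> x \<in> carrier G" "u \<in> words S"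
  shows "h (word_value G \<xi> u) = word_value T (\<lambda>x. h (\<xi> x)) u"
proof -
  interpret group_hom G T h using assms by (simp add: group_hom_def group_hom_axioms_def)
  show ?thesis using assms(5)
  proof (induction u)
    case (Cons a u)
    then show ?case using assms(4) G.word_value_closed[of S \<xi> u] by (cases a) auto
  qed simp
qed

lemma pres_class_eq_iff: "pres_class S R u = pres_class S R v \<longleftrightarrow> pres_eq S R u v"
proof
  assume "pres_class S R u = pres_class S R v"
  moreover have "v \<in> pres_class S R v" by (simp add: pres_class_def pres_eq.refl)
  ultimately have "v \<in> pres_class S R u" by (simp only:)
  then show "pres_eq S R u v" by (simp add: pres_class_def)
next
  assume uv: "pres_eq S R u v"
  show "pres_class S R u = pres_class S R v"
    unfolding pres_class_def
    by (rule Collect_cong, rule iffI)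
      (erule pres_eq.trans[OF pres_eq.sym[OF uv]], erule pres_eq.trans[OF uv])
qed

lemma carrier_presented_group: "carrier (presented_group S R) = pres_class S R ` words S"
  by (simp add: presented_group_def)

lemma one_presented_group: "\<one>\<^bsub>presented_group S R\<^esub> = pres_class S R []"
  by (simp add: presented_group_def)

lemma mult_presented_group:
  "pres_class S R u \<otimes>\<^bsub>presented_group S R\<^esub> pres_class S R v = pres_class S R (u @ v)"
proof -
  let ?A = "pres_class S R u" and ?B = "pres_class S R v"
  have eq: "pres_class S R (u' @ v') = pres_class S R (u @ v)" if uv: "u' \<in> ?A" "v' \<in> ?B" for u' v'
  proof -
    have "pres_eq S R u u'" "pres_eq S R v v'" using uv by (simp_all add: pres_class_def)
    then have "pres_eq S R (u @ v) (u' @ v')" by (rule pres_eq.append)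
    then show ?thesis unfolding pres_class_eq_iff by (rule pres_eq.sym)
  qed
  have ne: "?A \<noteq> {}" "?B \<noteq> {}" using pres_eq.refl by (force simp: pres_class_def)+
  have "(\<Union>v'\<in>?B. pres_class S R (u' @ v')) = pres_class S R (u @ v)" if "u' \<in> ?A" for u'
    by (rule SUP_eq_const[OF ne(2)]) (rule eq[OF that])
  then have "(\<Union>u'\<in>?A. \<Union>v'\<in>?B. pres_class S R (u' @ v')) = pres_class S R (u @ v)"
    by (rule SUP_eq_const[OF ne(1)])
  then show ?thesis by (simp add: presented_group_def)
qed

lemma pres_eq_word_inv_left: "u \<in> words S \<Longrightarrow> pres_eq S R (word_inv u @ u) []"
proof (induction u)
  case (Cons a u)
  obtain x e where a: "a = (x, e)" by fastforce
  have "pres_eq S R [(x, \<not> e), (x, e)] []"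
    using pres_eq.cancel[of x S R "\<not> e"] Cons a by simp
  then have "pres_eq S R (word_inv u @ ([(x, \<not> e), (x, e)] @ u)) (word_inv u @ ([] @ u))"
    by (intro pres_eq.append pres_eq.refl)
  moreover have "word_inv (a # u) @ (a # u) = word_inv u @ ([(x, \<not> e), (x, e)] @ u)"
    by (simp add: word_inv_def a)
  ultimately show ?case using Cons a by (auto intro: pres_eq.trans)
qed (simp add: word_inv_def pres_eq.refl)

lemma group_presented_group: "group (presented_group S R)" (is "group ?P")
proof (rule groupI)
  fix x assume "x \<in> carrier ?P"
  then obtain u where u: "u \<in> words S" "x = pres_class S R u"
    by (auto simp: carrier_presented_group)
  show "\<one>\<^bsub>?P\<^esub> \<otimes>\<^bsub>?P\<^esub> x = x" by (simp add: u one_presented_group mult_presented_group)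
  have "pres_class S R (word_inv u) \<otimes>\<^bsub>?P\<^esub> x = \<one>\<^bsub>?P\<^esub>"
    unfolding u mult_presented_group one_presented_group pres_class_eq_iff
    by (rule pres_eq_word_inv_left[OF u(1)])
  moreover have "pres_class S R (word_inv u) \<in> carrier ?P"
    using u(1) by (simp add: carrier_presented_group)
  ultimately show "\<exists>y\<in>carrier ?P. y \<otimes>\<^bsub>?P\<^esub> x = \<one>\<^bsub>?P\<^esub>" by blast
qed (auto simp: carrier_presented_group mult_presented_group one_presented_group)

abbreviation pres_gen :: "'x set \<Rightarrow> ('x word \<times> 'x word) set \<Rightarrow> 'x \<Rightarrow> 'x word set"
  where "pres_gen S R x \<equiv> pres_class S R [(x, True)]"

lemma word_value_pres_gen:
  "u \<in> words S \<Longrightarrow> word_value (presented_group S R) (pres_gen S R) u = pres_class S R u"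
proof (induction u)
  case (Cons a u)
  obtain x e where a: "a = (x, e)" by fastforce
  then have x: "x \<in> S" "u \<in> words S" using Cons by auto
  interpret group "presented_group S R" by (rule group_presented_group)
  have inv: "inv\<^bsub>presented_group S R\<^esub> pres_gen S R x = pres_class S R [(x, False)]"
    by (rule inv_equality)
      (use x pres_eq.cancel[of x S R False] in
        \<open>auto simp: mult_presented_group one_presented_group carrier_presented_group pres_class_eq_iff\<close>)
  show ?case
    using Cons x by (cases e) (simp_all add: a inv mult_presented_group)
qed (simp add: one_presented_group)

text \<open>
  Letters outside \<open>S\<close> can occur in words that \<open>pres_eq\<close> relates, so the assignment is first extended by
  \<open>\<one>\<close> to all letters; the value of a word is then invariant under \<open>pres_eq\<close>.
\<close>

lemma von_Dyck:
  assumes "group T" "R \<subseteq> words S \<times> words S" "\<And>x. x \<in> S \<Longrightarrow> \<xi> x \<in> carrier T"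
    and rel: "\<And>u v. (u, v) \<in> R \<Longrightarrow> word_value T \<xi> u = word_value T \<xi> v"
  obtains h where "h \<in> hom (presented_group S R) T"
    "\<And>u. u \<in> words S \<Longrightarrow> h (pres_class S R u) = word_value T \<xi> u"
    "\<And>x. x \<in> S \<Longrightarrow> h (pres_gen S R x) = \<xi> x"
proof
  interpret T: group T by fact
  define \<zeta> where "\<zeta> x = (if x \<in> S then \<xi> x else \<one>\<^bsub>T\<^esub>)" for x
  have \<zeta>: "\<zeta> x \<in> carrier T" for x using assms(3) by (simp add: \<zeta>_def)
  have \<zeta>_eq: "word_value T \<zeta> u = word_value T \<xi> u" if "u \<in> words S" for u
    by (rule word_value_cong[OF that]) (simp add: \<zeta>_def)
  have rel': "word_value T \<zeta> u = word_value T \<zeta> v" if "(u, v) \<in> R" for u v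
    using rel[OF that] \<zeta>_eq that assms(2) by auto
  define h where "h A = word_value T \<zeta> (SOME u. u \<in> A)" for A
  have h: "h (pres_class S R u) = word_value T \<zeta> u" for u
  proof -
    have "u \<in> pres_class S R u" by (simp add: pres_class_def pres_eq.refl)
    then have "(SOME u'. u' \<in> pres_class S R u) \<in> pres_class S R u" by (rule someI)
    then have "pres_eq S R u (SOME u'. u' \<in> pres_class S R u)" by (simp add: pres_class_def)
    then show ?thesis
      unfolding h_def by (intro T.word_value_pres_eq[symmetric, OF _ \<zeta> rel'])
  qed
  then show *: "h (pres_class S R u) = word_value T \<xi> u" if "u \<in> words S" for u
    using \<zeta>_eq that by simp
  show "h \<in> hom (presented_group S R) T"
    by (rule homI)
      (use T.word_value_closed[of S \<xi>] T.word_value_append[of S \<xi>] assms(3) in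
        \<open>auto simp: carrier_presented_group mult_presented_group *\<close>)
  show "h (pres_gen S R x) = \<xi> x" if "x \<in> S" for x
    using *[of "[(x, True)]"] that assms(3) by simp
qed

text \<open>
  The generators \<open>k i\<close> are kept next to the relators because homomorphisms out of \<open>K\<close> are specified
  on them. The von Dyck property itself cannot be part of a definition, as it quantifies over groups of all types.
\<close>

definition presents ::
    "('a, 'm) monoid_scheme \<Rightarrow> nat \<Rightarrow> (nat word \<times> nat word) set \<Rightarrow> (nat \<Rightarrow> 'a) \<Rightarrow> bool"
  where "presents K n R k \<longleftrightarrow> finite R \<and> R \<subseteq> words {..<n} \<times> words {..<n} \<and>
    (\<exists>\<phi>\<in>iso (presented_group {..<n} R) K. \<forall>i<n. k i = \<phi> (pres_gen {..<n} R i))"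

lemma finitely_presented_presents:
  assumes "finitely_presented K"
  obtains n R k where "presents K n R k"
proof -
  obtain n :: nat and R where R: "finite R" "R \<subseteq> words {..<n} \<times> words {..<n}"
      "K \<cong> presented_group {..<n} R" and K: "group K"
    using assms by (auto simp: finitely_presented_def)
  have "presented_group {..<n} R \<cong> K" using group.iso_sym[OF K R(3)] .
  then obtain \<phi> where "\<phi> \<in> iso (presented_group {..<n} R) K" by (auto simp: is_iso_def)
  then have "presents K n R (\<lambda>i. \<phi> (pres_gen {..<n} R i))"
    using R by (auto simp: presents_def)
  then show thesis by (rule that)
qed

lemma presentsD:
  assumes "presents K n R k" "group K"
  shows "finite R" "R \<subseteq> words {..<n} \<times> words {..<n}"
    and "\<And>i. i < n \<Longrightarrow> k i \<in> carrier K"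
    and "\<And>y. y \<in> carrier K \<Longrightarrow> \<exists>u\<in>words {..<n}. y = word_value K k u"
    and "\<And>u v. (u, v) \<in> R \<Longrightarrow> word_value K k u = word_value K k v"
proof -
  let ?P = "presented_group {..<n} R"
  obtain \<phi> where \<phi>: "\<phi> \<in> iso ?P K" "\<forall>i<n. k i = \<phi> (pres_gen {..<n} R i)"
    and R: "finite R" "R \<subseteq> words {..<n} \<times> words {..<n}"
    using assms by (auto simp: presents_def)
  show "finite R" "R \<subseteq> words {..<n} \<times> words {..<n}" by fact+
  have hom: "\<phi> \<in> hom ?P K" and img: "\<phi> ` carrier ?P = carrier K"
    using \<phi>(1) by (auto simp: iso_def bij_betw_def)
  have gen: "pres_gen {..<n} R i \<in> carrier ?P" if "i < n" for i
    using that by (auto simp: carrier_presented_group)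
  then show "k i \<in> carrier K" if "i < n" for i using that \<phi>(2) hom_in_carrier[OF hom] by simp
  have val: "word_value K k u = \<phi> (pres_class {..<n} R u)" if u: "u \<in> words {..<n}" for u
  proof -
    have "\<phi> (pres_class {..<n} R u) = \<phi> (word_value ?P (pres_gen {..<n} R) u)"
      by (simp add: word_value_pres_gen[OF u])
    also have "\<dots> = word_value K (\<lambda>i. \<phi> (pres_gen {..<n} R i)) u"
      using gen by (intro hom_word_value[OF hom group_presented_group assms(2) _ u]) auto
    also have "\<dots> = word_value K k u" using \<phi>(2) by (intro word_value_cong[OF u]) auto
    finally show ?thesis by simp
  qed
  show "\<exists>u\<in>words {..<n}. y = word_value K k u" if y: "y \<in> carrier K" for y
  proof -
    have "y \<in> \<phi> ` carrier ?P" using y by (simp only: img)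
    then obtain u where u: "u \<in> words {..<n}" "y = \<phi> (pres_class {..<n} R u)"
      unfolding carrier_presented_group by blast
    then show ?thesis using val[OF u(1)] by (intro bexI[of _ u]) simp_all
  qed
  show "word_value K k u = word_value K k v" if uv: "(u, v) \<in> R" for u v
  proof -
    have "pres_class {..<n} R u = pres_class {..<n} R v"
      unfolding pres_class_eq_iff by (rule pres_eq.relation[OF uv])
    then show ?thesis using val uv R(2) by auto
  qed
qed

lemma presents_von_Dyck:
  assumes "presents K n R k" "group K" "group T" "\<And>i. i < n \<Longrightarrow> \<tau> i \<in> carrier T"
    and "\<And>u v. (u, v) \<in> R \<Longrightarrow> word_value T \<tau> u = word_value T \<tau> v"
  obtains h where "h \<in> hom K T" "\<And>i. i < n \<Longrightarrow> h (k i) = \<tau> i"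
proof -
  let ?P = "presented_group {..<n} R"
  obtain \<phi> where \<phi>: "\<phi> \<in> iso ?P K" "\<forall>i<n. k i = \<phi> (pres_gen {..<n} R i)"
    and R: "R \<subseteq> words {..<n} \<times> words {..<n}"
    using assms(1) by (auto simp: presents_def)
  obtain h where h: "h \<in> hom ?P T" "\<And>i. i < n \<Longrightarrow> h (pres_gen {..<n} R i) = \<tau> i"
    by (rule von_Dyck[OF assms(3) R, of \<tau>]) (use assms(4,5) in auto)
  let ?\<psi> = "inv_into (carrier ?P) \<phi>"
  have "?\<psi> \<in> iso K ?P" by (rule group.iso_set_sym[OF group_presented_group \<phi>(1)])
  then have "?\<psi> \<in> hom K ?P" by (simp add: iso_def)
  then have "h \<circ> ?\<psi> \<in> hom K T" using h(1) by (rule hom_compose)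
  moreover have "(h \<circ> ?\<psi>) (k i) = \<tau> i" if i: "i < n" for i
  proof -
    have "pres_gen {..<n} R i \<in> carrier ?P" using i by (auto simp: carrier_presented_group)
    then have "?\<psi> (k i) = pres_gen {..<n} R i"
      using \<phi> i by (auto simp: iso_def bij_betw_def inv_into_f_f)
    then show ?thesis using h(2)[OF i] by simp
  qed
  ultimately show thesis by (rule that)
qed

lemma hom_eq_on_generators:
  assumes "group K" "group T" "h \<in> hom K T" "h' \<in> hom K T"
    and k: "\<And>i. i \<in> S \<Longrightarrow> k i \<in> carrier K" "\<And>i. i \<in> S \<Longrightarrow> h (k i) = h' (k i)"
    and y: "u \<in> words S" "y = word_value K k u"
  shows "h y = h' y"
proof -
  have "h y = word_value T (\<lambda>i. h (k i)) u"
    unfolding y(2) using k(1) by (intro hom_word_value[OF assms(3,1,2) _ y(1)])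
  also have "\<dots> = word_value T (\<lambda>i. h' (k i)) u" using k(2) by (intro word_value_cong[OF y(1)])
  also have "\<dots> = h' y"
    unfolding y(2) using k(1) by (intro hom_word_value[symmetric, OF assms(4,1,2) _ y(1)])
  finally show ?thesis .
qed

section \<open>Low-dimensional bar homology\<close>

lemma carrier_bar_chain_group:
  "c \<in> carrier (bar_chain_group n G) \<longleftrightarrow> Poly_Mapping.keys c \<subseteq> bar_simplices n G"
  by (simp add: bar_chain_group_def)

lemma bar_simplices_1: "bar_simplices 1 G = (\<lambda>x. [x]) ` carrier G"
  by (auto simp: bar_simplices_def length_Suc_conv image_iff)

lemma bar_simplices_2: "xs \<in> bar_simplices 2 G \<longleftrightarrow> (\<exists>x\<in>carrier G. \<exists>y\<in>carrier G. xs = [x, y])"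
  by (auto simp: bar_simplices_def length_Suc_conv numeral_2_eq_2)

lemma bar_simplices_3:
  "xs \<in> bar_simplices 3 G \<longleftrightarrow>
    (\<exists>x\<in>carrier G. \<exists>y\<in>carrier G. \<exists>z\<in>carrier G. xs = [x, y, z])"
  by (auto simp: bar_simplices_def length_Suc_conv numeral_3_eq_3)

lemma bar_simplex_boundary_1 [simp]: "bar_simplex_boundary G [x] = 0"
proof -
  have "{0<..<Suc 0} = {}" by auto
  then show ?thesis by (simp add: bar_simplex_boundary_def)
qed

lemma bar_simplex_boundary_2 [simp]:
  "bar_simplex_boundary G [x, y] = frag_of [y] - frag_of [x \<otimes>\<^bsub>G\<^esub> y] + frag_of [x]"
proof -
  have "{0<..<Suc (Suc 0)} = {1::nat}" by auto
  then show ?thesis by (simp add: bar_simplex_boundary_def)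
qed

lemma bar_simplex_boundary_3 [simp]:
  "bar_simplex_boundary G [x, y, z] =
    frag_of [y, z] - frag_of [x \<otimes>\<^bsub>G\<^esub> y, z] + frag_of [x, y \<otimes>\<^bsub>G\<^esub> z] - frag_of [x, y]"
proof -
  have "{0<..<Suc (Suc (Suc 0))} = {1::nat, 2}" by auto
  then show ?thesis by (simp add: bar_simplex_boundary_def)
qed

lemma bar_boundary_simps:
  "bar_boundary G 0 = 0"
  "bar_boundary G (c + d) = bar_boundary G c + bar_boundary G d"
  "bar_boundary G (c - d) = bar_boundary G c - bar_boundary G d"
  "bar_boundary G (frag_of xs) = bar_simplex_boundary G xs"
  "bar_boundary G (- c) = - bar_boundary G c"
  by (simp_all add: bar_boundary_def frag_extend_add frag_extend_diff frag_extend_minus)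

lemma bar_chain_map_simps:
  "bar_chain_map f 0 = 0"
  "bar_chain_map f (c + d) = bar_chain_map f c + bar_chain_map f d"
  "bar_chain_map f (c - d) = bar_chain_map f c - bar_chain_map f d"
  "bar_chain_map f (frag_of xs) = frag_of (map f xs)"
  "bar_chain_map f (- c) = - bar_chain_map f c"
  by (simp_all add: bar_chain_map_def frag_extend_add frag_extend_diff frag_extend_minus)

lemma bar_chain_diff_induct [consumes 1, case_names zero diff simplex]:
  assumes "c \<in> carrier (bar_chain_group n G)"
    and "P 0"
    and "\<And>c d. c \<in> carrier (bar_chain_group n G) \<Longrightarrow> d \<in> carrier (bar_chain_group n G) \<Longrightarrow>
           P c \<Longrightarrow> P d \<Longrightarrow> P (c - d)"
    and "\<And>xs. xs \<in> bar_simplices n G \<Longrightarrow> P (frag_of xs)"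
  shows "P c"
proof (rule free_Abelian_group_induct[of c "bar_simplices n G" P])
  show "Poly_Mapping.keys c \<subseteq> bar_simplices n G"
    using assms(1) by (simp only: carrier_bar_chain_group)
  show "P (a - b)"
    if "Poly_Mapping.keys a \<subseteq> bar_simplices n G" "Poly_Mapping.keys b \<subseteq> bar_simplices n G" "P a" "P b"
    for a b using assms(3) that by (simp only: carrier_bar_chain_group)
qed (fact assms)+

lemma carrier_bar_chain_group_closed:
  "0 \<in> carrier (bar_chain_group n G)"
  "c \<in> carrier (bar_chain_group n G) \<Longrightarrow> d \<in> carrier (bar_chain_group n G) \<Longrightarrow>
     c + d \<in> carrier (bar_chain_group n G)"
  "c \<in> carrier (bar_chain_group n G) \<Longrightarrow> d \<in> carrier (bar_chain_group n G) \<Longrightarrow>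
     c - d \<in> carrier (bar_chain_group n G)"
  "c \<in> carrier (bar_chain_group n G) \<Longrightarrow> - c \<in> carrier (bar_chain_group n G)"
  "frag_of xs \<in> carrier (bar_chain_group n G) \<longleftrightarrow> xs \<in> bar_simplices n G"
  unfolding carrier_bar_chain_group
  using keys_diff[of c d] keys_add[of c d] by auto

lemma bar_chain_map_closed:
  assumes "f \<in> hom G K" "c \<in> carrier (bar_chain_group n G)"
  shows "bar_chain_map f c \<in> carrier (bar_chain_group n K)"
  using assms(2)
proof (induction rule: bar_chain_diff_induct)
  case (simplex xs)
  then show ?case
    using assms(1) by (auto simp: bar_chain_map_simps carrier_bar_chain_group_closed bar_simplices_def hom_def)
qed (auto simp: bar_chain_map_simps carrier_bar_chain_group_closed)

lemma bar_boundary_1: "c \<in> carrier (bar_chain_group 1 G) \<Longrightarrow> bar_boundary G c = 0"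
  by (induction rule: bar_chain_diff_induct)
    (auto simp: bar_boundary_simps bar_simplices_1 simp del: One_nat_def)

lemma bar_boundary_natural_2:
  assumes "f \<in> hom G K" "c \<in> carrier (bar_chain_group 2 G)"
  shows "bar_chain_map f (bar_boundary G c) = bar_boundary K (bar_chain_map f c)"
  using assms(2)
  by (induction rule: bar_chain_diff_induct)
    (use assms(1) in \<open>auto simp: bar_boundary_simps bar_chain_map_simps bar_simplices_2 hom_def\<close>)

lemma bar_boundary_natural_3:
  assumes "f \<in> hom G K" "c \<in> carrier (bar_chain_group 3 G)"
  shows "bar_chain_map f (bar_boundary G c) = bar_boundary K (bar_chain_map f c)"
  using assms(2)
  by (induction rule: bar_chain_diff_induct)
    (use assms(1) in \<open>auto simp: bar_boundary_simps bar_chain_map_simps bar_simplices_3 hom_def\<close>)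

lemma bar_boundary_closed_2:
  assumes "group G" "c \<in> carrier (bar_chain_group 2 G)"
  shows "bar_boundary G c \<in> carrier (bar_chain_group 1 G)"
proof -
  interpret group G by fact
  show ?thesis using assms(2)
    by (induction rule: bar_chain_diff_induct)
      (auto simp: bar_boundary_simps carrier_bar_chain_group_closed bar_simplices_2 bar_simplices_1
        simp del: One_nat_def
        intro!: carrier_bar_chain_group_closed(2,3))
qed

lemma bar_boundary_closed_3:
  assumes "group G" "c \<in> carrier (bar_chain_group 3 G)"
  shows "bar_boundary G c \<in> carrier (bar_chain_group 2 G)"
proof -
  interpret group G by fact
  show ?thesis using assms(2)
    by (induction rule: bar_chain_diff_induct)
      (auto simp: bar_boundary_simps carrier_bar_chain_group_closed bar_simplices_2 bar_simplices_3
        intro!: carrier_bar_chain_group_closed(2,3))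
qed

lemma bar_boundary_boundary_3:
  assumes "group G" "c \<in> carrier (bar_chain_group 3 G)"
  shows "bar_boundary G (bar_boundary G c) = 0"
proof -
  interpret group G by fact
  show ?thesis using assms(2)
    by (induction rule: bar_chain_diff_induct)
      (auto simp: bar_boundary_simps bar_simplices_3 m_assoc)
qed

lemma bar_boundaries_closed:
  "0 \<in> bar_boundaries n G"
  "c \<in> bar_boundaries n G \<Longrightarrow> d \<in> bar_boundaries n G \<Longrightarrow> c + d \<in> bar_boundaries n G"
  "c \<in> bar_boundaries n G \<Longrightarrow> d \<in> bar_boundaries n G \<Longrightarrow> c - d \<in> bar_boundaries n G"
  "c \<in> bar_boundaries n G \<Longrightarrow> - c \<in> bar_boundaries n G"
proof -
  show "0 \<in> bar_boundaries n G"
    unfolding bar_boundaries_def image_iff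
    by (rule bexI[of _ 0]) (simp_all add: bar_boundary_simps carrier_bar_chain_group_closed)
  show "c + d \<in> bar_boundaries n G" if "c \<in> bar_boundaries n G" "d \<in> bar_boundaries n G"
    using that unfolding bar_boundaries_def
    by (auto simp flip: bar_boundary_simps(2) simp: carrier_bar_chain_group_closed intro!: imageI)
  show "c - d \<in> bar_boundaries n G" if "c \<in> bar_boundaries n G" "d \<in> bar_boundaries n G"
    using that unfolding bar_boundaries_def
    by (auto simp flip: bar_boundary_simps(3) simp: carrier_bar_chain_group_closed intro!: imageI)
  show "- c \<in> bar_boundaries n G" if "c \<in> bar_boundaries n G"
    using that unfolding bar_boundaries_def
    by (auto simp flip: bar_boundary_simps(5) simp: carrier_bar_chain_group_closed intro!: imageI)
qed

lemma bar_boundaries_1_subset: "group G \<Longrightarrow> bar_boundaries 1 G \<subseteq> carrier (bar_chain_group 1 G)"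
  using bar_boundary_closed_2[of G] by (auto simp: bar_boundaries_def numeral_2_eq_2)

lemma bar_boundaries_2_subset: "group G \<Longrightarrow> bar_boundaries 2 G \<subseteq> bar_cycles 2 G"
  using bar_boundary_closed_3[of G] bar_boundary_boundary_3[of G]
  by (auto simp: bar_boundaries_def bar_cycles_def numeral_2_eq_2 numeral_3_eq_3)

lemma bar_cycles_1: "bar_cycles 1 G = carrier (bar_chain_group 1 G)"
  using bar_boundary_1[of _ G] by (auto simp: bar_cycles_def)

lemma bar_chain_map_boundaries_1:
  "f \<in> hom G K \<Longrightarrow> c \<in> bar_boundaries 1 G \<Longrightarrow> bar_chain_map f c \<in> bar_boundaries 1 K"
  using bar_boundary_natural_2[of f G K] bar_chain_map_closed[of f G K _ 2]
  by (auto simp: bar_boundaries_def simp flip: numeral_2_eq_2)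

lemma bar_chain_map_boundaries_2:
  "f \<in> hom G K \<Longrightarrow> c \<in> bar_boundaries 2 G \<Longrightarrow> bar_chain_map f c \<in> bar_boundaries 2 K"
  using bar_boundary_natural_3[of f G K] bar_chain_map_closed[of f G K _ 3]
  by (auto simp: bar_boundaries_def)

lemma bar_chain_map_cycles_2:
  "f \<in> hom G K \<Longrightarrow> c \<in> bar_cycles 2 G \<Longrightarrow> bar_chain_map f c \<in> bar_cycles 2 K"
  using bar_boundary_natural_2[of f G K c] bar_chain_map_closed[of f G K c 2]
  by (auto simp: bar_cycles_def bar_chain_map_simps)

definition homology_class :: "nat \<Rightarrow> ('a, 'm) monoid_scheme \<Rightarrow> ('a list \<Rightarrow>\<^sub>0 int) \<Rightarrow> ('a list \<Rightarrow>\<^sub>0 int) set"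
  where "homology_class n G c = (\<lambda>b. b + c) ` bar_boundaries n G"

lemma homology_class_eq_iff:
  "homology_class n G c = homology_class n G d \<longleftrightarrow> c - d \<in> bar_boundaries n G"
proof
  assume "homology_class n G c = homology_class n G d"
  then have "c \<in> homology_class n G d"
    using bar_boundaries_closed(1)[of n G] by (force simp: homology_class_def)
  then show "c - d \<in> bar_boundaries n G" by (auto simp: homology_class_def)
next
  have *: "homology_class n G c \<subseteq> homology_class n G d" if cd: "c - d \<in> bar_boundaries n G" for c d
  proof
    fix x assume "x \<in> homology_class n G c"
    then obtain b where "b \<in> bar_boundaries n G" "x = b + c" by (auto simp: homology_class_def)
    then have "b + (c - d) \<in> bar_boundaries n G" "x = (b + (c - d)) + d"
      using cd bar_boundaries_closed(2) by auto
    then show "x \<in> homology_class n G d" unfolding homology_class_def by blast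
  qed
  assume "c - d \<in> bar_boundaries n G"
  then show "homology_class n G c = homology_class n G d"
    using *[of c d] *[of d c] bar_boundaries_closed(4)[of "c - d" n G] by fastforce
qed

lemma carrier_group_homology: "carrier (group_homology n G) = homology_class n G ` bar_cycles n G"
  by (auto simp: group_homology_def FactGroup_def RCOSETS_def r_coset_def homology_class_def
      bar_chain_group_def image_def)

lemma mult_group_homology:
  "homology_class n G c \<otimes>\<^bsub>group_homology n G\<^esub> homology_class n G d = homology_class n G (c + d)"
proof -
  have "homology_class n G c \<otimes>\<^bsub>group_homology n G\<^esub> homology_class n G d =
      {(b + c) + (b' + d) |b b'. b \<in> bar_boundaries n G \<and> b' \<in> bar_boundaries n G}"
    by (auto simp: group_homology_def FactGroup_def set_mult_def homology_class_def bar_chain_group_def)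
  also have "\<dots> = homology_class n G (c + d)"
  proof (rule subset_antisym; rule subsetI)
    fix x assume "x \<in> {(b + c) + (b' + d) |b b'. b \<in> bar_boundaries n G \<and> b' \<in> bar_boundaries n G}"
    then obtain b b' where b: "b \<in> bar_boundaries n G" "b' \<in> bar_boundaries n G"
      and x: "x = (b + c) + (b' + d)" by blast
    have "x = (b + b') + (c + d)" by (simp add: x algebra_simps)
    then show "x \<in> homology_class n G (c + d)"
      using b bar_boundaries_closed(2) unfolding homology_class_def by blast
  next
    fix x assume "x \<in> homology_class n G (c + d)"
    then obtain b where b: "b \<in> bar_boundaries n G" and x: "x = b + (c + d)"
      by (auto simp: homology_class_def)
    have "x = (b + c) + (0 + d)" by (simp add: x algebra_simps)
    then show "x \<in> {(b + c) + (b' + d) |b b'. b \<in> bar_boundaries n G \<and> b' \<in> bar_boundaries n G}"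
      using b bar_boundaries_closed(1) by blast
  qed
  finally show ?thesis .
qed

lemma group_homology_map_class:
  assumes "\<And>b. b \<in> bar_boundaries n G \<Longrightarrow> bar_chain_map f b \<in> bar_boundaries n K"
  shows "group_homology_map n K f (homology_class n G c) = homology_class n K (bar_chain_map f c)"
proof -
  have "group_homology_map n K f (homology_class n G c) =
      {b + bar_chain_map f (b' + c) |b b'. b \<in> bar_boundaries n K \<and> b' \<in> bar_boundaries n G}"
    by (auto simp: group_homology_map_def set_mult_def homology_class_def bar_chain_group_def)
  also have "\<dots> = homology_class n K (bar_chain_map f c)"
  proof (rule subset_antisym; rule subsetI)
    fix x assume "x \<in> {b + bar_chain_map f (b' + c) |b b'. b \<in> bar_boundaries n K \<and> b' \<in> bar_boundaries n G}"
    then obtain b b' where b: "b \<in> bar_boundaries n K" "b' \<in> bar_boundaries n G"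
      and x: "x = b + bar_chain_map f (b' + c)" by blast
    have "x = (b + bar_chain_map f b') + bar_chain_map f c" by (simp add: x bar_chain_map_simps)
    then show "x \<in> homology_class n K (bar_chain_map f c)"
      using b assms bar_boundaries_closed(2) unfolding homology_class_def by blast
  next
    fix x assume "x \<in> homology_class n K (bar_chain_map f c)"
    then obtain b where b: "b \<in> bar_boundaries n K" and x: "x = b + bar_chain_map f c"
      by (auto simp: homology_class_def)
    have "x = b + bar_chain_map f (0 + c)" by (simp add: x)
    then show "x \<in> {b + bar_chain_map f (b' + c) |b b'. b \<in> bar_boundaries n K \<and> b' \<in> bar_boundaries n G}"
      using b bar_boundaries_closed(1) by blast
  qed
  finally show ?thesis .
qed

text \<open>
  Cosets of boundaries are unpacked once and for all; every later argument works with chains.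
\<close>

lemma two_connected_iff:
  assumes "group G" "group K"
  shows "two_connected G K f \<longleftrightarrow> f \<in> hom G K \<and>
    (\<forall>c\<in>carrier (bar_chain_group 1 K). \<exists>d\<in>carrier (bar_chain_group 1 G).
        c - bar_chain_map f d \<in> bar_boundaries 1 K) \<and>
    (\<forall>c\<in>carrier (bar_chain_group 1 G). bar_chain_map f c \<in> bar_boundaries 1 K \<longrightarrow>
        c \<in> bar_boundaries 1 G) \<and>
    (\<forall>z\<in>bar_cycles 2 K. \<exists>w\<in>bar_cycles 2 G. z - bar_chain_map f w \<in> bar_boundaries 2 K)"
proof (cases "f \<in> hom G K")
  case False
  then show ?thesis by (simp add: two_connected_def)
next
  case f: True
  have map1: "group_homology_map 1 K f (homology_class 1 G c) = homology_class 1 K (bar_chain_map f c)"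
    for c by (rule group_homology_map_class) (rule bar_chain_map_boundaries_1[OF f])
  have map2: "group_homology_map 2 K f (homology_class 2 G c) = homology_class 2 K (bar_chain_map f c)"
    for c by (rule group_homology_map_class) (rule bar_chain_map_boundaries_2[OF f])
  let ?\<phi> = "group_homology_map 1 K f"
  have car1: "carrier (group_homology 1 G') = homology_class 1 G' ` carrier (bar_chain_group 1 G')"
    for G' :: "('x, 'y) monoid_scheme"
    by (simp only: carrier_group_homology bar_cycles_1)
  have hom: "?\<phi> \<in> hom (group_homology 1 G) (group_homology 1 K)"
    unfolding hom_def car1
    using bar_chain_map_closed[OF f, of _ 1]
    by (auto simp: map1 mult_group_homology bar_chain_map_simps simp del: One_nat_def)
  have inj: "inj_on ?\<phi> (carrier (group_homology 1 G)) \<longleftrightarrow>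
     (\<forall>c\<in>carrier (bar_chain_group 1 G). bar_chain_map f c \<in> bar_boundaries 1 K \<longrightarrow>
        c \<in> bar_boundaries 1 G)" (is "?L \<longleftrightarrow> ?R")
  proof
    assume ?L
    show ?R
    proof (intro ballI impI)
      fix c assume c: "c \<in> carrier (bar_chain_group 1 G)" "bar_chain_map f c \<in> bar_boundaries 1 K"
      have "?\<phi> (homology_class 1 G c) = ?\<phi> (homology_class 1 G 0)"
        using c(2) by (simp add: map1 homology_class_eq_iff bar_chain_map_simps del: One_nat_def)
      then have "homology_class 1 G c = homology_class 1 G 0"
        using \<open>?L\<close> c(1) unfolding inj_on_def car1
        by (meson carrier_bar_chain_group_closed(1) imageI)
      then show "c \<in> bar_boundaries 1 G" by (simp add: homology_class_eq_iff)
    qed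
  next
    assume ?R
    then show ?L
      unfolding inj_on_def car1
      by (auto simp: map1 homology_class_eq_iff carrier_bar_chain_group_closed
          simp flip: bar_chain_map_simps(3) simp del: One_nat_def)
  qed
  have surj: "?\<phi> ` carrier (group_homology 1 G) = carrier (group_homology 1 K) \<longleftrightarrow>
    (\<forall>c\<in>carrier (bar_chain_group 1 K). \<exists>d\<in>carrier (bar_chain_group 1 G).
        c - bar_chain_map f d \<in> bar_boundaries 1 K)" (is "?L \<longleftrightarrow> ?R")
  proof -
    have "?\<phi> ` carrier (group_homology 1 G) \<subseteq> carrier (group_homology 1 K)"
      using hom by (auto simp: hom_def)
    then have "?L \<longleftrightarrow> carrier (group_homology 1 K) \<subseteq> ?\<phi> ` carrier (group_homology 1 G)" by blast
    also have "\<dots> \<longleftrightarrow> (\<forall>c\<in>carrier (bar_chain_group 1 K). \<exists>d\<in>carrier (bar_chain_group 1 G).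
        homology_class 1 K c = homology_class 1 K (bar_chain_map f d))"
      by (simp only: car1 image_image map1 image_subset_iff image_iff)
    also have "\<dots> \<longleftrightarrow> ?R"
      by (simp only: homology_class_eq_iff)
    finally show ?thesis .
  qed
  have surj2: "group_homology_map 2 K f ` carrier (group_homology 2 G) = carrier (group_homology 2 K)
    \<longleftrightarrow> (\<forall>z\<in>bar_cycles 2 K. \<exists>w\<in>bar_cycles 2 G. z - bar_chain_map f w \<in> bar_boundaries 2 K)"
    (is "?L \<longleftrightarrow> ?R")
  proof -
    have "group_homology_map 2 K f ` carrier (group_homology 2 G) \<subseteq> carrier (group_homology 2 K)"
      using bar_chain_map_cycles_2[OF f] by (auto simp: carrier_group_homology map2)
    then have "?L \<longleftrightarrow> carrier (group_homology 2 K) \<subseteq>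
        group_homology_map 2 K f ` carrier (group_homology 2 G)" by blast
    also have "\<dots> \<longleftrightarrow> ?R"
      by (simp only: carrier_group_homology image_image map2 image_subset_iff image_iff
          homology_class_eq_iff)
    finally show ?thesis .
  qed
  show ?thesis
    unfolding two_connected_def iso_def bij_betw_def mem_Collect_eq inj surj surj2
    using f hom by blast
qed

section \<open>Quotient groups and homomorphisms on bar chains\<close>

lemma (in group) inv_cancel_left [simp]:
  assumes "x \<in> carrier G" "y \<in> carrier G"
  shows "inv x \<otimes> (x \<otimes> y) = y" "x \<otimes> (inv x \<otimes> y) = y"
  using assms by (simp_all flip: m_assoc)

lemmas (in group) word_simps = m_assoc inv_mult_group

lemma normal_quotient:
  assumes "N \<lhd> G"
  shows "group (G Mod N)" "(\<lambda>x. r_coset G N x) \<in> hom G (G Mod N)"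
    and "\<And>x y. x \<in> carrier G \<Longrightarrow> y \<in> carrier G \<Longrightarrow>
      r_coset G N x = r_coset G N y \<longleftrightarrow> x \<otimes>\<^bsub>G\<^esub> inv\<^bsub>G\<^esub> y \<in> N"
    and "\<And>x. x \<in> carrier G \<Longrightarrow> r_coset G N x = \<one>\<^bsub>G Mod N\<^esub> \<longleftrightarrow> x \<in> N"
    and "carrier (G Mod N) = (\<lambda>x. r_coset G N x) ` carrier G"
proof -
  interpret N: normal N G by fact
  note is_subgroup = N.subgroup_axioms
  show "group (G Mod N)" by (rule N.factorgroup_is_group)
  show "(\<lambda>x. r_coset G N x) \<in> hom G (G Mod N)" by (rule N.r_coset_hom_Mod)
  show coset_eq: "r_coset G N x = r_coset G N y \<longleftrightarrow> x \<otimes>\<^bsub>G\<^esub> inv\<^bsub>G\<^esub> y \<in> N"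
    if "x \<in> carrier G" "y \<in> carrier G" for x y
  proof
    assume "r_coset G N x = r_coset G N y"
    then have "x \<in> r_coset G N y" using N.rcos_self[OF that(1) is_subgroup] by simp
    then obtain n where "n \<in> N" "x = n \<otimes>\<^bsub>G\<^esub> y" by (auto simp: r_coset_def)
    then show "x \<otimes>\<^bsub>G\<^esub> inv\<^bsub>G\<^esub> y \<in> N" using that by (simp add: N.word_simps)
  next
    assume *: "x \<otimes>\<^bsub>G\<^esub> inv\<^bsub>G\<^esub> y \<in> N"
    have "x = (x \<otimes>\<^bsub>G\<^esub> inv\<^bsub>G\<^esub> y) \<otimes>\<^bsub>G\<^esub> y" using that by (simp add: N.word_simps)
    then have "x \<in> r_coset G N y" using * unfolding r_coset_def by blast
    then show "r_coset G N x = r_coset G N y"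
      using N.repr_independence[OF _ that(2) is_subgroup] by simp
  qed
  show "r_coset G N x = \<one>\<^bsub>G Mod N\<^esub> \<longleftrightarrow> x \<in> N" if "x \<in> carrier G" for x
    using coset_eq[of x "\<one>\<^bsub>G\<^esub>"] that by (simp add: N.coset_mult_one N.subset)
  show "carrier (G Mod N) = (\<lambda>x. r_coset G N x) ` carrier G" by (rule carrier_FactGroup)
qed

text \<open>
  Bar chains are written additively and their targets multiplicatively; these rules translate.
\<close>

lemma hom_bar_chain_simps:
  assumes "h \<in> hom (bar_chain_group n G) A" "group A"
    and "c \<in> carrier (bar_chain_group n G)" "d \<in> carrier (bar_chain_group n G)"
  shows "h (c + d) = h c \<otimes>\<^bsub>A\<^esub> h d" "h (c - d) = h c \<otimes>\<^bsub>A\<^esub> inv\<^bsub>A\<^esub> h d" "h c \<in> carrier A"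
    "h 0 = \<one>\<^bsub>A\<^esub>" "h (- c) = inv\<^bsub>A\<^esub> h c"
proof -
  have grp: "group (bar_chain_group n G)" by (simp add: bar_chain_group_def)
  interpret group_hom "bar_chain_group n G" A h
    using assms grp by (simp add: group_hom_def group_hom_axioms_def)
  have inv: "inv\<^bsub>bar_chain_group n G\<^esub> c = - c" if "c \<in> carrier (bar_chain_group n G)" for c
    using that by (simp add: bar_chain_group_def)
  have mult: "x \<otimes>\<^bsub>bar_chain_group n G\<^esub> y = x + y" for x y
    by (simp add: bar_chain_group_def)
  show "h (c + d) = h c \<otimes>\<^bsub>A\<^esub> h d" using hom_mult[OF assms(3,4)] by (simp add: mult)
  show minus: "h (- c) = inv\<^bsub>A\<^esub> h c"
    using hom_inv[OF assms(3)] inv[OF assms(3)] by simp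
  show "h (c - d) = h c \<otimes>\<^bsub>A\<^esub> inv\<^bsub>A\<^esub> h d"
    using hom_mult[OF assms(3) G.inv_closed[OF assms(4)]] hom_inv[OF assms(4)] inv[OF assms(4)]
    by (simp add: mult)
  show "h c \<in> carrier A" using assms(3) by simp
  show "h 0 = \<one>\<^bsub>A\<^esub>" using hom_one by (simp add: bar_chain_group_def)
qed

lemma bar_chain_hom_exists:
  assumes "comm_group A" "\<And>xs. xs \<in> bar_simplices n G \<Longrightarrow> \<psi> xs \<in> carrier A"
  obtains h where "h \<in> hom (bar_chain_group n G) A"
    "\<And>xs. xs \<in> bar_simplices n G \<Longrightarrow> h (frag_of xs) = \<psi> xs"
  using comm_group.free_Abelian_group_universal[OF assms(1), of \<psi> "bar_simplices n G"] assms(2)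
  by (auto simp: bar_chain_group_def)

lemma bar_chain_map_compose: "bar_chain_map q (bar_chain_map f c) = bar_chain_map (q \<circ> f) c"
  using frag_extend_compose[of "frag_of \<circ> map q" "map f" c]
  by (simp add: bar_chain_map_def comp_def)

lemma bar_chain_map_cong:
  assumes "c \<in> carrier (bar_chain_group n G)" "\<And>x. x \<in> carrier G \<Longrightarrow> f x = g x"
  shows "bar_chain_map f c = bar_chain_map g c"
  unfolding bar_chain_map_def
proof (rule frag_extend_eq)
  fix xs assume "xs \<in> Poly_Mapping.keys c"
  then have "set xs \<subseteq> carrier G"
    using assms(1) by (auto simp: carrier_bar_chain_group bar_simplices_def)
  then show "frag_of (map f xs) = frag_of (map g xs)"
    using assms(2) by (metis map_ext subsetD)
qed

section \<open>Stallings' theorem for extensions\<close>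

text \<open>
  A section of \<open>q\<close> has a 2-cocycle \<open>\<gamma>\<close> with values in the central kernel \<open>A\<close>. Evaluation of \<open>\<gamma>\<close> on 2-cycles
  vanishes on those coming from \<open>G\<close>, because \<open>G\<close> lifts to \<open>E\<close>; since \<open>f\<close> is onto in degree 2 it vanishes on
  all 2-cycles of \<open>K\<close>, which says that \<open>A\<close> injects into the first homology of \<open>E\<close>. But \<open>A\<close> is trivial there,
  because that homology comes from \<open>G\<close> and \<open>f\<close> is injective in degree 1.
\<close>

lemma central_kernel_trivial:
  assumes grp: "group G" "group K" "group E"
    and q: "q \<in> hom E K" "q ` carrier E = carrier K"
    and central: "\<And>n e. n \<in> carrier E \<Longrightarrow> q n = \<one>\<^bsub>K\<^esub> \<Longrightarrow> e \<in> carrier E \<Longrightarrow>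
      n \<otimes>\<^bsub>E\<^esub> e = e \<otimes>\<^bsub>E\<^esub> n"
    and \<phi>: "\<phi> \<in> hom G E" "\<And>x. x \<in> carrier G \<Longrightarrow> q (\<phi> x) = f x"
    and f: "two_connected G K f"
    and H1: "\<And>e. e \<in> carrier E \<Longrightarrow> \<exists>c\<in>carrier (bar_chain_group 1 G).
      frag_of [e] - bar_chain_map \<phi> c \<in> bar_boundaries 1 E"
    and n: "n \<in> carrier E" "q n = \<one>\<^bsub>K\<^esub>"
  shows "n = \<one>\<^bsub>E\<^esub>"
proof -
  interpret G: group G by fact
  interpret K: group K by fact
  interpret E: group E by fact
  interpret q: group_hom E K q using q by (simp add: group_hom_def group_hom_axioms_def grp)
  have f_hom: "f \<in> hom G K" using f by (simp add: two_connected_def)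
  note f_conn = f[unfolded two_connected_iff[OF grp(1,2)]]
  define A where "A = E\<lparr>carrier := {x \<in> carrier E. q x = \<one>\<^bsub>K\<^esub>}\<rparr>"
  have subA: "subgroup {x \<in> carrier E. q x = \<one>\<^bsub>K\<^esub>} E"
    by (rule E.subgroupI) auto
  have carA: "x \<in> carrier A \<longleftrightarrow> x \<in> carrier E \<and> q x = \<one>\<^bsub>K\<^esub>" for x by (simp add: A_def)
  have multA: "x \<otimes>\<^bsub>A\<^esub> y = x \<otimes>\<^bsub>E\<^esub> y" and oneA: "\<one>\<^bsub>A\<^esub> = \<one>\<^bsub>E\<^esub>" for x y by (simp_all add: A_def)
  have "group A" unfolding A_def by (rule E.subgroup_imp_group[OF subA])
  then interpret A: comm_group A
    by (rule group.group_comm_groupI) (use central in \<open>auto simp: carA multA\<close>)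
  define \<sigma> where "\<sigma> k = (SOME e. e \<in> carrier E \<and> q e = k)" for k
  have \<sigma>: "\<sigma> k \<in> carrier E" "q (\<sigma> k) = k" if "k \<in> carrier K" for k
  proof -
    have "k \<in> q ` carrier E" using that by (simp only: q(2))
    then have "\<exists>e. e \<in> carrier E \<and> q e = k" by auto
    from someI_ex[OF this] show "\<sigma> k \<in> carrier E" "q (\<sigma> k) = k" by (simp_all add: \<sigma>_def)
  qed
  define \<gamma> where "\<gamma> x y = \<sigma> x \<otimes>\<^bsub>E\<^esub> \<sigma> y \<otimes>\<^bsub>E\<^esub> inv\<^bsub>E\<^esub> \<sigma> (x \<otimes>\<^bsub>K\<^esub> y)" for x y
  have \<gamma>A: "\<gamma> x y \<in> carrier A" if "x \<in> carrier K" "y \<in> carrier K" for x y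
    using that by (simp add: \<gamma>_def carA \<sigma>)
  have \<gamma>_cancel: "\<gamma> x y \<otimes>\<^bsub>E\<^esub> \<sigma> (x \<otimes>\<^bsub>K\<^esub> y) = \<sigma> x \<otimes>\<^bsub>E\<^esub> \<sigma> y"
    if "x \<in> carrier K" "y \<in> carrier K" for x y
    using that by (simp add: \<gamma>_def \<sigma> E.word_simps)
  define \<alpha> where "\<alpha> e = e \<otimes>\<^bsub>E\<^esub> inv\<^bsub>E\<^esub> \<sigma> (q e)" for e
  have \<alpha>A: "\<alpha> e \<in> carrier A" if "e \<in> carrier E" for e
    using that by (simp add: \<alpha>_def carA \<sigma>)
  have \<alpha>_cancel: "\<alpha> e \<otimes>\<^bsub>E\<^esub> \<sigma> (q e) = e" if "e \<in> carrier E" for e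
    using that by (simp add: \<alpha>_def \<sigma> E.word_simps)
  have \<alpha>_simplex: "\<alpha> (xs ! 0) \<in> carrier A" if "xs \<in> bar_simplices 1 E" for xs
    using that \<alpha>A unfolding bar_simplices_1 by auto
  have \<gamma>_simplex: "\<gamma> (xs ! 0) (xs ! 1) \<in> carrier A" if "xs \<in> bar_simplices 2 K" for xs
    using that \<gamma>A unfolding bar_simplices_2 by auto
  obtain h1 where h1: "h1 \<in> hom (bar_chain_group 1 E) A"
      and h1_of: "\<And>xs. xs \<in> bar_simplices 1 E \<Longrightarrow> h1 (frag_of xs) = \<alpha> (xs ! 0)"
    by (rule bar_chain_hom_exists[OF A.comm_group_axioms, OF \<alpha>_simplex]) blast+
  obtain h2 where h2: "h2 \<in> hom (bar_chain_group 2 K) A"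
      and h2_of: "\<And>xs. xs \<in> bar_simplices 2 K \<Longrightarrow> h2 (frag_of xs) = \<gamma> (xs ! 0) (xs ! 1)"
    by (rule bar_chain_hom_exists[OF A.comm_group_axioms, OF \<gamma>_simplex]) blast+
  note h1s = hom_bar_chain_simps[OF h1 A.group_axioms]
  note h2s = hom_bar_chain_simps[OF h2 A.group_axioms]
  have h1_1: "h1 (frag_of [e]) = \<alpha> e" if "e \<in> carrier E" for e
    using h1_of[of "[e]"] that by (simp add: bar_simplices_1 del: One_nat_def)
  have h2_2: "h2 (frag_of [x, y]) = \<gamma> x y" if "x \<in> carrier K" "y \<in> carrier K" for x y
    using h2_of[of "[x, y]"] that by (simp add: bar_simplices_2)
  (* On E the pullback of the cocycle is the coboundary of the retraction e |-> e / sigma (q e). *)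
  have 1: "h1 (bar_boundary E b) \<otimes>\<^bsub>A\<^esub> h2 (bar_chain_map q b) = \<one>\<^bsub>A\<^esub>"
    if "b \<in> carrier (bar_chain_group 2 E)" for b
    using that
  proof (induction rule: bar_chain_diff_induct)
    case zero
    show ?case
      using h1s(4) h2s(4) carrier_bar_chain_group_closed(1)
      by (metis A.l_one A.one_closed bar_boundary_simps(1) bar_chain_map_simps(1))
  next
    case (diff c d)
    note cl = bar_boundary_closed_2[OF grp(3)] bar_chain_map_closed[OF q(1)]
    let ?p = "h1 (bar_boundary E c)" and ?r = "h1 (bar_boundary E d)"
    let ?u = "h2 (bar_chain_map q c)" and ?v = "h2 (bar_chain_map q d)"
    have in_A: "?p \<in> carrier A" "?r \<in> carrier A" "?u \<in> carrier A" "?v \<in> carrier A"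
      using cl[OF diff(1)] cl[OF diff(2)] h1s(3) h2s(3) by blast+
    have "h1 (bar_boundary E (c - d)) \<otimes>\<^bsub>A\<^esub> h2 (bar_chain_map q (c - d)) =
        (?p \<otimes>\<^bsub>A\<^esub> inv\<^bsub>A\<^esub> ?r) \<otimes>\<^bsub>A\<^esub> (?u \<otimes>\<^bsub>A\<^esub> inv\<^bsub>A\<^esub> ?v)"
      using cl[OF diff(1)] cl[OF diff(2)] by (simp add: bar_boundary_simps bar_chain_map_simps h1s h2s)
    also have "\<dots> = (?p \<otimes>\<^bsub>A\<^esub> ?u) \<otimes>\<^bsub>A\<^esub> inv\<^bsub>A\<^esub> (?r \<otimes>\<^bsub>A\<^esub> ?v)"
      using in_A by (simp add: A.inv_mult A.m_ac)
    finally show ?case using diff by simp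
  next
    case (simplex xs)
    then obtain x y where xy: "x \<in> carrier E" "y \<in> carrier E" "xs = [x, y]"
      by (auto simp: bar_simplices_2)
    let ?s = "\<lambda>z. \<sigma> (q z)"
    have sE: "?s z \<in> carrier E" if "z \<in> carrier E" for z using \<sigma> that by simp
    have aE: "\<alpha> z \<in> carrier E" if "z \<in> carrier E" for z using \<alpha>A[OF that] by (simp add: carA)
    have cE: "\<gamma> (q x) (q y) \<in> carrier E" using \<gamma>A xy by (simp add: carA)
    have "x \<otimes>\<^bsub>E\<^esub> y = (\<alpha> x \<otimes>\<^bsub>E\<^esub> ?s x) \<otimes>\<^bsub>E\<^esub> (\<alpha> y \<otimes>\<^bsub>E\<^esub> ?s y)"
      using xy by (simp add: \<alpha>_cancel)
    also have "\<dots> = \<alpha> x \<otimes>\<^bsub>E\<^esub> \<alpha> y \<otimes>\<^bsub>E\<^esub> (?s x \<otimes>\<^bsub>E\<^esub> ?s y)"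
      using central[of "\<alpha> y" "?s x"] \<alpha>A[OF xy(2)] xy sE aE
      by (simp add: carA E.m_assoc) (metis E.m_assoc)
    also have "\<dots> = \<alpha> x \<otimes>\<^bsub>E\<^esub> \<alpha> y \<otimes>\<^bsub>E\<^esub> \<gamma> (q x) (q y) \<otimes>\<^bsub>E\<^esub> ?s (x \<otimes>\<^bsub>E\<^esub> y)"
      using xy \<gamma>_cancel[of "q x" "q y"] sE aE cE \<sigma>(1)[of "q x \<otimes>\<^bsub>K\<^esub> q y"]
      by (simp add: E.m_assoc)
    finally have prod: "x \<otimes>\<^bsub>E\<^esub> y =
        \<alpha> x \<otimes>\<^bsub>E\<^esub> \<alpha> y \<otimes>\<^bsub>E\<^esub> \<gamma> (q x) (q y) \<otimes>\<^bsub>E\<^esub> ?s (x \<otimes>\<^bsub>E\<^esub> y)" .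
    have "\<alpha> (x \<otimes>\<^bsub>E\<^esub> y) \<otimes>\<^bsub>E\<^esub> ?s (x \<otimes>\<^bsub>E\<^esub> y) =
        (\<alpha> x \<otimes>\<^bsub>E\<^esub> \<alpha> y \<otimes>\<^bsub>E\<^esub> \<gamma> (q x) (q y)) \<otimes>\<^bsub>E\<^esub> ?s (x \<otimes>\<^bsub>E\<^esub> y)"
      by (rule HOL.trans[OF \<alpha>_cancel[OF E.m_closed[OF xy(1) xy(2)]] prod])
    then have eq: "\<alpha> (x \<otimes>\<^bsub>E\<^esub> y) = \<alpha> x \<otimes>\<^bsub>A\<^esub> \<alpha> y \<otimes>\<^bsub>A\<^esub> \<gamma> (q x) (q y)"
      using E.right_cancel[of "?s (x \<otimes>\<^bsub>E\<^esub> y)" "\<alpha> (x \<otimes>\<^bsub>E\<^esub> y)" "\<alpha> x \<otimes>\<^bsub>E\<^esub> \<alpha> y \<otimes>\<^bsub>E\<^esub> \<gamma> (q x) (q y)"]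
        xy sE[of "x \<otimes>\<^bsub>E\<^esub> y"] aE cE by (simp add: multA)
    have A: "\<alpha> x \<in> carrier A" "\<alpha> y \<in> carrier A" "\<gamma> (q x) (q y) \<in> carrier A"
      using xy \<alpha>A \<gamma>A by simp_all
    have in1: "frag_of [z] \<in> carrier (bar_chain_group 1 E)" if "z \<in> carrier E" for z
      using that by (simp add: carrier_bar_chain_group_closed bar_simplices_1 del: One_nat_def)
    have "h1 (bar_boundary E (frag_of xs)) = \<alpha> y \<otimes>\<^bsub>A\<^esub> inv\<^bsub>A\<^esub> \<alpha> (x \<otimes>\<^bsub>E\<^esub> y) \<otimes>\<^bsub>A\<^esub> \<alpha> x"
      using xy in1 by (simp add: bar_boundary_simps h1s h1_1 carrier_bar_chain_group_closed(3))
    also have "\<dots> = (\<alpha> x \<otimes>\<^bsub>A\<^esub> \<alpha> y) \<otimes>\<^bsub>A\<^esub> inv\<^bsub>A\<^esub> ((\<alpha> x \<otimes>\<^bsub>A\<^esub> \<alpha> y) \<otimes>\<^bsub>A\<^esub> \<gamma> (q x) (q y))"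
      unfolding eq using A by (simp add: A.m_ac)
    also have "\<dots> = inv\<^bsub>A\<^esub> \<gamma> (q x) (q y)"
      using A by (simp add: A.inv_mult A.m_assoc)
        (simp add: A.m_lcomm[of "\<alpha> y"])
    finally show ?case
      using A xy by (simp add: bar_chain_map_simps h2_2)
  qed
  (* This is the cocycle identity. *)
  have 2: "h2 (bar_boundary K t) = \<one>\<^bsub>A\<^esub>" if "t \<in> carrier (bar_chain_group 3 K)" for t
    using that
  proof (induction rule: bar_chain_diff_induct)
    case zero
    then show ?case
      using h2s(4) carrier_bar_chain_group_closed(1) by (metis bar_boundary_simps(1))
  next
    case (diff c d)
    then show ?case
      using bar_boundary_closed_3[OF grp(2)] by (simp add: bar_boundary_simps h2s)
  next
    case (simplex xs)
    then obtain x y w where xyw: "x \<in> carrier K" "y \<in> carrier K" "w \<in> carrier K" "xs = [x, y, w]"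
      by (auto simp: bar_simplices_3)
    have cE: "\<gamma> u v \<in> carrier E" if "u \<in> carrier K" "v \<in> carrier K" for u v
      using \<gamma>A that by (simp add: carA)
    have "\<gamma> x y \<otimes>\<^bsub>E\<^esub> \<gamma> (x \<otimes>\<^bsub>K\<^esub> y) w \<otimes>\<^bsub>E\<^esub> \<sigma> (x \<otimes>\<^bsub>K\<^esub> y \<otimes>\<^bsub>K\<^esub> w) =
        \<sigma> x \<otimes>\<^bsub>E\<^esub> \<sigma> y \<otimes>\<^bsub>E\<^esub> \<sigma> w"
      using xyw cE \<sigma> \<gamma>_cancel[of "x \<otimes>\<^bsub>K\<^esub> y" w] \<gamma>_cancel[of x y]
      by (simp add: E.m_assoc) (metis E.m_assoc K.m_closed)
    moreover have "\<gamma> y w \<otimes>\<^bsub>E\<^esub> \<gamma> x (y \<otimes>\<^bsub>K\<^esub> w) \<otimes>\<^bsub>E\<^esub> \<sigma> (x \<otimes>\<^bsub>K\<^esub> y \<otimes>\<^bsub>K\<^esub> w) =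
        \<sigma> x \<otimes>\<^bsub>E\<^esub> \<sigma> y \<otimes>\<^bsub>E\<^esub> \<sigma> w"
    proof -
      have "\<gamma> y w \<otimes>\<^bsub>E\<^esub> \<gamma> x (y \<otimes>\<^bsub>K\<^esub> w) \<otimes>\<^bsub>E\<^esub> \<sigma> (x \<otimes>\<^bsub>K\<^esub> y \<otimes>\<^bsub>K\<^esub> w) =
          \<gamma> y w \<otimes>\<^bsub>E\<^esub> \<sigma> x \<otimes>\<^bsub>E\<^esub> \<sigma> (y \<otimes>\<^bsub>K\<^esub> w)"
        using xyw cE \<sigma> \<gamma>_cancel[of x "y \<otimes>\<^bsub>K\<^esub> w"] by (simp add: E.m_assoc K.m_assoc)
      also have "\<dots> = \<sigma> x \<otimes>\<^bsub>E\<^esub> (\<gamma> y w \<otimes>\<^bsub>E\<^esub> \<sigma> (y \<otimes>\<^bsub>K\<^esub> w))"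
        using xyw cE \<sigma> central[of "\<gamma> y w" "\<sigma> x"] \<gamma>A[of y w] by (simp add: carA E.m_assoc)
      finally show ?thesis
        using xyw cE \<sigma> \<gamma>_cancel[of y w] by (simp add: E.m_assoc)
    qed
    ultimately have eq: "\<gamma> x y \<otimes>\<^bsub>A\<^esub> \<gamma> (x \<otimes>\<^bsub>K\<^esub> y) w = \<gamma> y w \<otimes>\<^bsub>A\<^esub> \<gamma> x (y \<otimes>\<^bsub>K\<^esub> w)"
      using xyw cE \<sigma>(1) E.right_cancel[of "\<sigma> (x \<otimes>\<^bsub>K\<^esub> y \<otimes>\<^bsub>K\<^esub> w)"
          "\<gamma> x y \<otimes>\<^bsub>E\<^esub> \<gamma> (x \<otimes>\<^bsub>K\<^esub> y) w" "\<gamma> y w \<otimes>\<^bsub>E\<^esub> \<gamma> x (y \<otimes>\<^bsub>K\<^esub> w)"]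
      by (simp add: multA)
    have in2: "frag_of [u, v] \<in> carrier (bar_chain_group 2 K)" if "u \<in> carrier K" "v \<in> carrier K" for u v
      using that by (simp add: carrier_bar_chain_group_closed bar_simplices_2)
    have "h2 (bar_boundary K (frag_of xs)) =
        \<gamma> y w \<otimes>\<^bsub>A\<^esub> inv\<^bsub>A\<^esub> \<gamma> (x \<otimes>\<^bsub>K\<^esub> y) w \<otimes>\<^bsub>A\<^esub> \<gamma> x (y \<otimes>\<^bsub>K\<^esub> w) \<otimes>\<^bsub>A\<^esub> inv\<^bsub>A\<^esub> \<gamma> x y"
      using xyw in2
      by (simp add: bar_boundary_simps h2s h2_2 carrier_bar_chain_group_closed(2,3))
    also have "\<dots> = (\<gamma> y w \<otimes>\<^bsub>A\<^esub> \<gamma> x (y \<otimes>\<^bsub>K\<^esub> w)) \<otimes>\<^bsub>A\<^esub> inv\<^bsub>A\<^esub> (\<gamma> x y \<otimes>\<^bsub>A\<^esub> \<gamma> (x \<otimes>\<^bsub>K\<^esub> y) w)"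
      using xyw \<gamma>A by (simp add: A.word_simps A.m_ac)
    also have "\<dots> = \<one>\<^bsub>A\<^esub>" using xyw \<gamma>A by (simp add: eq)
    finally show ?case .
  qed
  have 3: "h2 (bar_chain_map f w) = \<one>\<^bsub>A\<^esub>" if w: "w \<in> bar_cycles 2 G" for w
  proof -
    have w': "w \<in> carrier (bar_chain_group 2 G)" "bar_boundary G w = 0"
      using w by (simp_all add: bar_cycles_def)
    let ?b = "bar_chain_map \<phi> w"
    have b: "?b \<in> carrier (bar_chain_group 2 E)" by (rule bar_chain_map_closed[OF \<phi>(1) w'(1)])
    have "bar_boundary E ?b = 0"
      using bar_boundary_natural_2[OF \<phi>(1) w'(1)] w'(2) by (simp add: bar_chain_map_simps)
    moreover have "bar_chain_map q ?b = bar_chain_map f w"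
      unfolding bar_chain_map_compose using w'(1) \<phi>(2) by (intro bar_chain_map_cong) auto
    moreover have "h1 0 = \<one>\<^bsub>A\<^esub>" using h1s(4) carrier_bar_chain_group_closed(1) by metis
    moreover have "h2 (bar_chain_map f w) \<in> carrier A"
      using h2s(3) bar_chain_map_closed[OF f_hom w'(1)] by blast
    ultimately show ?thesis using 1[OF b] by simp
  qed
  have 4: "h2 z = \<one>\<^bsub>A\<^esub>" if z: "z \<in> bar_cycles 2 K" for z
  proof -
    obtain w where w: "w \<in> bar_cycles 2 G" "z - bar_chain_map f w \<in> bar_boundaries 2 K"
      using f_conn z by blast
    obtain t where t: "t \<in> carrier (bar_chain_group 3 K)" "z - bar_chain_map f w = bar_boundary K t"
      using w(2) by (auto simp: bar_boundaries_def)
    have "bar_chain_map f w \<in> carrier (bar_chain_group 2 K)"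
      using bar_chain_map_closed[OF f_hom] w(1) by (simp add: bar_cycles_def)
    moreover have "z = bar_boundary K t + bar_chain_map f w"
      using t(2) by (simp add: algebra_simps)
    ultimately show ?thesis
      using h2s(1)[OF bar_boundary_closed_3[OF grp(2) t(1)]] 2[OF t(1)] 3[OF w(1)] by simp
  qed
  (* The element n is null-homologous in E. *)
  obtain b where b: "b \<in> carrier (bar_chain_group 2 E)" "frag_of [n] = bar_boundary E b"
  proof -
    obtain c where c: "c \<in> carrier (bar_chain_group 1 G)"
        "frag_of [n] - bar_chain_map \<phi> c \<in> bar_boundaries 1 E"
      using H1[OF n(1)] by blast
    have "bar_chain_map q (frag_of [n] - bar_chain_map \<phi> c) \<in> bar_boundaries 1 K"
      using bar_chain_map_boundaries_1[OF q(1) c(2)] .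
    moreover have "bar_chain_map q (bar_chain_map \<phi> c) = bar_chain_map f c"
      unfolding bar_chain_map_compose using c(1) \<phi>(2) by (intro bar_chain_map_cong) auto
    moreover have "frag_of [\<one>\<^bsub>K\<^esub>] \<in> bar_boundaries 1 K"
    proof -
      have "frag_of [\<one>\<^bsub>K\<^esub>] = bar_boundary K (frag_of [\<one>\<^bsub>K\<^esub>, \<one>\<^bsub>K\<^esub>])"
        by (simp add: bar_boundary_simps)
      then show ?thesis
        by (auto simp: bar_boundaries_def carrier_bar_chain_group_closed bar_simplices_2
            simp flip: numeral_2_eq_2)
    qed
    ultimately have "bar_chain_map f c \<in> bar_boundaries 1 K"
      using n(2) bar_boundaries_closed(3)[of "frag_of [\<one>\<^bsub>K\<^esub>]" 1 K "frag_of [\<one>\<^bsub>K\<^esub>] - bar_chain_map f c"]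
      by (simp add: bar_chain_map_simps)
    then have "c \<in> bar_boundaries 1 G" using f_conn c(1) by simp
    then have "bar_chain_map \<phi> c \<in> bar_boundaries 1 E" by (rule bar_chain_map_boundaries_1[OF \<phi>(1)])
    then have "frag_of [n] - bar_chain_map \<phi> c + bar_chain_map \<phi> c \<in> bar_boundaries 1 E"
      using c(2) by (intro bar_boundaries_closed(2))
    then show ?thesis using that by (auto simp: bar_boundaries_def simp flip: numeral_2_eq_2)
  qed
  (* The section need not preserve the unit, so [1|1] has to be subtracted to get a cycle. *)
  have z: "bar_chain_map q b - frag_of [\<one>\<^bsub>K\<^esub>, \<one>\<^bsub>K\<^esub>] \<in> bar_cycles 2 K"
  proof -
    have "bar_boundary K (bar_chain_map q b) = bar_chain_map q (frag_of [n])"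
      by (simp only: b(2) bar_boundary_natural_2[OF q(1) b(1)])
    then have "bar_boundary K (bar_chain_map q b) = frag_of [\<one>\<^bsub>K\<^esub>]"
      using n(2) by (simp add: bar_chain_map_simps)
    then show ?thesis
      using bar_chain_map_closed[OF q(1) b(1)]
      by (auto simp: bar_cycles_def bar_boundary_simps bar_simplices_2 carrier_bar_chain_group_closed
          intro!: carrier_bar_chain_group_closed(3))
  qed
  have one1: "frag_of [\<one>\<^bsub>K\<^esub>, \<one>\<^bsub>K\<^esub>] \<in> carrier (bar_chain_group 2 K)"
    by (simp add: carrier_bar_chain_group_closed bar_simplices_2)
  have "h2 (frag_of [\<one>\<^bsub>K\<^esub>, \<one>\<^bsub>K\<^esub>]) = \<sigma> \<one>\<^bsub>K\<^esub>"
    using \<sigma>(1)[of "\<one>\<^bsub>K\<^esub>"] by (simp add: h2_2 \<gamma>_def E.word_simps)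
  then have "h2 (bar_chain_map q b) \<otimes>\<^bsub>A\<^esub> inv\<^bsub>A\<^esub> \<sigma> \<one>\<^bsub>K\<^esub> = \<one>\<^bsub>A\<^esub>" "\<sigma> \<one>\<^bsub>K\<^esub> \<in> carrier A"
      "h2 (bar_chain_map q b) \<in> carrier A"
    using h2s(2,3)[OF bar_chain_map_closed[OF q(1) b(1)] one1] h2s(3)[OF one1 one1] 4[OF z] by simp_all
  then have "h2 (bar_chain_map q b) = \<sigma> \<one>\<^bsub>K\<^esub>"
    using A.inv_equality[of "h2 (bar_chain_map q b)" "inv\<^bsub>A\<^esub> \<sigma> \<one>\<^bsub>K\<^esub>"] by simp
  moreover have "h1 (bar_boundary E b) = n \<otimes>\<^bsub>E\<^esub> inv\<^bsub>E\<^esub> \<sigma> \<one>\<^bsub>K\<^esub>"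
    using n h1_1[OF n(1)] by (simp add: b(2) \<alpha>_def)
  ultimately have "n \<otimes>\<^bsub>E\<^esub> inv\<^bsub>E\<^esub> \<sigma> \<one>\<^bsub>K\<^esub> \<otimes>\<^bsub>E\<^esub> \<sigma> \<one>\<^bsub>K\<^esub> = \<one>\<^bsub>E\<^esub>"
    using 1[OF b(1)] by (simp add: multA oneA)
  then show ?thesis using n \<sigma>[of "\<one>\<^bsub>K\<^esub>"] by (simp add: E.m_assoc)
qed

lemma (in group) commutator_closed:
  "x \<in> carrier G \<Longrightarrow> y \<in> carrier G \<Longrightarrow> commutator G x y \<in> carrier G"
  by (simp add: commutator_def)

lemma (in group) commutator_subgroup_normal:
  assumes "N \<lhd> G"
  shows "commutator_subgroup G N (carrier G) \<lhd> G"
  unfolding commutator_subgroup_def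
proof (rule normal_generateI)
  interpret N: normal N G by fact
  have NG: "x \<in> carrier G" if "x \<in> N" for x using that N.subset by blast
  show "{commutator G x y |x y. x \<in> N \<and> y \<in> carrier G} \<subseteq> carrier G"
    using NG commutator_closed by blast
  fix h g assume "h \<in> {commutator G x y |x y. x \<in> N \<and> y \<in> carrier G}" and g: "g \<in> carrier G"
  then obtain x y where xy: "x \<in> N" "y \<in> carrier G" "h = commutator G x y" by blast
  have "g \<otimes> h \<otimes> inv g = commutator G (g \<otimes> x \<otimes> inv g) (g \<otimes> y \<otimes> inv g)"
    using g xy NG[OF xy(1)] by (simp add: commutator_def word_simps)
  moreover have "g \<otimes> x \<otimes> inv g \<in> N" using N.inv_op_closed2[OF g xy(1)] .
  ultimately show "g \<otimes> h \<otimes> inv g \<in> {commutator G x y |x y. x \<in> N \<and> y \<in> carrier G}"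
    using g xy by blast
qed

text \<open>
  Dividing \<open>E\<close> by the commutator of the kernel with \<open>E\<close> makes the kernel central, where
  \<open>central_kernel_trivial\<close> applies. This is the step of Stallings' theorem on the lower central series in
  which the hypothesis on second homology enters.
\<close>

theorem two_connected_kernel_le_commutator:
  assumes grp: "group G" "group K" "group E"
    and q: "q \<in> hom E K" "q ` carrier E = carrier K"
    and \<phi>: "\<phi> \<in> hom G E" "\<And>x. x \<in> carrier G \<Longrightarrow> q (\<phi> x) = f x"
    and f: "two_connected G K f"
    and H1: "\<And>e. e \<in> carrier E \<Longrightarrow> \<exists>c\<in>carrier (bar_chain_group 1 G).
      frag_of [e] - bar_chain_map \<phi> c \<in> bar_boundaries 1 E"
    and n: "n \<in> carrier E" "q n = \<one>\<^bsub>K\<^esub>"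
  shows "n \<in> commutator_subgroup E {x \<in> carrier E. q x = \<one>\<^bsub>K\<^esub>} (carrier E)"
proof -
  interpret K: group K by fact
  interpret E: group E by fact
  interpret q: group_hom E K q using q by (simp add: group_hom_def group_hom_axioms_def grp)
  let ?N = "{x \<in> carrier E. q x = \<one>\<^bsub>K\<^esub>}"
  define M where "M = commutator_subgroup E ?N (carrier E)"
  have "?N \<lhd> E" using q.normal_kernel by (simp add: kernel_def)
  then have M: "M \<lhd> E" unfolding M_def by (rule E.commutator_subgroup_normal)
  note Q = normal_quotient[OF M]
  let ?\<pi> = "\<lambda>x. r_coset E M x"
  have comm_M: "commutator E x y \<in> M" if "x \<in> ?N" "y \<in> carrier E" for x y
    unfolding M_def commutator_subgroup_def using that by (blast intro: generate.incl)
  have M_N: "x \<in> ?N" if "x \<in> M" for x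
  proof -
    have "M \<subseteq> ?N"
      unfolding M_def commutator_subgroup_def
    proof (rule E.generate_subgroup_incl)
      show "subgroup ?N E" by (rule E.subgroupI) auto
      show "{commutator E x y |x y. x \<in> ?N \<and> y \<in> carrier E} \<subseteq> ?N"
        by (auto simp: commutator_def)
    qed
    then show ?thesis using that by blast
  qed
  have q_cong: "q x = q y" if xy: "x \<in> carrier E" "y \<in> carrier E" "?\<pi> x = ?\<pi> y" for x y
  proof -
    have "x \<otimes>\<^bsub>E\<^esub> inv\<^bsub>E\<^esub> y \<in> ?N" using xy Q(3) M_N by blast
    then show "q x = q y" using xy by (simp add: K.inv_solve_right')
  qed
  obtain p where p: "p \<in> hom (E Mod M) K" "\<And>x. x \<in> carrier E \<Longrightarrow> p (?\<pi> x) = q x"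
    by (rule FactGroup_universal[OF q(1) M q_cong]) blast+
  have "?\<pi> n = \<one>\<^bsub>E Mod M\<^esub>"
  proof (rule central_kernel_trivial[OF grp(1,2) Q(1) p(1) _ _ _ _ f])
    show "p ` carrier (E Mod M) = carrier K"
      unfolding Q(5) image_image using p(2) q(2) by simp
    show "n \<otimes>\<^bsub>E Mod M\<^esub> e = e \<otimes>\<^bsub>E Mod M\<^esub> n"
      if ne: "n \<in> carrier (E Mod M)" "p n = \<one>\<^bsub>K\<^esub>" "e \<in> carrier (E Mod M)" for n e
    proof -
      obtain x y where xy: "x \<in> carrier E" "y \<in> carrier E" "n = ?\<pi> x" "e = ?\<pi> y"
        using ne unfolding Q(5) by blast
      have "inv\<^bsub>E\<^esub> x \<in> ?N" using xy ne p(2) by simp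
      then have "commutator E (inv\<^bsub>E\<^esub> x) (inv\<^bsub>E\<^esub> y) \<in> M" using comm_M xy by simp
      then have "(x \<otimes>\<^bsub>E\<^esub> y) \<otimes>\<^bsub>E\<^esub> inv\<^bsub>E\<^esub> (y \<otimes>\<^bsub>E\<^esub> x) \<in> M"
        using xy by (simp add: commutator_def E.word_simps)
      then have "?\<pi> (x \<otimes>\<^bsub>E\<^esub> y) = ?\<pi> (y \<otimes>\<^bsub>E\<^esub> x)" using Q(3) xy by simp
      then show ?thesis
        using hom_mult[OF Q(2)] xy by simp
    qed
    show "?\<pi> \<circ> \<phi> \<in> hom G (E Mod M)" by (rule hom_compose[OF \<phi>(1) Q(2)])
    show "p ((?\<pi> \<circ> \<phi>) x) = f x" if "x \<in> carrier G" for x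
      using p(2) \<phi>(2) that hom_in_carrier[OF \<phi>(1)] by simp
    show "\<exists>c\<in>carrier (bar_chain_group 1 G).
        frag_of [e] - bar_chain_map (?\<pi> \<circ> \<phi>) c \<in> bar_boundaries 1 (E Mod M)"
      if e: "e \<in> carrier (E Mod M)" for e
    proof -
      obtain x where x: "x \<in> carrier E" "e = ?\<pi> x" using e unfolding Q(5) by blast
      obtain c where c: "c \<in> carrier (bar_chain_group 1 G)"
          "frag_of [x] - bar_chain_map \<phi> c \<in> bar_boundaries 1 E"
        using H1[OF x(1)] by blast
      have "bar_chain_map ?\<pi> (frag_of [x] - bar_chain_map \<phi> c) \<in> bar_boundaries 1 (E Mod M)"
        by (rule bar_chain_map_boundaries_1[OF Q(2) c(2)])
      then show ?thesis
        using c(1) x by (auto simp: bar_chain_map_simps bar_chain_map_compose)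
    qed
    show "?\<pi> n \<in> carrier (E Mod M)" using Q(5) n(1) by simp
    show "p (?\<pi> n) = \<one>\<^bsub>K\<^esub>" using p(2) n by simp
  qed
  then show ?thesis using Q(4)[OF n(1)] by (simp add: M_def)
qed

section \<open>A criterion for 2-connectedness\<close>

text \<open>
  The cocycle is not assumed to be normalised, so the neutral element has a correction in its second component.
\<close>

definition cocycle_extension ::
    "('k, 'm) monoid_scheme \<Rightarrow> ('a, 'n) monoid_scheme \<Rightarrow> ('k \<Rightarrow> 'k \<Rightarrow> 'a) \<Rightarrow> ('k \<times> 'a) monoid"
  where "cocycle_extension K A c = \<lparr>carrier = carrier K \<times> carrier A,
    monoid.mult = (\<lambda>(x, a) (y, b). (x \<otimes>\<^bsub>K\<^esub> y, a \<otimes>\<^bsub>A\<^esub> b \<otimes>\<^bsub>A\<^esub> c x y)),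
    one = (\<one>\<^bsub>K\<^esub>, inv\<^bsub>A\<^esub> c \<one>\<^bsub>K\<^esub> \<one>\<^bsub>K\<^esub>)\<rparr>"

lemma cocycle_extension_group:
  assumes "group K" "comm_group A"
    and c: "\<And>x y. x \<in> carrier K \<Longrightarrow> y \<in> carrier K \<Longrightarrow> c x y \<in> carrier A"
    and cocycle: "\<And>x y z. x \<in> carrier K \<Longrightarrow> y \<in> carrier K \<Longrightarrow> z \<in> carrier K \<Longrightarrow>
      c x y \<otimes>\<^bsub>A\<^esub> c (x \<otimes>\<^bsub>K\<^esub> y) z = c y z \<otimes>\<^bsub>A\<^esub> c x (y \<otimes>\<^bsub>K\<^esub> z)"
  shows "group (cocycle_extension K A c)" (is "group ?E")
    and "fst \<in> hom (cocycle_extension K A c) K"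
    and "fst ` carrier (cocycle_extension K A c) = carrier K"
    and "\<And>n e. n \<in> carrier (cocycle_extension K A c) \<Longrightarrow> fst n = \<one>\<^bsub>K\<^esub> \<Longrightarrow>
      e \<in> carrier (cocycle_extension K A c) \<Longrightarrow>
      n \<otimes>\<^bsub>cocycle_extension K A c\<^esub> e = e \<otimes>\<^bsub>cocycle_extension K A c\<^esub> n"
proof -
  interpret K: group K by fact
  interpret A: comm_group A by fact
  have c1: "c \<one>\<^bsub>K\<^esub> y = c \<one>\<^bsub>K\<^esub> \<one>\<^bsub>K\<^esub>" if "y \<in> carrier K" for y
    using cocycle[of "\<one>\<^bsub>K\<^esub>" "\<one>\<^bsub>K\<^esub>" y] c that by simp
  have c2: "c y \<one>\<^bsub>K\<^esub> = c \<one>\<^bsub>K\<^esub> \<one>\<^bsub>K\<^esub>" if "y \<in> carrier K" for y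
    using cocycle[of y "\<one>\<^bsub>K\<^esub>" "\<one>\<^bsub>K\<^esub>"] c that by simp
  show "group ?E"
  proof (rule groupI)
    fix x y assume "x \<in> carrier ?E" "y \<in> carrier ?E"
    then show "x \<otimes>\<^bsub>?E\<^esub> y \<in> carrier ?E"
      by (auto simp: cocycle_extension_def c)
  next
    show "\<one>\<^bsub>?E\<^esub> \<in> carrier ?E" by (simp add: cocycle_extension_def c)
  next
    fix x y z assume "x \<in> carrier ?E" "y \<in> carrier ?E" "z \<in> carrier ?E"
    then obtain k a l b m d where kab: "k \<in> carrier K" "l \<in> carrier K" "m \<in> carrier K"
      "a \<in> carrier A" "b \<in> carrier A" "d \<in> carrier A" "x = (k, a)" "y = (l, b)" "z = (m, d)"
      by (auto simp: cocycle_extension_def)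
    have "a \<otimes>\<^bsub>A\<^esub> b \<otimes>\<^bsub>A\<^esub> c k l \<otimes>\<^bsub>A\<^esub> d \<otimes>\<^bsub>A\<^esub> c (k \<otimes>\<^bsub>K\<^esub> l) m =
        a \<otimes>\<^bsub>A\<^esub> b \<otimes>\<^bsub>A\<^esub> d \<otimes>\<^bsub>A\<^esub> (c k l \<otimes>\<^bsub>A\<^esub> c (k \<otimes>\<^bsub>K\<^esub> l) m)"
      using kab c by (simp add: A.m_ac)
    also have "\<dots> = a \<otimes>\<^bsub>A\<^esub> (b \<otimes>\<^bsub>A\<^esub> d \<otimes>\<^bsub>A\<^esub> c l m) \<otimes>\<^bsub>A\<^esub> c k (l \<otimes>\<^bsub>K\<^esub> m)"
      unfolding cocycle[OF kab(1-3)] using kab c by (simp add: A.m_ac)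
    finally show "x \<otimes>\<^bsub>?E\<^esub> y \<otimes>\<^bsub>?E\<^esub> z = x \<otimes>\<^bsub>?E\<^esub> (y \<otimes>\<^bsub>?E\<^esub> z)"
      using kab by (simp add: cocycle_extension_def K.m_assoc)
  next
    fix x assume "x \<in> carrier ?E"
    then obtain k a where ka: "k \<in> carrier K" "a \<in> carrier A" "x = (k, a)"
      by (auto simp: cocycle_extension_def)
    show "\<one>\<^bsub>?E\<^esub> \<otimes>\<^bsub>?E\<^esub> x = x"
      using ka c c1[OF ka(1)] by (simp add: cocycle_extension_def A.m_assoc A.m_comm[of a])
    let ?d = "a \<otimes>\<^bsub>A\<^esub> c (inv\<^bsub>K\<^esub> k) k" and ?e = "c \<one>\<^bsub>K\<^esub> \<one>\<^bsub>K\<^esub>"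
    let ?y = "(inv\<^bsub>K\<^esub> k, inv\<^bsub>A\<^esub> ?e \<otimes>\<^bsub>A\<^esub> inv\<^bsub>A\<^esub> ?d)"
    have "?y \<otimes>\<^bsub>?E\<^esub> x = \<one>\<^bsub>?E\<^esub>"
      using ka c by (simp add: cocycle_extension_def A.m_assoc)
    moreover have "?y \<in> carrier ?E" using ka c by (simp add: cocycle_extension_def)
    ultimately show "\<exists>y\<in>carrier ?E. y \<otimes>\<^bsub>?E\<^esub> x = \<one>\<^bsub>?E\<^esub>" by blast
  qed
  show "fst \<in> hom ?E K" by (auto simp: hom_def cocycle_extension_def)
  show "fst ` carrier ?E = carrier K"
    using A.one_closed by (auto simp: cocycle_extension_def)
  fix n e assume "n \<in> carrier ?E" "fst n = \<one>\<^bsub>K\<^esub>" "e \<in> carrier ?E"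
  then obtain a k b where "a \<in> carrier A" "k \<in> carrier K" "b \<in> carrier A"
      and ne: "n = (\<one>\<^bsub>K\<^esub>, a)" "e = (k, b)"
    by (auto simp: cocycle_extension_def)
  then show "n \<otimes>\<^bsub>?E\<^esub> e = e \<otimes>\<^bsub>?E\<^esub> n"
    by (simp add: cocycle_extension_def c1[of k] c2[of k] A.m_comm[of a b])
qed

lemma bar_chain_group_comm: "comm_group (bar_chain_group n G)"
  by (simp add: bar_chain_group_def abelian_free_Abelian_group)

lemma bar_chain_group_ops:
  "x \<otimes>\<^bsub>bar_chain_group n G\<^esub> y = x + y" "\<one>\<^bsub>bar_chain_group n G\<^esub> = 0"
  "x \<in> carrier (bar_chain_group n G) \<Longrightarrow> inv\<^bsub>bar_chain_group n G\<^esub> x = - x"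
  by (simp_all add: bar_chain_group_def)

text \<open>
  The converse of Stallings' theorem, with lifts to central extensions as the test. In place of all abelian kernels it
  suffices to consider one, the group \<open>A\<close> of 2-chains of the mapping cone of \<open>f\<close> modulo boundaries:
  2-chains of \<open>K\<close> plus 1-chains of \<open>G\<close> modulo \<open>S\<close>. It carries the tautological cocycle \<open>c\<close>, and a section over \<open>K\<close>
  which restricts to the tautological lift \<open>\<phi>\<close> yields a homomorphism \<open>U\<close> on 1-chains with
  \<open>U (\<partial> b) = - [b]\<close> and \<open>U (f w) = - [w]\<close>. Surjectivity in degree 2 and injectivity in degree 1 both follow by
  evaluating \<open>U\<close>. Surjectivity in degree 1 is the hypothesis \<open>epi\<close>, applied to the cokernel.
\<close>

lemma two_connectedI:
  fixes G :: "('g, 'm) monoid_scheme" and K :: "('k, 'n) monoid_scheme"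
  assumes grp: "group G" "group K" and f: "f \<in> hom G K"
    and epi: "\<And>(A :: ('k list \<Rightarrow>\<^sub>0 int) set monoid) \<theta> k. comm_group A \<Longrightarrow> \<theta> \<in> hom K A \<Longrightarrow>
      (\<And>g. g \<in> carrier G \<Longrightarrow> \<theta> (f g) = \<one>\<^bsub>A\<^esub>) \<Longrightarrow> k \<in> carrier K \<Longrightarrow> \<theta> k = \<one>\<^bsub>A\<^esub>"
    and lift: "\<And>(E :: ('k \<times> (('k list \<Rightarrow>\<^sub>0 int) \<times> ('g list \<Rightarrow>\<^sub>0 int)) set) monoid) \<phi>.
      group E \<Longrightarrow> fst \<in> hom E K \<Longrightarrow> fst ` carrier E = carrier K \<Longrightarrow>
      (\<And>n e. n \<in> carrier E \<Longrightarrow> fst n = \<one>\<^bsub>K\<^esub> \<Longrightarrow> e \<in> carrier E \<Longrightarrow>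
        n \<otimes>\<^bsub>E\<^esub> e = e \<otimes>\<^bsub>E\<^esub> n) \<Longrightarrow>
      \<phi> \<in> hom G E \<Longrightarrow> (\<And>g. g \<in> carrier G \<Longrightarrow> fst (\<phi> g) = f g) \<Longrightarrow>
      \<exists>s\<in>hom K E. (\<forall>k\<in>carrier K. fst (s k) = k) \<and> (\<forall>g\<in>carrier G. s (f g) = \<phi> g)"
  shows "two_connected G K f"
proof -
  interpret G: group G by fact
  interpret K: group K by fact
  interpret f: group_hom G K f using f by (simp add: group_hom_def group_hom_axioms_def grp)
  note One_nat_def [simp del]
  let ?C = "\<lambda>n. carrier (bar_chain_group n K)" and ?C' = "\<lambda>n. carrier (bar_chain_group n G)"
  have surj1: "\<exists>d\<in>?C' 1. c - bar_chain_map f d \<in> bar_boundaries 1 K" if c: "c \<in> ?C 1" for c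
  proof -
    define S where "S = {b + bar_chain_map f d |b d. b \<in> bar_boundaries 1 K \<and> d \<in> ?C' 1}"
    interpret C: comm_group "bar_chain_group 1 K" by (rule bar_chain_group_comm)
    have S_diff: "x - y \<in> S" if xy: "x \<in> S" "y \<in> S" for x y
    proof -
      obtain b d b' d' where *: "b \<in> bar_boundaries 1 K" "d \<in> ?C' 1" "x = b + bar_chain_map f d"
          "b' \<in> bar_boundaries 1 K" "d' \<in> ?C' 1" "y = b' + bar_chain_map f d'"
        using xy unfolding S_def by blast
      have "x - y = (b - b') + bar_chain_map f (d - d')"
        by (simp add: * bar_chain_map_simps)
      then show ?thesis
        unfolding S_def using * bar_boundaries_closed(3) carrier_bar_chain_group_closed(3) by blast
    qed
    have S0: "0 \<in> S"
      unfolding S_def using bar_boundaries_closed(1)[of 1 K] carrier_bar_chain_group_closed(1)[of 1 G]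
      by (force simp: bar_chain_map_simps)
    have S_C: "S \<subseteq> ?C 1"
      unfolding S_def using bar_boundaries_1_subset[OF grp(2)] bar_chain_map_closed[OF f, of _ 1]
      by (auto intro!: carrier_bar_chain_group_closed(2))
    have "subgroup S (bar_chain_group 1 K)"
    proof (rule C.subgroupI)
      show "inv\<^bsub>bar_chain_group 1 K\<^esub> a \<in> S" if "a \<in> S" for a
      proof -
        have "a \<in> ?C 1" using that S_C by blast
        then show ?thesis using S_diff[OF S0 that] by (simp add: bar_chain_group_ops)
      qed
      show "a \<otimes>\<^bsub>bar_chain_group 1 K\<^esub> b \<in> S" if "a \<in> S" "b \<in> S" for a b
        using S_diff[OF that(1) S_diff[OF S0 that(2)]] by (simp add: bar_chain_group_ops)
    qed (use S_C S0 in auto)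
    note S_normal = C.subgroup_imp_normal[OF this] and comm = C.abelian_FactGroup[OF this]
    let ?A = "bar_chain_group 1 K Mod S"
    note Q = normal_quotient[OF S_normal]
    let ?\<theta> = "\<lambda>k. r_coset (bar_chain_group 1 K) S (frag_of [k])"
    have in1: "frag_of [k] \<in> ?C 1" if "k \<in> carrier K" for k
      using that by (simp add: carrier_bar_chain_group_closed bar_simplices_1 del: One_nat_def)
    have coset_eq: "r_coset (bar_chain_group 1 K) S x = r_coset (bar_chain_group 1 K) S y \<longleftrightarrow> x - y \<in> S"
      if "x \<in> ?C 1" "y \<in> ?C 1" for x y
      using Q(3)[OF that] that by (simp add: bar_chain_group_ops)
    have "?\<theta> \<in> hom K ?A"
    proof (rule homI)
      show "?\<theta> k \<in> carrier ?A" if "k \<in> carrier K" for k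
        using that in1 unfolding Q(5) by blast
      show "?\<theta> (k \<otimes>\<^bsub>K\<^esub> l) = ?\<theta> k \<otimes>\<^bsub>?A\<^esub> ?\<theta> l" if kl: "k \<in> carrier K" "l \<in> carrier K" for k l
      proof -
        have "frag_of [k, l] \<in> ?C 2"
          using kl by (simp add: carrier_bar_chain_group_closed bar_simplices_2)
        then have "- bar_boundary K (frag_of [k, l]) \<in> bar_boundaries 1 K"
          by (intro bar_boundaries_closed(4)) (auto simp: bar_boundaries_def simp flip: numeral_2_eq_2)
        then have "- bar_boundary K (frag_of [k, l]) + bar_chain_map f 0 \<in> S"
          unfolding S_def using carrier_bar_chain_group_closed(1)[of 1 G] by blast
        then have "frag_of [k \<otimes>\<^bsub>K\<^esub> l] - (frag_of [k] + frag_of [l]) \<in> S"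
          by (simp add: bar_boundary_simps bar_chain_map_simps algebra_simps)
        then have "?\<theta> (k \<otimes>\<^bsub>K\<^esub> l) = r_coset (bar_chain_group 1 K) S (frag_of [k] + frag_of [l])"
          using coset_eq in1 kl carrier_bar_chain_group_closed(2)[OF in1 in1] by simp
        also have "\<dots> = ?\<theta> k \<otimes>\<^bsub>?A\<^esub> ?\<theta> l"
          using hom_mult[OF Q(2) in1 in1] kl by (simp add: bar_chain_group_ops)
        finally show ?thesis .
      qed
    qed
    moreover have "?\<theta> (f g) = \<one>\<^bsub>?A\<^esub>" if g: "g \<in> carrier G" for g
    proof -
      have "frag_of [g] \<in> ?C' 1"
        using g by (simp add: carrier_bar_chain_group_closed bar_simplices_1 del: One_nat_def)
      then have "0 + bar_chain_map f (frag_of [g]) \<in> S"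
        unfolding S_def using bar_boundaries_closed(1)[of 1 K] by blast
      then show ?thesis using Q(4)[OF in1] g by (simp add: bar_chain_map_simps)
    qed
    ultimately have \<theta>1: "?\<theta> k = \<one>\<^bsub>?A\<^esub>" if "k \<in> carrier K" for k
      using epi[OF comm, of ?\<theta>] that by blast
    have "c \<in> S"
      using c
    proof (induction rule: bar_chain_diff_induct)
      case (simplex xs)
      then show ?case using \<theta>1 Q(4)[OF in1] unfolding bar_simplices_1 by auto
    qed (use S0 S_diff in auto)
    then obtain b d where "c = b + bar_chain_map f d" "b \<in> bar_boundaries 1 K" "d \<in> ?C' 1"
      unfolding S_def by blast
    then show ?thesis by (intro bexI[of _ d]) simp_all
  qed
  (* The mapping cone in degree 2, and its boundaries S. *)
  define P where "P = bar_chain_group 2 K \<times>\<times> bar_chain_group 1 G"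
  interpret P: comm_group P
  proof -
    have "group P" unfolding P_def
      by (intro DirProd_group comm_group.axioms(2) bar_chain_group_comm)
    then show "comm_group P"
      by (rule group.group_comm_groupI) (auto simp: P_def bar_chain_group_ops add.commute)
  qed
  have carP: "(x, y) \<in> carrier P \<longleftrightarrow> x \<in> ?C 2 \<and> y \<in> ?C' 1" for x y by (simp add: P_def)
  have multP: "(x, y) \<otimes>\<^bsub>P\<^esub> (x', y') = (x + x', y + y')" for x y x' y'
    by (simp add: P_def bar_chain_group_ops)
  have oneP: "\<one>\<^bsub>P\<^esub> = (0, 0)" by (simp add: P_def bar_chain_group_ops)
  have invP: "inv\<^bsub>P\<^esub> (x, y) = (- x, - y)" if "x \<in> ?C 2" "y \<in> ?C' 1" for x y
    using that by (intro P.inv_equality) (auto simp: multP oneP carP carrier_bar_chain_group_closed)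
  define S where "S = {(b + bar_chain_map f d, - bar_boundary G d) |b d.
    b \<in> bar_boundaries 2 K \<and> d \<in> ?C' 2}"
  have S_diff: "(x - y, x' - y') \<in> S" if xy: "(x, x') \<in> S" "(y, y') \<in> S" for x x' y y'
  proof -
    obtain b d b' d' where *: "b \<in> bar_boundaries 2 K" "d \<in> ?C' 2" "x = b + bar_chain_map f d"
        "x' = - bar_boundary G d"
        "b' \<in> bar_boundaries 2 K" "d' \<in> ?C' 2" "y = b' + bar_chain_map f d'"
        "y' = - bar_boundary G d'"
      using xy unfolding S_def by blast
    have "(x - y, x' - y') = ((b - b') + bar_chain_map f (d - d'), - bar_boundary G (d - d'))"
      by (simp add: * bar_chain_map_simps bar_boundary_simps)
    then show ?thesis
      unfolding S_def using * bar_boundaries_closed(3) carrier_bar_chain_group_closed(3) by blast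
  qed
  have SI: "(b + bar_chain_map f d, - bar_boundary G d) \<in> S"
    if "b \<in> bar_boundaries 2 K" "d \<in> ?C' 2" for b d using that unfolding S_def by blast
  have S0: "(0, 0) \<in> S"
    using SI[OF bar_boundaries_closed(1) carrier_bar_chain_group_closed(1)]
    by (simp add: bar_chain_map_simps bar_boundary_simps)
  have S_P: "S \<subseteq> carrier P"
    unfolding S_def
    using bar_boundaries_2_subset[OF grp(2)] bar_chain_map_closed[OF f, of _ 2]
      bar_boundary_closed_2[OF grp(1)]
    by (auto simp: carP bar_cycles_def intro!: carrier_bar_chain_group_closed(2,4))
  have subS: "subgroup S P"
  proof (rule P.subgroupI)
    show "inv\<^bsub>P\<^esub> a \<in> S" if a: "a \<in> S" for a
    proof -
      obtain x y where "a = (x, y)" by fastforce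
      then show ?thesis using S_diff[OF S0, of x y] a S_P invP[of x y] carP by auto
    qed
    show "a \<otimes>\<^bsub>P\<^esub> b \<in> S" if ab: "a \<in> S" "b \<in> S" for a b
    proof -
      obtain x y x' y' where xy: "a = (x, y)" "b = (x', y')" by fastforce
      have "(0 - x', 0 - y') \<in> S" using S_diff[OF S0] ab xy by blast
      from S_diff[OF _ this, of x y] show ?thesis using ab xy by (simp add: multP)
    qed
  qed (use S_P S0 in auto)
  define A where "A = P Mod S"
  have commA: "comm_group A" unfolding A_def by (rule P.abelian_FactGroup[OF subS])
  interpret A: comm_group A by (rule commA)
  note Q = normal_quotient[OF P.subgroup_imp_normal[OF subS], folded A_def]
  define cls where "cls x y = r_coset P S (x, y)" for x y
  have clsA: "cls x y \<in> carrier A" if "x \<in> ?C 2" "y \<in> ?C' 1" for x y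
    using that unfolding Q(5) cls_def by (simp add: carP)
  have cls_mult: "cls x y \<otimes>\<^bsub>A\<^esub> cls x' y' = cls (x + x') (y + y')"
    if "x \<in> ?C 2" "y \<in> ?C' 1" "x' \<in> ?C 2" "y' \<in> ?C' 1" for x y x' y'
    using hom_mult[OF Q(2), of "(x, y)" "(x', y')"] that unfolding cls_def by (simp add: carP multP)
  have cls_eq: "cls x y = cls x' y' \<longleftrightarrow> (x - x', y - y') \<in> S"
    if "x \<in> ?C 2" "y \<in> ?C' 1" "x' \<in> ?C 2" "y' \<in> ?C' 1" for x y x' y'
    using Q(3)[of "(x, y)" "(x', y')"] that unfolding cls_def by (simp add: carP multP invP)
  have cls_0: "cls 0 0 = \<one>\<^bsub>A\<^esub>"
    using Q(4)[of "(0, 0)"] S0 S_P unfolding cls_def by blast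
  note cc = carrier_bar_chain_group_closed
  have in2: "frag_of [k, l] \<in> ?C 2" if "k \<in> carrier K" "l \<in> carrier K" for k l
    using that by (simp add: cc bar_simplices_2)
  have in2': "frag_of [k, l] \<in> ?C' 2" if "k \<in> carrier G" "l \<in> carrier G" for k l
    using that by (simp add: cc bar_simplices_2)
  have in1': "frag_of [k] \<in> ?C' 1" if "k \<in> carrier G" for k
    using that by (simp add: cc bar_simplices_1 del: One_nat_def)
  define c where "c k l = cls (frag_of [k, l]) 0" for k l
  have cA: "c k l \<in> carrier A" if "k \<in> carrier K" "l \<in> carrier K" for k l
    unfolding c_def by (intro clsA in2 that cc(1))
  have cocycle: "c x y \<otimes>\<^bsub>A\<^esub> c (x \<otimes>\<^bsub>K\<^esub> y) z = c y z \<otimes>\<^bsub>A\<^esub> c x (y \<otimes>\<^bsub>K\<^esub> z)"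
    if xyz: "x \<in> carrier K" "y \<in> carrier K" "z \<in> carrier K" for x y z
  proof -
    have "frag_of [x, y, z] \<in> ?C 3" using xyz by (simp add: cc bar_simplices_3)
    then have "- bar_boundary K (frag_of [x, y, z]) \<in> bar_boundaries 2 K"
      by (intro bar_boundaries_closed(4)) (auto simp: bar_boundaries_def)
    from SI[OF this cc(1)]
    have "(frag_of [x, y] + frag_of [x \<otimes>\<^bsub>K\<^esub> y, z] - (frag_of [y, z] + frag_of [x, y \<otimes>\<^bsub>K\<^esub> z]), 0 - 0) \<in> S"
      by (simp add: bar_boundary_simps bar_chain_map_simps algebra_simps)
    then have "cls (frag_of [x, y] + frag_of [x \<otimes>\<^bsub>K\<^esub> y, z]) 0 =
        cls (frag_of [y, z] + frag_of [x, y \<otimes>\<^bsub>K\<^esub> z]) 0"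
      using xyz by (subst cls_eq) (auto intro!: cc(1,2) in2)
    then show ?thesis unfolding c_def using xyz by (simp add: cls_mult in2 cc(1))
  qed
  let ?E = "cocycle_extension K A c"
  note ext = cocycle_extension_group[OF grp(2) commA cA cocycle]
  define \<phi> where "\<phi> g = (f g, cls 0 (- frag_of [g]))" for g
  have \<phi>: "\<phi> \<in> hom G ?E"
  proof (rule homI)
    show "\<phi> g \<in> carrier ?E" if "g \<in> carrier G" for g
      using that by (simp add: \<phi>_def cocycle_extension_def clsA cc(1) cc(4)[OF in1'])
    show "\<phi> (g \<otimes>\<^bsub>G\<^esub> h) = \<phi> g \<otimes>\<^bsub>?E\<^esub> \<phi> h" if gh: "g \<in> carrier G" "h \<in> carrier G" for g h
    proof -
      have "cls 0 (- frag_of [g]) \<otimes>\<^bsub>A\<^esub> cls 0 (- frag_of [h]) \<otimes>\<^bsub>A\<^esub> c (f g) (f h) =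
          cls (0 + 0 + frag_of [f g, f h]) (- frag_of [g] + - frag_of [h] + 0)"
        unfolding c_def using gh by (simp add: cls_mult cc(1) cc(4)[OF in1'] cc(3)[OF cc(4)[OF in1'] in1'] in2)
      also have "\<dots> = cls 0 (- frag_of [g \<otimes>\<^bsub>G\<^esub> h])"
      proof (subst cls_eq)
        have "(0 + bar_chain_map f (frag_of [g, h]), - bar_boundary G (frag_of [g, h])) \<in> S"
          by (rule SI[OF bar_boundaries_closed(1) in2'[OF gh]])
        then show "(0 + 0 + frag_of [f g, f h] - 0,
            - frag_of [g] + - frag_of [h] + 0 - - frag_of [g \<otimes>\<^bsub>G\<^esub> h]) \<in> S"
          by (simp add: bar_chain_map_simps bar_boundary_simps algebra_simps)
      qed (use gh in \<open>auto intro!: cc(1,2) cc(3)[OF cc(4)[OF in1'] in1'] cc(4)[OF in1'] in2\<close>)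
      finally show ?thesis using gh by (simp add: \<phi>_def cocycle_extension_def)
    qed
  qed
  have "\<exists>s\<in>hom K ?E. (\<forall>k\<in>carrier K. fst (s k) = k) \<and> (\<forall>g\<in>carrier G. s (f g) = \<phi> g)"
    by (rule lift[OF ext \<phi>]) (simp_all add: \<phi>_def)
  then obtain s where s: "s \<in> hom K ?E" "\<And>k. k \<in> carrier K \<Longrightarrow> fst (s k) = k"
      "\<And>g. g \<in> carrier G \<Longrightarrow> s (f g) = \<phi> g"
    by blast
  define u where "u k = snd (s k)" for k
  have s_eq: "s k = (k, u k)" if "k \<in> carrier K" for k
    using s(2)[OF that] by (simp add: u_def prod_eq_iff)
  have uA: "u k \<in> carrier A" if "k \<in> carrier K" for k
    using hom_in_carrier[OF s(1) that] s_eq[OF that] by (simp add: cocycle_extension_def)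
  have u_mult: "u (k \<otimes>\<^bsub>K\<^esub> l) = u k \<otimes>\<^bsub>A\<^esub> u l \<otimes>\<^bsub>A\<^esub> c k l" if "k \<in> carrier K" "l \<in> carrier K" for k l
    using hom_mult[OF s(1) that] that by (simp add: s_eq cocycle_extension_def)
  have u_f: "u (f g) = cls 0 (- frag_of [g])" if "g \<in> carrier G" for g
    using s(3)[OF that] by (simp add: u_def \<phi>_def)
  have u_simplex: "u (xs ! 0) \<in> carrier A" if "xs \<in> bar_simplices 1 K" for xs
    using that uA unfolding bar_simplices_1 by auto
  obtain U where U: "U \<in> hom (bar_chain_group 1 K) A"
      and U_of: "\<And>xs. xs \<in> bar_simplices 1 K \<Longrightarrow> U (frag_of xs) = u (xs ! 0)"
    by (rule bar_chain_hom_exists[OF A.comm_group_axioms, OF u_simplex]) blast+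
  note Us = hom_bar_chain_simps[OF U A.group_axioms]
  have U_1: "U (frag_of [k]) = u k" if "k \<in> carrier K" for k
    using U_of[of "[k]"] that by (simp add: bar_simplices_1 del: One_nat_def)
  have U_boundary: "U (bar_boundary K b) = cls (- b) 0" if "b \<in> ?C 2" for b
    using that
  proof (induction rule: bar_chain_diff_induct)
    case zero
    show ?case using Us(4)[OF cc(1) cc(1)] by (simp add: bar_boundary_simps cls_0)
  next
    case (diff x y)
    have "inv\<^bsub>A\<^esub> cls (- y) 0 = cls y 0"
      using diff(2) by (intro A.inv_equality) (simp_all add: cls_mult cls_0 clsA cc(1) cc(4))
    then have "U (bar_boundary K (x - y)) = cls (- x) 0 \<otimes>\<^bsub>A\<^esub> cls y 0"
      using diff bar_boundary_closed_2[OF grp(2)] by (simp add: bar_boundary_simps Us)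
    also have "\<dots> = cls (- (x - y)) 0"
      using diff(1,2) by (simp add: cls_mult cc(1) cc(4))
    finally show ?case .
  next
    case (simplex xs)
    then obtain k l where kl: "k \<in> carrier K" "l \<in> carrier K" "xs = [k, l]"
      by (auto simp: bar_simplices_2)
    have in1: "frag_of [k] \<in> ?C 1" if "k \<in> carrier K" for k
      using that by (simp add: cc bar_simplices_1 del: One_nat_def)
    have "U (bar_boundary K (frag_of xs)) = u l \<otimes>\<^bsub>A\<^esub> inv\<^bsub>A\<^esub> u (k \<otimes>\<^bsub>K\<^esub> l) \<otimes>\<^bsub>A\<^esub> u k"
      using kl in1 cc(3)[OF in1 in1] by (simp add: bar_boundary_simps Us U_1)
    also have "\<dots> = (u k \<otimes>\<^bsub>A\<^esub> u l) \<otimes>\<^bsub>A\<^esub> inv\<^bsub>A\<^esub> ((u k \<otimes>\<^bsub>A\<^esub> u l) \<otimes>\<^bsub>A\<^esub> c k l)"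
      using kl uA cA by (simp add: u_mult A.m_ac)
    also have "\<dots> = inv\<^bsub>A\<^esub> c k l"
      using kl uA cA by (simp add: A.inv_mult A.m_assoc) (simp add: A.m_lcomm[of "u l"])
    also have "\<dots> = cls (- frag_of xs) 0"
      unfolding c_def using kl in2
      by (intro A.inv_equality) (simp_all add: cls_mult cls_0 clsA cc(1) cc(4))
    finally show ?case .
  qed
  have U_f: "U (bar_chain_map f w) = cls 0 (- w)" if "w \<in> ?C' 1" for w
    using that
  proof (induction rule: bar_chain_diff_induct)
    case zero
    show ?case using Us(4)[OF cc(1) cc(1)] by (simp add: bar_chain_map_simps cls_0)
  next
    case (diff x y)
    have "inv\<^bsub>A\<^esub> cls 0 (- y) = cls 0 y"
      using diff(2) by (intro A.inv_equality) (simp_all add: cls_mult cls_0 clsA cc(1) cc(4))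
    then have "U (bar_chain_map f (x - y)) = cls 0 (- x) \<otimes>\<^bsub>A\<^esub> cls 0 y"
      using diff bar_chain_map_closed[OF f] by (simp add: bar_chain_map_simps Us)
    also have "\<dots> = cls 0 (- (x - y))"
      using diff(1,2) by (simp add: cls_mult cc(1) cc(4))
    finally show ?case .
  next
    case (simplex xs)
    then show ?case
      unfolding bar_simplices_1 by (auto simp: bar_chain_map_simps U_1 u_f)
  qed
  (* If f w is the boundary of b, then b and w have the same class in A, so w is a boundary in G. *)
  have inj1: "w \<in> bar_boundaries 1 G" if w: "w \<in> ?C' 1" "bar_chain_map f w \<in> bar_boundaries 1 K" for w
  proof -
    obtain b where b: "b \<in> ?C 2" "bar_chain_map f w = bar_boundary K b"
      using w(2) by (auto simp: bar_boundaries_def simp flip: numeral_2_eq_2)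
    have "cls 0 (- w) = cls (- b) 0" using U_f[OF w(1)] U_boundary[OF b(1)] b(2) by simp
    then have "(b, - w) \<in> S"
      using cls_eq[OF cc(1) cc(4)[OF w(1)] cc(4)[OF b(1)] cc(1)] by simp
    then obtain d where "d \<in> ?C' 2" "- w = - bar_boundary G d" unfolding S_def by blast
    then show ?thesis by (auto simp: bar_boundaries_def simp flip: numeral_2_eq_2)
  qed
  (* The class of a cycle z is - U 0, so z is a boundary of the cone. *)
  have surj2: "\<exists>w\<in>bar_cycles 2 G. z - bar_chain_map f w \<in> bar_boundaries 2 K"
    if z: "z \<in> bar_cycles 2 K" for z
  proof -
    have z': "z \<in> ?C 2" "bar_boundary K z = 0" using z by (simp_all add: bar_cycles_def)
    have "cls 0 0 = cls (- z) 0"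
      using U_boundary[OF z'(1)] z'(2) Us(4)[OF cc(1) cc(1)] by (simp add: cls_0)
    then have "(z, 0) \<in> S" using cls_eq[OF cc(1) cc(1) cc(4)[OF z'(1)] cc(1)] by simp
    then obtain b d where "b \<in> bar_boundaries 2 K" "d \<in> ?C' 2" "z = b + bar_chain_map f d"
        "bar_boundary G d = 0"
      unfolding S_def by auto
    then show ?thesis by (intro bexI[of _ d]) (auto simp: bar_cycles_def)
  qed
  show ?thesis
    unfolding two_connected_iff[OF grp] using f surj1 inj1 surj2 by blast
qed

section \<open>Systems of equations over a group\<close>

text \<open>
  Group words in variables \<open>Var i\<close> with constants from the group.
\<close>

datatype 't gterm = Const 't | Var nat | Mul "'t gterm" "'t gterm" | Inv "'t gterm"

primrec gval :: "('t, 'm) monoid_scheme \<Rightarrow> (nat \<Rightarrow> 't) \<Rightarrow> 't gterm \<Rightarrow> 't"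
  where
    "gval T x (Const a) = a"
  | "gval T x (Var i) = x i"
  | "gval T x (Mul s t) = gval T x s \<otimes>\<^bsub>T\<^esub> gval T x t"
  | "gval T x (Inv t) = inv\<^bsub>T\<^esub> gval T x t"

primrec expo :: "nat \<Rightarrow> 't gterm \<Rightarrow> int"
  where
    "expo j (Const a) = 0"
  | "expo j (Var i) = (if i = j then 1 else 0)"
  | "expo j (Mul s t) = expo j s + expo j t"
  | "expo j (Inv t) = - expo j t"

primrec gterm_over :: "'t set \<Rightarrow> nat \<Rightarrow> 't gterm \<Rightarrow> bool"
  where
    "gterm_over A n (Const a) \<longleftrightarrow> a \<in> A"
  | "gterm_over A n (Var i) \<longleftrightarrow> i < n"
  | "gterm_over A n (Mul s t) \<longleftrightarrow> gterm_over A n s \<and> gterm_over A n t"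
  | "gterm_over A n (Inv t) \<longleftrightarrow> gterm_over A n t"

text \<open>
  Exponent sum 0 means that every \<open>w i\<close> becomes constant in the abelianisation, so the system
  \<open>x i = w i\<close> has there the identity as its matrix.
\<close>

definition contractible_system :: "('t, 'm) monoid_scheme \<Rightarrow> nat \<Rightarrow> (nat \<Rightarrow> 't gterm) \<Rightarrow> bool"
  where "contractible_system T n w \<longleftrightarrow>
    (\<forall>i<n. gterm_over (carrier T) n (w i) \<and> (\<forall>j<n. expo j (w i) = 0))"

definition solves :: "('t, 'm) monoid_scheme \<Rightarrow> nat \<Rightarrow> (nat \<Rightarrow> 't gterm) \<Rightarrow> (nat \<Rightarrow> 't) \<Rightarrow> bool"
  where "solves T n w x \<longleftrightarrow> (\<forall>i<n. x i \<in> carrier T \<and> x i = gval T x (w i))"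

definition uniquely_solvable :: "('t, 'm) monoid_scheme \<Rightarrow> bool"
  where "uniquely_solvable T \<longleftrightarrow> (\<forall>n w. contractible_system T n w \<longrightarrow>
    (\<exists>x. solves T n w x \<and> (\<forall>y. solves T n w y \<longrightarrow> (\<forall>i<n. y i = x i))))"

lemma (in group) gval_closed:
  "gterm_over (carrier G) n t \<Longrightarrow> (\<And>i. i < n \<Longrightarrow> x i \<in> carrier G) \<Longrightarrow> gval G x t \<in> carrier G"
  by (induction t) auto

lemma gval_cong: "gterm_over A n t \<Longrightarrow> (\<And>i. i < n \<Longrightarrow> x i = y i) \<Longrightarrow> gval T x t = gval T y t"
  by (induction t) auto

lemma gval_map:
  assumes "\<pi> \<in> hom T S" "group T" "group S"
    and "gterm_over (carrier T) n t" "\<And>i. i < n \<Longrightarrow> x i \<in> carrier T"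
  shows "\<pi> (gval T x t) = gval S (\<lambda>i. \<pi> (x i)) (map_gterm \<pi> t)"
proof -
  interpret group_hom T S \<pi> using assms by (simp add: group_hom_def group_hom_axioms_def)
  have "gval T x t \<in> carrier T \<and> \<pi> (gval T x t) = gval S (\<lambda>i. \<pi> (x i)) (map_gterm \<pi> t)"
    using assms(4) by (induction t) (use assms(5) in auto)
  then show ?thesis ..
qed

lemma gterm_over_map:
  "gterm_over A n t \<Longrightarrow> \<pi> ` A \<subseteq> B \<Longrightarrow> gterm_over B n (map_gterm \<pi> t)"
  by (induction t) auto

lemma expo_map: "expo j (map_gterm \<pi> t) = expo j t"
  by (induction t) auto

subsection \<open>Abelian groups\<close>

primrec power_product :: "('t, 'm) monoid_scheme \<Rightarrow> (nat \<Rightarrow> 't) \<Rightarrow> (nat \<Rightarrow> int) \<Rightarrow> nat \<Rightarrow> 't"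
  where
    "power_product T x e 0 = \<one>\<^bsub>T\<^esub>"
  | "power_product T x e (Suc n) = power_product T x e n \<otimes>\<^bsub>T\<^esub> x n [^]\<^bsub>T\<^esub> e n"

context comm_group
begin

lemma power_product_closed:
  "(\<And>i. i < n \<Longrightarrow> x i \<in> carrier G) \<Longrightarrow> power_product G x e n \<in> carrier G"
  by (induction n) auto

lemma power_product_zero:
  "(\<And>i. i < n \<Longrightarrow> e i = 0) \<Longrightarrow> power_product G x e n = \<one>"
  by (induction n) auto

lemma power_product_add:
  "(\<And>i. i < n \<Longrightarrow> x i \<in> carrier G) \<Longrightarrow>
    power_product G x (\<lambda>j. e j + d j) n = power_product G x e n \<otimes> power_product G x d n"
proof (induction n)
  case (Suc n)
  then show ?case
    using power_product_closed[of n x e] power_product_closed[of n x d]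
    by (simp add: int_pow_mult m_ac)
qed simp

lemma power_product_minus:
  assumes "\<And>i. i < n \<Longrightarrow> x i \<in> carrier G"
  shows "power_product G x (\<lambda>j. - e j) n = inv power_product G x e n"
proof (rule inv_equality[symmetric])
  have "power_product G x (\<lambda>j. - e j + e j) n = \<one>" by (rule power_product_zero) simp
  then show "power_product G x (\<lambda>j. - e j) n \<otimes> power_product G x e n = \<one>"
    using power_product_add[of n x "\<lambda>j. - e j" e] assms by simp
qed (use assms power_product_closed in auto)

lemma power_product_single:
  assumes "\<And>i. i < n \<Longrightarrow> x i \<in> carrier G" "i < n"
  shows "power_product G x (\<lambda>j. if i = j then 1 else 0) n = x i"
  using assms
proof (induction n)
  case (Suc n)
  show ?case
  proof (cases "i = n")
    case True
    then show ?thesis using Suc.prems by (simp add: power_product_zero)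
  next
    case False
    then show ?thesis using Suc by simp
  qed
qed simp

lemma gval_eq_power_product:
  assumes "gterm_over (carrier G) n t" "\<And>i. i < n \<Longrightarrow> x i \<in> carrier G"
  shows "gval G x t = gval G (\<lambda>_. \<one>) t \<otimes> power_product G x (\<lambda>j. expo j t) n"
  using assms(1)
proof (induction t)
  case (Const a)
  then show ?case by (simp add: power_product_zero)
next
  case (Var i)
  then show ?case using assms(2) by (simp add: power_product_single)
next
  case (Mul s t)
  then show ?case
    using assms(2) gval_closed[of n s "\<lambda>_. \<one>"] gval_closed[of n t "\<lambda>_. \<one>"]
      power_product_closed[of n x "\<lambda>j. expo j s"] power_product_closed[of n x "\<lambda>j. expo j t"]
    by (simp add: power_product_add m_ac)
next
  case (Inv t)
  then show ?case
    using assms(2) gval_closed[of n t "\<lambda>_. \<one>"] power_product_closed[of n x "\<lambda>j. expo j t"]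
    by (simp add: power_product_minus inv_mult)
qed

lemma gval_zero_expo:
  assumes "gterm_over (carrier G) n t" "\<And>i. i < n \<Longrightarrow> x i \<in> carrier G" "\<And>j. j < n \<Longrightarrow> expo j t = 0"
  shows "gval G x t = gval G (\<lambda>_. \<one>) t"
  using gval_eq_power_product[OF assms(1,2)] gval_closed[of n t "\<lambda>_. \<one>"] assms
  by (simp add: power_product_zero)

lemma uniquely_solvable: "uniquely_solvable G"
  unfolding uniquely_solvable_def
proof (intro allI impI)
  fix n w assume w: "contractible_system G n w"
  have const: "gval G x (w i) = gval G (\<lambda>_. \<one>) (w i)" if "i < n" "\<And>i. i < n \<Longrightarrow> x i \<in> carrier G" for x i
    using w that by (intro gval_zero_expo[of n]) (auto simp: contractible_system_def)
  define x where "x i = gval G (\<lambda>_. \<one>) (w i)" for i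
  have x: "x i \<in> carrier G" if "i < n" for i
    using w that gval_closed[of n "w i" "\<lambda>_. \<one>"] by (auto simp: contractible_system_def x_def)
  have "solves G n w x" using const[of _ x] x by (simp add: solves_def x_def)
  moreover have "y i = x i" if y: "solves G n w y" and i: "i < n" for y i
  proof -
    have yG: "y j \<in> carrier G" if "j < n" for j
      using y that unfolding solves_def by blast
    have "y i = gval G y (w i)" using y i by (simp add: solves_def)
    also have "\<dots> = x i" using const[OF i yG] by (simp only: x_def)
    finally show ?thesis .
  qed
  ultimately show "\<exists>x. solves G n w x \<and> (\<forall>y. solves G n w y \<longrightarrow> (\<forall>i<n. y i = x i))" by blast
qed

end

subsection \<open>Radical sets of endomorphisms\<close>

text \<open>
  The set \<open>J\<close> is a ring without unit that consists of endomorphisms and coincides with its Jacobson radical: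
  \<open>quasi_inverse\<close> says that each \<open>1 - j\<close> is invertible with inverse \<open>1 + r\<close>, \<open>r \<in> J\<close>.
\<close>

locale radical_endomorphisms =
  fixes J :: "('d::ab_group_add \<Rightarrow> 'd) set"
  assumes zero: "(\<lambda>_. 0) \<in> J"
    and plus: "j \<in> J \<Longrightarrow> k \<in> J \<Longrightarrow> (\<lambda>a. j a + k a) \<in> J"
    and minus: "j \<in> J \<Longrightarrow> (\<lambda>a. - j a) \<in> J"
    and compose: "j \<in> J \<Longrightarrow> k \<in> J \<Longrightarrow> (\<lambda>a. j (k a)) \<in> J"
    and additive: "j \<in> J \<Longrightarrow> j (a + b) = j a + j b"
    and quasi_inverse: "j \<in> J \<Longrightarrow> \<exists>r\<in>J. \<forall>a b. b = a + j b \<longleftrightarrow> b = a + r a"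
begin

lemma additive_0: "j \<in> J \<Longrightarrow> j 0 = 0"
  using additive[of j 0 0] by simp

lemma additive_minus: "j \<in> J \<Longrightarrow> j (- a) = - j a"
  using additive[of j a "- a"] additive_0[of j] by (simp add: minus_unique)

lemma additive_sum: "j \<in> J \<Longrightarrow> j (\<Sum>i\<in>I. f i) = (\<Sum>i\<in>I. j (f i))"
  by (induction I rule: infinite_finite_induct) (simp_all add: additive additive_0)

text \<open>
  Gaussian elimination: the last equation determines \<open>y n\<close> from the other variables, and substitution keeps all
  coefficients in \<open>J\<close>.
\<close>

lemma linear_system_uniquely_solvable:
  fixes n :: nat
  assumes "\<And>i j. i < n \<Longrightarrow> j < n \<Longrightarrow> m i j \<in> J"
  shows "\<exists>y. (\<forall>i<n. y i = c i + (\<Sum>j<n. m i j (y j))) \<and>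
    (\<forall>z. (\<forall>i<n. z i = c i + (\<Sum>j<n. m i j (z j))) \<longrightarrow> (\<forall>i<n. z i = y i))"
  using assms
proof (induction n arbitrary: m c)
  case (Suc n)
  obtain r where r: "r \<in> J" "\<And>a b. b = a + m n n b \<longleftrightarrow> b = a + r a"
    using quasi_inverse[of "m n n"] Suc.prems by blast
  define m' where "m' i j a = m i j a + m i n (m n j a + r (m n j a))" for i j a
  define c' where "c' i = c i + m i n (c n + r (c n))" for i
  define s where "s y = c n + (\<Sum>j<n. m n j (y j))" for y
  have m'J: "m' i j \<in> J" if "i < n" "j < n" for i j
  proof -
    have m: "m i j \<in> J" "m i n \<in> J" "m n j \<in> J" using Suc.prems that by auto
    show ?thesis
      unfolding m'_def
      by (rule plus[OF m(1) compose[OF m(2) plus[OF m(3) compose[OF r(1) m(3)]]]])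
  qed
  have elim: "(\<forall>i<Suc n. y i = c i + (\<Sum>j<Suc n. m i j (y j))) \<longleftrightarrow>
      (\<forall>i<n. y i = c' i + (\<Sum>j<n. m' i j (y j))) \<and> y n = s y + r (s y)" for y
  proof -
    have last: "y n = c n + (\<Sum>j<Suc n. m n j (y j)) \<longleftrightarrow> y n = s y + r (s y)"
      using r(2)[of "y n" "s y"] by (simp add: s_def add.assoc)
    have sub: "c i + (\<Sum>j<Suc n. m i j (y j)) = c' i + (\<Sum>j<n. m' i j (y j))"
      if i: "i < n" and y: "y n = s y + r (s y)" for i
    proof -
      have "m i n (y n) = m i n (c n + r (c n)) + (\<Sum>j<n. m i n (m n j (y j) + r (m n j (y j))))"
        unfolding y s_def using Suc.prems i r(1)
        by (simp add: additive additive_sum sum.distrib algebra_simps)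
      then show ?thesis by (simp add: c'_def m'_def sum.distrib algebra_simps)
    qed
    show ?thesis
    proof
      assume L: "\<forall>i<Suc n. y i = c i + (\<Sum>j<Suc n. m i j (y j))"
      then have y: "y n = s y + r (s y)" using last by blast
      moreover have "y i = c' i + (\<Sum>j<n. m' i j (y j))" if i: "i < n" for i
        unfolding sub[OF i y, symmetric] using L i less_SucI by blast
      ultimately show "(\<forall>i<n. y i = c' i + (\<Sum>j<n. m' i j (y j))) \<and> y n = s y + r (s y)"
        by blast
    next
      assume R: "(\<forall>i<n. y i = c' i + (\<Sum>j<n. m' i j (y j))) \<and> y n = s y + r (s y)"
      show "\<forall>i<Suc n. y i = c i + (\<Sum>j<Suc n. m i j (y j))"
      proof (intro allI impI)
        fix i assume "i < Suc n"
        then consider "i = n" | "i < n" by linarith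
        then show "y i = c i + (\<Sum>j<Suc n. m i j (y j))"
        proof cases
          case 1
          then show ?thesis using R last by blast
        next
          case 2
          show ?thesis unfolding sub[OF 2 conjunct2[OF R]] using R 2 by blast
        qed
      qed
    qed
  qed
  obtain y where y: "\<forall>i<n. y i = c' i + (\<Sum>j<n. m' i j (y j))"
    and y_unique: "\<And>z. (\<forall>i<n. z i = c' i + (\<Sum>j<n. m' i j (z j))) \<Longrightarrow> (\<forall>i<n. z i = y i)"
    using Suc.IH[of m' c', OF m'J] by blast
  define y' where "y' = y(n := s y + r (s y))"
  have y'_n: "y' n = s y + r (s y)" by (simp add: y'_def)
  have y'_i: "y' i = y i" if "i < n" for i using that by (simp add: y'_def)
  have s_cong: "s z = s y" if "\<And>i. i < n \<Longrightarrow> z i = y i" for z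
    unfolding s_def using that by simp
  have "\<forall>i<n. y' i = c' i + (\<Sum>j<n. m' i j (y' j))" using y by (simp add: y'_i)
  moreover have "y' n = s y' + r (s y')" using y'_n s_cong[of y'] y'_i by simp
  ultimately have "\<forall>i<Suc n. y' i = c i + (\<Sum>j<Suc n. m i j (y' j))" using elim by blast
  moreover have "\<forall>i<Suc n. z i = y' i" if z: "\<forall>i<Suc n. z i = c i + (\<Sum>j<Suc n. m i j (z j))" for z
  proof -
    have z': "\<forall>i<n. z i = c' i + (\<Sum>j<n. m' i j (z j))" "z n = s z + r (s z)"
      using z elim by blast+
    have zy: "z i = y i" if "i < n" for i using y_unique[OF z'(1)] that by blast
    have "z n = y' n" unfolding z'(2) y'_n using s_cong[of z] zy by simp
    then show ?thesis using zy y'_i less_Suc_eq by auto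
  qed
  ultimately show ?case by blast
qed simp

end

subsection \<open>Extensions by a radical kernel\<close>

text \<open>
  The additive group as a structure provides integer multiples and their laws.
\<close>

definition additive_group :: "'d::ab_group_add monoid"
  where "additive_group = \<lparr>carrier = UNIV, monoid.mult = (+), one = 0\<rparr>"

lemma one_additive_group [simp]: "\<one>\<^bsub>additive_group\<^esub> = 0"
  by (simp add: additive_group_def)

abbreviation int_multiple :: "int \<Rightarrow> 'd \<Rightarrow> 'd::ab_group_add"
  where "int_multiple k d \<equiv> d [^]\<^bsub>additive_group\<^esub> k"

lemma group_additive_group: "group (additive_group :: 'd::ab_group_add monoid)"
  by (rule groupI) (auto simp: additive_group_def intro: exI[of _ "- _"] left_minus)

lemma int_multiple_simps:
  "int_multiple 0 d = 0" "int_multiple 1 d = d"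
  "int_multiple (k + l) d = int_multiple k d + int_multiple l d"
  "int_multiple (- k) d = - int_multiple k d"
proof -
  interpret group "additive_group :: 'a monoid" by (rule group_additive_group)
  have car: "d \<in> carrier additive_group" for d :: 'a by (simp add: additive_group_def)
  show "int_multiple 0 d = 0" by (simp add: additive_group_def)
  show "int_multiple 1 d = d" using int_pow_1[OF car] .
  show add: "int_multiple (k + l) d = int_multiple k d + int_multiple l d" for k l
    using int_pow_mult[OF car, of d k l] by (simp add: additive_group_def)
  have "int_multiple (k + - k) d = 0" by (simp add: additive_group_def)
  then show "int_multiple (- k) d = - int_multiple k d"
    unfolding add by (simp add: minus_unique)
qed

lemma (in radical_endomorphisms) int_multiple_in:
  assumes "j \<in> J"
  shows "(\<lambda>a. j (int_multiple k a)) \<in> J"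
proof (induction k rule: int_induct[where k = 0])
  case base
  then show ?case using assms zero by (simp add: int_multiple_simps additive_0)
next
  case (step1 i)
  then show ?case
    using plus[OF step1(2) assms] by (simp add: int_multiple_simps additive assms)
next
  case (step2 i)
  have "(\<lambda>a. j (int_multiple (i - 1) a)) = (\<lambda>a. j (int_multiple i a) + - j a)"
  proof
    fix a :: 'd
    have "int_multiple (i - 1) a = int_multiple i a - a"
      using int_multiple_simps(3)[where k = i and l = "- 1" and d = a]
        int_multiple_simps(4)[where k = 1 and d = a] by (simp add: int_multiple_simps(2))
    then show "j (int_multiple (i - 1) a) = j (int_multiple i a) + - j a"
      using additive[OF assms, of "int_multiple i a" "- a"] additive_minus[OF assms] by simp
  qed
  then show ?case using plus[OF step2(2) minus[OF assms]] by simp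
qed

text \<open>
  Lift the solution over \<open>S\<close> to \<open>x\<close> and look for a solution of the form \<open>x i \<otimes> \<iota> (e i)\<close>. Moving all \<open>\<iota> (e j)\<close> to the
  right of a term changes them by elements of \<open>J\<close> only (Fox calculus), so that the coefficient of \<open>e j\<close> is
  its exponent sum, which is 0, plus an element of \<open>J\<close>: a linear system over \<open>J\<close> remains.
\<close>

theorem (in radical_endomorphisms) uniquely_solvable_extension:
  fixes T :: "('t, 'm) monoid_scheme" and S :: "('s, 'n) monoid_scheme" and \<iota> :: "'d \<Rightarrow> 't"
  assumes T: "group T" and S: "group S"
    and \<pi>: "\<pi> \<in> hom T S" "\<pi> ` carrier T = carrier S"
    and \<iota>: "\<And>a. \<iota> a \<in> carrier T" "\<And>a b. \<iota> (a + b) = \<iota> a \<otimes>\<^bsub>T\<^esub> \<iota> b" "inj \<iota>"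
    and ker: "\<And>t. t \<in> carrier T \<Longrightarrow> \<pi> t = \<one>\<^bsub>S\<^esub> \<longleftrightarrow> t \<in> range \<iota>"
    and action: "\<And>t. t \<in> carrier T \<Longrightarrow> \<exists>k\<in>J. \<forall>a. inv\<^bsub>T\<^esub> t \<otimes>\<^bsub>T\<^esub> \<iota> a \<otimes>\<^bsub>T\<^esub> t = \<iota> (a + k a)"
    and "uniquely_solvable S"
  shows "uniquely_solvable T"
proof -
  interpret T: group T by fact
  interpret S: group S by fact
  interpret \<pi>: group_hom T S \<pi> using \<pi> T S by (simp add: group_hom_def group_hom_axioms_def)
  have \<iota>_0: "\<iota> 0 = \<one>\<^bsub>T\<^esub>" using \<iota>(2)[of 0 0] \<iota>(1)[of 0] T.r_cancel_one'[of "\<iota> 0" "\<iota> 0"] by simp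
  have \<iota>_minus: "inv\<^bsub>T\<^esub> \<iota> a = \<iota> (- a)" for a
    by (rule T.inv_equality) (simp_all add: \<iota>(1) \<iota>_0 flip: \<iota>(2))
  have move: "\<exists>k\<in>J. \<forall>a. \<iota> a \<otimes>\<^bsub>T\<^esub> t = t \<otimes>\<^bsub>T\<^esub> \<iota> (a + k a)" if t: "t \<in> carrier T" for t
  proof -
    obtain k where "k \<in> J" and k: "\<And>a. inv\<^bsub>T\<^esub> t \<otimes>\<^bsub>T\<^esub> \<iota> a \<otimes>\<^bsub>T\<^esub> t = \<iota> (a + k a)"
      using action[OF t] by blast
    have "\<iota> a \<otimes>\<^bsub>T\<^esub> t = t \<otimes>\<^bsub>T\<^esub> \<iota> (a + k a)" for a
      unfolding k[symmetric] using t \<iota>(1)[of a] by (simp add: T.m_assoc[symmetric])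
    then show ?thesis using \<open>k \<in> J\<close> by blast
  qed
  have expand: "\<exists>\<delta>. (\<forall>j<n. \<delta> j \<in> J) \<and> (\<forall>e. gval T (\<lambda>j. x j \<otimes>\<^bsub>T\<^esub> \<iota> (e j)) t =
      gval T x t \<otimes>\<^bsub>T\<^esub> \<iota> (\<Sum>j<n. int_multiple (expo j t) (e j) + \<delta> j (e j)))"
    if t: "gterm_over (carrier T) n t" and x: "\<And>i. i < n \<Longrightarrow> x i \<in> carrier T" for n x t
    using t
  proof (induction t)
    case (Const a)
    then show ?case
      using zero by (intro exI[of _ "\<lambda>_ _. 0"]) (simp add: int_multiple_simps \<iota>_0)
  next
    case (Var i)
    have "(\<Sum>j<n. int_multiple (if i = j then 1 else 0) (e j) + 0) = e i"
      for e :: "nat \<Rightarrow> 'd"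
    proof -
      have "(\<Sum>j<n. int_multiple (if i = j then 1 else 0) (e j) + 0) = (\<Sum>j<n. if i = j then e j else 0)"
        by (intro sum.cong) (auto simp: int_multiple_simps)
      then show ?thesis using Var by simp
    qed
    then show ?case
      using zero by (intro exI[of _ "\<lambda>_ _. 0"]) (simp cong: if_cong)
  next
    case (Mul s t)
    obtain \<delta> where \<delta>: "\<And>j. j < n \<Longrightarrow> \<delta> j \<in> J" "\<And>e. gval T (\<lambda>j. x j \<otimes>\<^bsub>T\<^esub> \<iota> (e j)) s =
        gval T x s \<otimes>\<^bsub>T\<^esub> \<iota> (\<Sum>j<n. int_multiple (expo j s) (e j) + \<delta> j (e j))"
      using Mul by auto
    obtain \<epsilon> where \<epsilon>: "\<And>j. j < n \<Longrightarrow> \<epsilon> j \<in> J" "\<And>e. gval T (\<lambda>j. x j \<otimes>\<^bsub>T\<^esub> \<iota> (e j)) t =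
        gval T x t \<otimes>\<^bsub>T\<^esub> \<iota> (\<Sum>j<n. int_multiple (expo j t) (e j) + \<epsilon> j (e j))"
      using Mul by auto
    have st: "gval T x s \<in> carrier T" "gval T x t \<in> carrier T"
      using Mul.prems x T.gval_closed[of n] by auto
    obtain k where k: "k \<in> J" "\<And>a. \<iota> a \<otimes>\<^bsub>T\<^esub> gval T x t = gval T x t \<otimes>\<^bsub>T\<^esub> \<iota> (a + k a)"
      using move[OF st(2)] by blast
    let ?\<theta> = "\<lambda>j a. \<delta> j a + \<epsilon> j a + (k (int_multiple (expo j s) a) + k (\<delta> j a))"
    have "?\<theta> j \<in> J" if "j < n" for j
      by (rule plus[OF plus[OF \<delta>(1)[OF that] \<epsilon>(1)[OF that]]
            plus[OF int_multiple_in[OF k(1)] compose[OF k(1) \<delta>(1)[OF that]]]])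
    moreover have "gval T (\<lambda>j. x j \<otimes>\<^bsub>T\<^esub> \<iota> (e j)) (Mul s t) = gval T x (Mul s t) \<otimes>\<^bsub>T\<^esub>
        \<iota> (\<Sum>j<n. int_multiple (expo j (Mul s t)) (e j) + ?\<theta> j (e j))" for e
    proof -
      let ?a = "\<Sum>j<n. int_multiple (expo j s) (e j) + \<delta> j (e j)"
      let ?b = "\<Sum>j<n. int_multiple (expo j t) (e j) + \<epsilon> j (e j)"
      have "gval T (\<lambda>j. x j \<otimes>\<^bsub>T\<^esub> \<iota> (e j)) (Mul s t) =
          gval T x s \<otimes>\<^bsub>T\<^esub> ((\<iota> ?a \<otimes>\<^bsub>T\<^esub> gval T x t) \<otimes>\<^bsub>T\<^esub> \<iota> ?b)"
        using st \<iota>(1) by (simp add: \<delta>(2) \<epsilon>(2) T.m_assoc)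
      also have "\<dots> = gval T x s \<otimes>\<^bsub>T\<^esub> gval T x t \<otimes>\<^bsub>T\<^esub> \<iota> (?a + k ?a + ?b)"
        unfolding k(2) using st \<iota>(1) by (simp add: T.m_assoc \<iota>(2))
      also have "?a + k ?a + ?b = (\<Sum>j<n. int_multiple (expo j (Mul s t)) (e j) + ?\<theta> j (e j))"
        by (simp add: additive_sum[OF k(1)] additive[OF k(1)] int_multiple_simps sum.distrib algebra_simps)
      finally show ?thesis by simp
    qed
    ultimately show ?case by (intro exI[of _ ?\<theta>]) blast
  next
    case (Inv t)
    obtain \<epsilon> where \<epsilon>: "\<And>j. j < n \<Longrightarrow> \<epsilon> j \<in> J" "\<And>e. gval T (\<lambda>j. x j \<otimes>\<^bsub>T\<^esub> \<iota> (e j)) t =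
        gval T x t \<otimes>\<^bsub>T\<^esub> \<iota> (\<Sum>j<n. int_multiple (expo j t) (e j) + \<epsilon> j (e j))"
      using Inv by auto
    have t: "gval T x t \<in> carrier T" using Inv.prems x T.gval_closed[of n] by auto
    obtain k where k: "k \<in> J"
        "\<And>a. \<iota> a \<otimes>\<^bsub>T\<^esub> inv\<^bsub>T\<^esub> gval T x t = inv\<^bsub>T\<^esub> gval T x t \<otimes>\<^bsub>T\<^esub> \<iota> (a + k a)"
      using move[OF T.inv_closed[OF t]] by blast
    let ?\<theta> = "\<lambda>j a. - \<epsilon> j a + (- k (int_multiple (expo j t) a) + - k (\<epsilon> j a))"
    have "?\<theta> j \<in> J" if "j < n" for j
      by (rule plus[OF minus[OF \<epsilon>(1)[OF that]] plus[OF minus[OF int_multiple_in[OF k(1)]]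
            minus[OF compose[OF k(1) \<epsilon>(1)[OF that]]]]])
    moreover have "gval T (\<lambda>j. x j \<otimes>\<^bsub>T\<^esub> \<iota> (e j)) (Inv t) = gval T x (Inv t) \<otimes>\<^bsub>T\<^esub>
        \<iota> (\<Sum>j<n. int_multiple (expo j (Inv t)) (e j) + ?\<theta> j (e j))" for e
    proof -
      let ?b = "\<Sum>j<n. int_multiple (expo j t) (e j) + \<epsilon> j (e j)"
      have "gval T (\<lambda>j. x j \<otimes>\<^bsub>T\<^esub> \<iota> (e j)) (Inv t) = \<iota> (- ?b) \<otimes>\<^bsub>T\<^esub> inv\<^bsub>T\<^esub> gval T x t"
        using t \<iota>(1) by (simp add: \<epsilon>(2) T.inv_mult_group \<iota>_minus)
      also have "\<dots> = inv\<^bsub>T\<^esub> gval T x t \<otimes>\<^bsub>T\<^esub> \<iota> (- ?b + k (- ?b))" by (rule k(2))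
      also have "- ?b + k (- ?b) = (\<Sum>j<n. int_multiple (expo j (Inv t)) (e j) + ?\<theta> j (e j))"
      proof -
        have "k ?b = (\<Sum>j<n. k (int_multiple (expo j t) (e j)) + k (\<epsilon> j (e j)))"
          by (simp only: additive_sum[OF k(1)] additive[OF k(1)])
        then show ?thesis
          unfolding additive_minus[OF k(1)]
          by (simp add: int_multiple_simps sum.distrib sum_negf sum_subtractf algebra_simps)
      qed
      finally show ?thesis by simp
    qed
    ultimately show ?case by (intro exI[of _ ?\<theta>]) blast
  qed
  show ?thesis
    unfolding uniquely_solvable_def
  proof (intro allI impI)
    fix n w assume w: "contractible_system T n w"
    have w': "contractible_system S n (\<lambda>i. map_gterm \<pi> (w i))"
      using w gterm_over_map[of "carrier T" n _ \<pi> "carrier S"] \<pi>(2)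
      by (simp add: contractible_system_def expo_map)
    obtain s where s: "solves S n (\<lambda>i. map_gterm \<pi> (w i)) s"
      and s_unique: "\<And>y i. solves S n (\<lambda>i. map_gterm \<pi> (w i)) y \<Longrightarrow> i < n \<Longrightarrow> y i = s i"
      using \<open>uniquely_solvable S\<close> w' unfolding uniquely_solvable_def by blast
    have sS: "s i \<in> carrier S" if "i < n" for i using s that unfolding solves_def by blast
    have "\<exists>t\<in>carrier T. \<pi> t = s i" if "i < n" for i
    proof -
      have "s i \<in> \<pi> ` carrier T" using sS[OF that] by (simp only: \<pi>(2))
      then show ?thesis by (auto simp: image_iff)
    qed
    then obtain x where x: "\<And>i. i < n \<Longrightarrow> x i \<in> carrier T" "\<And>i. i < n \<Longrightarrow> \<pi> (x i) = s i"
      by metis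
    have wT: "gterm_over (carrier T) n (w i)" "\<And>j. j < n \<Longrightarrow> expo j (w i) = 0" if "i < n" for i
      using w that by (simp_all add: contractible_system_def)
    have valT: "gval T x (w i) \<in> carrier T" if "i < n" for i
      using T.gval_closed[OF wT(1)[OF that] x(1)] by simp
    have solves_proj: "solves S n (\<lambda>i. map_gterm \<pi> (w i)) (\<lambda>i. \<pi> (y i))" if y: "solves T n w y" for y
    proof -
      have yT: "\<And>i. i < n \<Longrightarrow> y i \<in> carrier T" using y unfolding solves_def by blast
      have "\<pi> (y i) = gval S (\<lambda>i. \<pi> (y i)) (map_gterm \<pi> (w i))" if i: "i < n" for i
      proof -
        have "y i = gval T y (w i)" using y i by (simp add: solves_def)
        then have "\<pi> (y i) = \<pi> (gval T y (w i))" by (rule arg_cong)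
        also have "\<dots> = gval S (\<lambda>i. \<pi> (y i)) (map_gterm \<pi> (w i))"
          by (rule gval_map[OF \<pi>(1) T S wT(1)[OF i] yT])
        finally show ?thesis .
      qed
      then show ?thesis using \<pi>.hom_closed[OF yT] unfolding solves_def by blast
    qed
    have "\<exists>a. gval T x (w i) = x i \<otimes>\<^bsub>T\<^esub> \<iota> a" if i: "i < n" for i
    proof -
      have "\<pi> (gval T x (w i)) = gval S (\<lambda>i. \<pi> (x i)) (map_gterm \<pi> (w i))"
        by (rule gval_map[OF \<pi>(1) T S wT(1)[OF i] x(1)])
      also have "\<dots> = gval S s (map_gterm \<pi> (w i))"
        by (rule gval_cong[OF gterm_over_map[OF wT(1)[OF i]], of \<pi> "carrier S"]) (use \<pi>(2) x(2) in auto)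
      also have "\<dots> = s i" using s i unfolding solves_def by metis
      finally have "\<pi> (inv\<^bsub>T\<^esub> x i \<otimes>\<^bsub>T\<^esub> gval T x (w i)) = \<one>\<^bsub>S\<^esub>"
        using x i valT[OF i] sS by simp
      then obtain a where "inv\<^bsub>T\<^esub> x i \<otimes>\<^bsub>T\<^esub> gval T x (w i) = \<iota> a"
        using ker x(1)[OF i] valT[OF i] by (metis T.inv_closed T.m_closed imageE)
      then have "gval T x (w i) = x i \<otimes>\<^bsub>T\<^esub> \<iota> a"
        using T.inv_solve_left[OF \<iota>(1) x(1)[OF i] valT[OF i]] by metis
      then show ?thesis by blast
    qed
    then obtain c where c: "\<And>i. i < n \<Longrightarrow> gval T x (w i) = x i \<otimes>\<^bsub>T\<^esub> \<iota> (c i)" by metis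
    obtain m where m: "\<And>i j. i < n \<Longrightarrow> j < n \<Longrightarrow> m i j \<in> J"
      and m_eq: "\<And>i e. i < n \<Longrightarrow> gval T (\<lambda>j. x j \<otimes>\<^bsub>T\<^esub> \<iota> (e j)) (w i) =
        gval T x (w i) \<otimes>\<^bsub>T\<^esub> \<iota> (\<Sum>j<n. int_multiple (expo j (w i)) (e j) + m i j (e j))"
    proof -
      have "\<forall>i\<in>{..<n}. \<exists>\<delta>. (\<forall>j<n. \<delta> j \<in> J) \<and> (\<forall>e. gval T (\<lambda>j. x j \<otimes>\<^bsub>T\<^esub> \<iota> (e j)) (w i) =
        gval T x (w i) \<otimes>\<^bsub>T\<^esub> \<iota> (\<Sum>j<n. int_multiple (expo j (w i)) (e j) + \<delta> j (e j)))"
        using expand wT(1) x(1) by simp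
      from bchoice[OF this] show ?thesis using that by auto
    qed
    have solves_iff: "solves T n w (\<lambda>j. x j \<otimes>\<^bsub>T\<^esub> \<iota> (e j)) \<longleftrightarrow>
        (\<forall>i<n. e i = c i + (\<Sum>j<n. m i j (e j)))" for e
    proof -
      have "x i \<otimes>\<^bsub>T\<^esub> \<iota> (e i) = gval T (\<lambda>j. x j \<otimes>\<^bsub>T\<^esub> \<iota> (e j)) (w i) \<longleftrightarrow>
          e i = c i + (\<Sum>j<n. m i j (e j))" if i: "i < n" for i
      proof -
        have "gval T (\<lambda>j. x j \<otimes>\<^bsub>T\<^esub> \<iota> (e j)) (w i) = x i \<otimes>\<^bsub>T\<^esub> \<iota> (c i + (\<Sum>j<n. m i j (e j)))"
          using m_eq[OF i] wT(2)[OF i] c[OF i] x(1)[OF i] \<iota>(1)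
          by (simp add: int_multiple_simps \<iota>(2) T.m_assoc)
        then show ?thesis using x(1)[OF i] \<iota>(1) \<iota>(3) by (simp add: inj_eq)
      qed
      then show ?thesis using x(1) \<iota>(1) by (auto simp: solves_def)
    qed
    obtain e where e: "\<forall>i<n. e i = c i + (\<Sum>j<n. m i j (e j))"
      and e_unique: "\<And>d. (\<forall>i<n. d i = c i + (\<Sum>j<n. m i j (d j))) \<Longrightarrow> (\<forall>i<n. d i = e i)"
      using linear_system_uniquely_solvable[of n m c, OF m] by blast
    have "\<forall>i<n. y i = x i \<otimes>\<^bsub>T\<^esub> \<iota> (e i)" if y: "solves T n w y" for y
    proof -
      have yT: "\<And>i. i < n \<Longrightarrow> y i \<in> carrier T" using y unfolding solves_def by blast
      have "\<exists>a. y i = x i \<otimes>\<^bsub>T\<^esub> \<iota> a" if i: "i < n" for i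
      proof -
        have "\<pi> (y i) = s i" by (rule s_unique[OF solves_proj[OF y] i])
        then have "\<pi> (inv\<^bsub>T\<^esub> x i \<otimes>\<^bsub>T\<^esub> y i) = \<one>\<^bsub>S\<^esub>"
          using x i yT[OF i] sS by simp
        then obtain a where "inv\<^bsub>T\<^esub> x i \<otimes>\<^bsub>T\<^esub> y i = \<iota> a"
          using ker x(1)[OF i] yT[OF i] by (metis T.inv_closed T.m_closed imageE)
        then show ?thesis
          using T.inv_solve_left[OF \<iota>(1) x(1)[OF i] yT[OF i]] by metis
      qed
      then obtain d where d: "\<And>i. i < n \<Longrightarrow> y i = x i \<otimes>\<^bsub>T\<^esub> \<iota> (d i)" by metis
      have "gval T y (w i) = gval T (\<lambda>j. x j \<otimes>\<^bsub>T\<^esub> \<iota> (d j)) (w i)" if "i < n" for i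
        by (rule gval_cong[OF wT(1)[OF that] d])
      then have "solves T n w (\<lambda>j. x j \<otimes>\<^bsub>T\<^esub> \<iota> (d j))"
        using y d yT unfolding solves_def by metis
      then show ?thesis using e_unique d unfolding solves_iff by simp
    qed
    moreover have "solves T n w (\<lambda>j. x j \<otimes>\<^bsub>T\<^esub> \<iota> (e j))" using e by (simp add: solves_iff)
    ultimately show "\<exists>x. solves T n w x \<and> (\<forall>y. solves T n w y \<longrightarrow> (\<forall>i<n. y i = x i))" by blast
  qed
qed

section \<open>Groups with uniquely solvable systems are local\<close>

fun term_of_word :: "'t \<Rightarrow> nat word \<Rightarrow> 't gterm"
  where
    "term_of_word a [] = Const a"
  | "term_of_word a ((i, e) # u) = Mul (if e then Var i else Inv (Var i)) (term_of_word a u)"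

lemma gval_term_of_word: "gval T x (term_of_word \<one>\<^bsub>T\<^esub> u) = word_value T x u"
  by (induction T x u rule: word_value.induct) auto

lemma gterm_over_term_of_word: "u \<in> words {..<n} \<Longrightarrow> gterm_over {a} n (term_of_word a u)"
  by (induction a u rule: term_of_word.induct) auto

lemma gterm_over_mono: "gterm_over A n t \<Longrightarrow> A \<subseteq> B \<Longrightarrow> gterm_over B n t"
  by (induction t) auto

lemma map_gterm_const: "gterm_over {a} n t \<Longrightarrow> f a = b \<Longrightarrow> map_gterm f t = map_gterm (\<lambda>_. b) t"
  by (induction t) auto

lemma (in group) gval_at_one: "gterm_over {\<one>} n t \<Longrightarrow> gval G (\<lambda>_. \<one>) t = \<one>"
  by (induction t) auto

text \<open>
  The abelianisation of \<open>E\<close>, written as first bar homology.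
\<close>

lemma homology_class_hom:
  assumes "group E"
  defines "Q \<equiv> bar_chain_group 1 E Mod bar_boundaries 1 E"
    and "\<theta> \<equiv> \<lambda>e. r_coset (bar_chain_group 1 E) (bar_boundaries 1 E) (frag_of [e])"
  shows "comm_group Q" "\<theta> \<in> hom E Q"
    and "\<And>x y. x \<in> carrier E \<Longrightarrow> y \<in> carrier E \<Longrightarrow>
      \<theta> x = \<theta> y \<longleftrightarrow> frag_of [x] - frag_of [y] \<in> bar_boundaries 1 E"
proof -
  interpret E: group E by fact
  let ?C = "bar_chain_group 1 E" and ?B = "bar_boundaries 1 E"
  interpret C: comm_group ?C by (simp add: bar_chain_group_def abelian_free_Abelian_group)
  have ops: "x \<otimes>\<^bsub>?C\<^esub> y = x + y" "x \<in> carrier ?C \<Longrightarrow> inv\<^bsub>?C\<^esub> x = - x" for x y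
    by (simp_all add: bar_chain_group_def)
  have B_C: "b \<in> carrier ?C" if "b \<in> ?B" for b using that bar_boundaries_1_subset[OF assms(1)] by blast
  have sub: "subgroup ?B ?C"
  proof (rule C.subgroupI)
    show "?B \<noteq> {}" using bar_boundaries_closed(1) by blast
    show "inv\<^bsub>?C\<^esub> a \<in> ?B" if "a \<in> ?B" for a
      using that ops(2)[OF B_C[OF that]] bar_boundaries_closed(4) by metis
    show "a \<otimes>\<^bsub>?C\<^esub> b \<in> ?B" if "a \<in> ?B" "b \<in> ?B" for a b
      unfolding ops(1) using that by (rule bar_boundaries_closed(2))
  qed (use B_C in blast)
  note N = normal_quotient[OF C.subgroup_imp_normal[OF sub]]
  show "comm_group Q" unfolding Q_def by (rule C.abelian_FactGroup[OF sub])
  have in1: "frag_of [e] \<in> carrier ?C" if "e \<in> carrier E" for e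
    using that by (simp add: carrier_bar_chain_group_closed bar_simplices_1 del: One_nat_def)
  have eq: "r_coset ?C ?B x = r_coset ?C ?B y \<longleftrightarrow> x - y \<in> ?B" if "x \<in> carrier ?C" "y \<in> carrier ?C" for x y
    using N(3)[OF that] that by (simp add: ops del: One_nat_def)
  show "\<theta> x = \<theta> y \<longleftrightarrow> frag_of [x] - frag_of [y] \<in> ?B" if "x \<in> carrier E" "y \<in> carrier E" for x y
    unfolding \<theta>_def by (rule eq[OF in1[OF that(1)] in1[OF that(2)]])
  show "\<theta> \<in> hom E Q"
  proof (rule homI)
    show "\<theta> x \<in> carrier Q" if "x \<in> carrier E" for x
      unfolding \<theta>_def Q_def N(5) using in1[OF that] by blast
    show "\<theta> (x \<otimes>\<^bsub>E\<^esub> y) = \<theta> x \<otimes>\<^bsub>Q\<^esub> \<theta> y" if xy: "x \<in> carrier E" "y \<in> carrier E" for x y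
    proof -
      have "frag_of [x, y] \<in> carrier (bar_chain_group 2 E)"
        using xy by (simp add: carrier_bar_chain_group_closed bar_simplices_2)
      then have "- bar_boundary E (frag_of [x, y]) \<in> ?B"
        by (intro bar_boundaries_closed(4)) (auto simp: bar_boundaries_def simp flip: numeral_2_eq_2)
      then have "frag_of [x \<otimes>\<^bsub>E\<^esub> y] - (frag_of [x] + frag_of [y]) \<in> ?B"
        by (simp add: bar_boundary_simps algebra_simps)
      then have "\<theta> (x \<otimes>\<^bsub>E\<^esub> y) = r_coset ?C ?B (frag_of [x] + frag_of [y])"
        unfolding \<theta>_def
        using eq[OF in1[OF E.m_closed[OF xy]] carrier_bar_chain_group_closed(2)[OF in1 in1], of x y] xy
        by blast
      also have "\<dots> = \<theta> x \<otimes>\<^bsub>Q\<^esub> \<theta> y"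
        using hom_mult[OF N(2) in1 in1] xy unfolding ops(1) \<theta>_def Q_def by simp
      finally show ?thesis .
    qed
  qed
qed

text \<open>
  Surjectivity on first homology writes \<open>y\<close> as an element of the image times an element of the derived subgroup, and
  the latter is a product of commutators of words in the generators. This is the source of systems with exponent sum 0.
\<close>

lemma two_connected_generators:
  assumes grp: "group G" "group K" and f: "two_connected G K f"
    and K: "presents K n R k" and y: "y \<in> carrier K"
  shows "\<exists>x\<in>carrier G. \<exists>t. gterm_over {\<one>\<^bsub>K\<^esub>} n t \<and> (\<forall>j. expo j t = 0) \<and>
    y = gval K k t \<otimes>\<^bsub>K\<^esub> f x"
proof -
  interpret G: group G by fact
  interpret K: group K by fact
  have f_hom: "f \<in> hom G K" using f by (simp add: two_connected_def)
  interpret f: group_hom G K f using f_hom grp by (simp add: group_hom_def group_hom_axioms_def)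
  note pres = presentsD[OF K grp(2)]
  let ?D = "derived K (carrier K)"
  let ?Q = "K Mod ?D"
  have normal: "?D \<lhd> K" by (rule K.derived_self_is_normal)
  note N = normal_quotient[OF normal]
  interpret Q: comm_group ?Q by (rule K.derived_quot_is_comm_group)
  let ?\<pi> = "\<lambda>x. r_coset K ?D x"
  interpret \<pi>: group_hom K ?Q ?\<pi>
    using N(1,2) grp by (simp add: group_hom_def group_hom_axioms_def)
  have \<pi>_simplex: "?\<pi> (xs ! 0) \<in> carrier ?Q" if "xs \<in> bar_simplices 1 K" for xs
    using that \<pi>.hom_closed unfolding bar_simplices_1 by auto
  obtain \<theta> where \<theta>: "\<theta> \<in> hom (bar_chain_group 1 K) ?Q"
      and \<theta>_of: "\<And>xs. xs \<in> bar_simplices 1 K \<Longrightarrow> \<theta> (frag_of xs) = ?\<pi> (xs ! 0)"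
    by (rule bar_chain_hom_exists[OF Q.comm_group_axioms, OF \<pi>_simplex]) blast+
  note \<theta>s = hom_bar_chain_simps[OF \<theta> Q.group_axioms]
  have in1: "frag_of [x] \<in> carrier (bar_chain_group 1 K)" if "x \<in> carrier K" for x
    using that by (simp add: carrier_bar_chain_group_closed bar_simplices_1 del: One_nat_def)
  have \<theta>_1: "\<theta> (frag_of [x]) = ?\<pi> x" if "x \<in> carrier K" for x
    using \<theta>_of[of "[x]"] that by (simp add: bar_simplices_1 del: One_nat_def)
  have \<theta>_boundary: "\<theta> (bar_boundary K b) = \<one>\<^bsub>?Q\<^esub>" if "b \<in> carrier (bar_chain_group 2 K)" for b
    using that
  proof (induction rule: bar_chain_diff_induct)
    case zero
    then show ?case
      using \<theta>s(4) carrier_bar_chain_group_closed(1) by (metis bar_boundary_simps(1))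
  next
    case (diff c d)
    then show ?case
      using bar_boundary_closed_2[OF grp(2)] by (simp add: bar_boundary_simps \<theta>s del: one_FactGroup mult_FactGroup)
  next
    case (simplex xs)
    then obtain a b where ab: "a \<in> carrier K" "b \<in> carrier K" "xs = [a, b]"
      by (auto simp: bar_simplices_2)
    have "\<theta> (bar_boundary K (frag_of xs)) = ?\<pi> b \<otimes>\<^bsub>?Q\<^esub> inv\<^bsub>?Q\<^esub> ?\<pi> (a \<otimes>\<^bsub>K\<^esub> b) \<otimes>\<^bsub>?Q\<^esub> ?\<pi> a"
      using ab in1 carrier_bar_chain_group_closed(3)[OF in1 in1]
      by (simp add: bar_boundary_simps \<theta>s \<theta>_1 del: one_FactGroup mult_FactGroup)
    also have "\<dots> = (?\<pi> a \<otimes>\<^bsub>?Q\<^esub> ?\<pi> b) \<otimes>\<^bsub>?Q\<^esub> inv\<^bsub>?Q\<^esub> (?\<pi> a \<otimes>\<^bsub>?Q\<^esub> ?\<pi> b)"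
      using ab \<pi>.hom_closed by (simp only: \<pi>.hom_mult Q.m_ac Q.inv_closed Q.m_closed)
    also have "\<dots> = \<one>\<^bsub>?Q\<^esub>" using ab \<pi>.hom_closed by (simp only: Q.r_inv Q.m_closed)
    finally show ?case .
  qed
  have \<theta>_f: "\<exists>x\<in>carrier G. \<theta> (bar_chain_map f d) = ?\<pi> (f x)" if "d \<in> carrier (bar_chain_group 1 G)" for d
    using that
  proof (induction rule: bar_chain_diff_induct)
    case zero
    have "\<theta> (bar_chain_map f 0) = ?\<pi> (f \<one>\<^bsub>G\<^esub>)"
      using \<theta>s(4) carrier_bar_chain_group_closed(1) f.hom_one \<pi>.hom_one
      by (metis bar_chain_map_simps(1))
    then show ?case by blast
  next
    case (diff c d)
    obtain x y where xy: "x \<in> carrier G" "\<theta> (bar_chain_map f c) = ?\<pi> (f x)"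
        "y \<in> carrier G" "\<theta> (bar_chain_map f d) = ?\<pi> (f y)"
      using diff by blast
    have "\<theta> (bar_chain_map f (c - d)) = ?\<pi> (f x) \<otimes>\<^bsub>?Q\<^esub> inv\<^bsub>?Q\<^esub> ?\<pi> (f y)"
      unfolding bar_chain_map_simps xy(2,4)[symmetric]
      by (rule \<theta>s(2)[OF bar_chain_map_closed[OF f_hom diff(1)] bar_chain_map_closed[OF f_hom diff(2)]])
    also have "\<dots> = ?\<pi> (f (x \<otimes>\<^bsub>G\<^esub> inv\<^bsub>G\<^esub> y))"
      using xy by (simp only: \<pi>.hom_mult \<pi>.hom_inv f.hom_mult f.hom_inv f.hom_closed G.inv_closed K.inv_closed)
    finally show ?case using xy by blast
  next
    case (simplex xs)
    then show ?case
      unfolding bar_simplices_1 using \<theta>_1 f.hom_closed by (auto simp: bar_chain_map_simps)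
  qed
  obtain d where d: "d \<in> carrier (bar_chain_group 1 G)"
      "frag_of [y] - bar_chain_map f d \<in> bar_boundaries 1 K"
    using f[unfolded two_connected_iff[OF grp]] in1[OF y] by blast
  obtain b where b: "b \<in> carrier (bar_chain_group 2 K)"
      "frag_of [y] - bar_chain_map f d = bar_boundary K b"
    using d(2) by (auto simp: bar_boundaries_def simp flip: numeral_2_eq_2)
  obtain x where x: "x \<in> carrier G" "\<theta> (bar_chain_map f d) = ?\<pi> (f x)" using \<theta>_f[OF d(1)] by blast
  have "frag_of [y] = bar_boundary K b + bar_chain_map f d" using b(2) by (simp add: algebra_simps)
  then have "?\<pi> y = \<theta> (bar_boundary K b + bar_chain_map f d)" using \<theta>_1[OF y] by simp
  also have "\<dots> = ?\<pi> (f x)"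
    using \<theta>s(1)[OF bar_boundary_closed_2[OF grp(2) b(1)] bar_chain_map_closed[OF f_hom d(1)]]
      \<theta>_boundary[OF b(1)] x Q.l_one[OF \<pi>.hom_closed[OF f.hom_closed[OF x(1)]]] by simp
  finally have D: "y \<otimes>\<^bsub>K\<^esub> inv\<^bsub>K\<^esub> f x \<in> ?D" using N(3)[OF y f.hom_closed[OF x(1)]] by blast
  let ?P = "\<lambda>t. gterm_over {\<one>\<^bsub>K\<^esub>} n t \<and> (\<forall>j. expo j t = 0)"
  have as_gterm: "\<exists>t. gterm_over {\<one>\<^bsub>K\<^esub>} n t \<and> a = gval K k t" if a: "a \<in> carrier K" for a
  proof -
    obtain u where u: "u \<in> words {..<n}" "a = word_value K k u" using pres(4)[OF a] by blast
    then show ?thesis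
      using gterm_over_term_of_word[OF u(1), of "\<one>\<^bsub>K\<^esub>"] gval_term_of_word[of K k u] by metis
  qed
  have comm: "\<exists>t. ?P t \<and> a \<otimes>\<^bsub>K\<^esub> b \<otimes>\<^bsub>K\<^esub> inv\<^bsub>K\<^esub> a \<otimes>\<^bsub>K\<^esub> inv\<^bsub>K\<^esub> b = gval K k t"
    if ab: "a \<in> carrier K" "b \<in> carrier K" for a b
  proof -
    obtain s t where st: "gterm_over {\<one>\<^bsub>K\<^esub>} n s" "a = gval K k s"
        "gterm_over {\<one>\<^bsub>K\<^esub>} n t" "b = gval K k t"
      using as_gterm[OF ab(1)] as_gterm[OF ab(2)] by blast
    show ?thesis
      by (rule exI[of _ "Mul (Mul (Mul s t) (Inv s)) (Inv t)"]) (use st in simp)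
  qed
  have comm_in: "h1 \<otimes>\<^bsub>K\<^esub> h2 \<otimes>\<^bsub>K\<^esub> inv\<^bsub>K\<^esub> h1 \<otimes>\<^bsub>K\<^esub> inv\<^bsub>K\<^esub> h2 \<in> {gval K k t |t. ?P t}"
    if "h1 \<in> carrier K" "h2 \<in> carrier K" for h1 h2
    using comm[OF that] by blast
  have "\<exists>t. ?P t \<and> a = gval K k t" if a: "a \<in> ?D" for a
    using a unfolding derived_def
  proof (induction rule: generate.induct)
    case one
    show ?case by (rule exI[of _ "Const \<one>\<^bsub>K\<^esub>"]) simp
  next
    case (incl h)
    then show ?case using comm by blast
  next
    case (inv h)
    then obtain t where "?P t" "h = gval K k t" using comm by blast
    then show ?case by (intro exI[of _ "Inv t"]) simp
  next
    case (eng h1 h2)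
    then obtain s t where "?P s" "h1 = gval K k s" "?P t" "h2 = gval K k t" by blast
    then show ?case by (intro exI[of _ "Mul s t"]) simp
  qed
  from this[OF D] obtain t where t: "?P t" "y \<otimes>\<^bsub>K\<^esub> inv\<^bsub>K\<^esub> f x = gval K k t" by blast
  have "y = (y \<otimes>\<^bsub>K\<^esub> inv\<^bsub>K\<^esub> f x) \<otimes>\<^bsub>K\<^esub> f x" using y x(1) by (simp add: K.m_assoc)
  then show ?thesis unfolding t(2) using t(1) x(1) by blast
qed

text \<open>
  Any extension sends the generators to a solution of the system from \<open>two_connected_generators\<close>.
\<close>

lemma local_extension_unique:
  assumes grp: "group G" "group K" "group T" and "uniquely_solvable T"
    and f: "two_connected G K f" and K: "presents K n R k"
    and h: "h \<in> hom K T" "h' \<in> hom K T" "\<And>x. x \<in> carrier G \<Longrightarrow> h (f x) = h' (f x)"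
    and y: "y \<in> carrier K"
  shows "h y = h' y"
proof -
  interpret K: group K by fact
  interpret T: group T by fact
  note pres = presentsD[OF K grp(2)]
  have f_hom: "f \<in> hom G K" using f by (simp add: two_connected_def)
  have "\<forall>i\<in>{..<n}. \<exists>x t. x \<in> carrier G \<and> gterm_over {\<one>\<^bsub>K\<^esub>} n t \<and> (\<forall>j. expo j t = 0) \<and>
      k i = gval K k t \<otimes>\<^bsub>K\<^esub> f x"
    using two_connected_generators[OF grp(1,2) f K pres(3)] by blast
  then obtain x t where x: "\<And>i. i < n \<Longrightarrow> x i \<in> carrier G"
      and t: "\<And>i. i < n \<Longrightarrow> gterm_over {\<one>\<^bsub>K\<^esub>} n (t i)" "\<And>i j. i < n \<Longrightarrow> expo j (t i) = 0"
      and k_eq: "\<And>i. i < n \<Longrightarrow> k i = gval K k (t i) \<otimes>\<^bsub>K\<^esub> f (x i)"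
    unfolding bchoice_iff by (metis lessThan_iff)
  define w where "w i = Mul (map_gterm (\<lambda>_. \<one>\<^bsub>T\<^esub>) (t i)) (Const (h (f (x i))))" for i
  have fx: "f (x i) \<in> carrier K" if "i < n" for i using hom_in_carrier[OF f_hom x[OF that]] .
  have "contractible_system T n w"
    using hom_in_carrier[OF h(1) fx] t gterm_over_map[of "{\<one>\<^bsub>K\<^esub>}" n _ "\<lambda>_. \<one>\<^bsub>T\<^esub>" "carrier T"]
    by (simp add: contractible_system_def w_def expo_map)
  then obtain x0 where unique: "\<And>y i. solves T n w y \<Longrightarrow> i < n \<Longrightarrow> y i = x0 i"
    using \<open>uniquely_solvable T\<close> unfolding uniquely_solvable_def by blast
  have solves: "solves T n w (\<lambda>i. g (k i))"
    if g: "g \<in> hom K T" "\<And>x. x \<in> carrier G \<Longrightarrow> g (f x) = h (f x)" for g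
  proof -
    have "g (k i) = gval T (\<lambda>i. g (k i)) (w i)" if i: "i < n" for i
    proof -
      have tK: "gterm_over (carrier K) n (t i)" using t(1)[OF i] by (rule gterm_over_mono) simp
      have "g (k i) = g (gval K k (t i)) \<otimes>\<^bsub>T\<^esub> g (f (x i))"
        using k_eq[OF i] hom_mult[OF g(1) K.gval_closed[OF tK pres(3)] fx[OF i]] by simp
      also have "g (gval K k (t i)) = gval T (\<lambda>i. g (k i)) (map_gterm g (t i))"
        by (rule gval_map[OF g(1) grp(2,3) tK pres(3)])
      also have "map_gterm g (t i) = map_gterm (\<lambda>_. \<one>\<^bsub>T\<^esub>) (t i)"
        by (rule map_gterm_const[OF t(1)[OF i]]) (rule hom_one[OF g(1) grp(2,3)])
      finally show ?thesis using g(2)[OF x[OF i]] by (simp add: w_def)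
    qed
    then show ?thesis using hom_in_carrier[OF g(1) pres(3)] unfolding solves_def by blast
  qed
  have gen: "h (k i) = h' (k i)" if "i < n" for i
    using unique[OF solves[OF h(1)] that] unique[OF solves[OF h(2)] that] h(3) by simp
  obtain u where u: "u \<in> words {..<n}" "y = word_value K k u" using pres(4)[OF y] by blast
  show ?thesis
    by (rule hom_eq_on_generators[OF grp(2,3) h(1,2) _ _ u]) (use pres(3) gen in auto)
qed

text \<open>
  The normal closure of the elements \<open>\<nu> 0, \<dots>, \<nu> (m - 1)\<close>: the values at \<open>\<nu>\<close> of the terms that vanish at
  \<open>\<one>\<close>. In this form a commutator with a member visibly has exponent sum 0 in \<open>\<nu>\<close>.
\<close>

definition vanishing_values :: "('t, 'm) monoid_scheme \<Rightarrow> nat \<Rightarrow> (nat \<Rightarrow> 't) \<Rightarrow> 't set"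
  where "vanishing_values T m \<nu> =
    {gval T \<nu> t |t. gterm_over (carrier T) m t \<and> gval T (\<lambda>_. \<one>\<^bsub>T\<^esub>) t = \<one>\<^bsub>T\<^esub>}"

lemma (in group) vanishing_values_normal:
  assumes \<nu>: "\<And>i. i < m \<Longrightarrow> \<nu> i \<in> carrier G"
  shows "vanishing_values G m \<nu> \<lhd> G"
proof -
  let ?P = "\<lambda>t. gterm_over (carrier G) m t \<and> gval G (\<lambda>_. \<one>) t = \<one>"
  have sub: "subgroup (vanishing_values G m \<nu>) G"
  proof (rule subgroupI)
    show "vanishing_values G m \<nu> \<subseteq> carrier G"
      using gval_closed[of m _ \<nu>] \<nu> by (auto simp: vanishing_values_def)
    have "?P (Const \<one>)" by simp
    then have "gval G \<nu> (Const \<one>) \<in> vanishing_values G m \<nu>"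
      unfolding vanishing_values_def by blast
    then show "vanishing_values G m \<nu> \<noteq> {}" by blast
    show "inv a \<in> vanishing_values G m \<nu>" if a: "a \<in> vanishing_values G m \<nu>" for a
    proof -
      obtain t where "?P t" "a = gval G \<nu> t" using a by (auto simp: vanishing_values_def)
      then have "?P (Inv t)" "inv a = gval G \<nu> (Inv t)" by auto
      then show ?thesis unfolding vanishing_values_def by blast
    qed
    show "a \<otimes> b \<in> vanishing_values G m \<nu>"
      if ab: "a \<in> vanishing_values G m \<nu>" "b \<in> vanishing_values G m \<nu>" for a b
    proof -
      obtain s t where "?P s" "a = gval G \<nu> s" "?P t" "b = gval G \<nu> t"
        using ab by (auto simp: vanishing_values_def)
      then have "?P (Mul s t)" "a \<otimes> b = gval G \<nu> (Mul s t)" by auto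
      then show ?thesis unfolding vanishing_values_def by blast
    qed
  qed
  show ?thesis
  proof (rule normal_invI[OF sub])
    fix g a assume g: "g \<in> carrier G" and a: "a \<in> vanishing_values G m \<nu>"
    obtain t where "?P t" "a = gval G \<nu> t" using a by (auto simp: vanishing_values_def)
    then have "?P (Mul (Mul (Const g) t) (Inv (Const g)))"
        "g \<otimes> a \<otimes> inv g = gval G \<nu> (Mul (Mul (Const g) t) (Inv (Const g)))" using g by auto
    then show "g \<otimes> a \<otimes> inv g \<in> vanishing_values G m \<nu>" unfolding vanishing_values_def by blast
  qed
qed

lemma vanishing_values_var:
  assumes "i < m"
  shows "\<nu> i \<in> vanishing_values T m \<nu>"
proof -
  have "gterm_over (carrier T) m (Var i) \<and> gval T (\<lambda>_. \<one>\<^bsub>T\<^esub>) (Var i) = \<one>\<^bsub>T\<^esub>"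
    using assms by simp
  then have "gval T \<nu> (Var i) \<in> vanishing_values T m \<nu>"
    unfolding vanishing_values_def by blast
  then show ?thesis by simp
qed

text \<open>
  The candidate images \<open>y i\<close> of the generators solve the system that they must satisfy. Let \<open>E \<subseteq> K \<times> T\<close> be generated
  by the pairs \<open>(k i, y i)\<close> and the graph of \<open>(f, g)\<close>. It is the graph of the extension once the kernel of \<open>E \<rightarrow> K\<close>
  is trivial. By Stallings' theorem this kernel equals its commutator with \<open>E\<close>; it lies in the
  normal closure of the finitely many \<open>\<nu> i\<close>, the values of the relators of \<open>K\<close> and the discrepancies on
  the generators of \<open>G\<close>. So the \<open>\<nu> i\<close> solve a system with exponent sum 0 which \<open>\<one>\<close> solves as well.
\<close>

lemma local_extension_exists:
  assumes grp: "group G" "group K" "group T" and US: "uniquely_solvable T"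
    and f: "two_connected G K f" and K: "presents K n R k" and G: "presents G p R' \<gamma>"
    and g: "g \<in> hom G T"
  shows "\<exists>h\<in>hom K T. \<forall>x\<in>carrier G. h (f x) = g x"
proof -
  interpret G: group G by fact
  interpret K: group K by fact
  interpret T: group T by fact
  note pres = presentsD[OF K grp(2)] and presG = presentsD[OF G grp(1)]
  have f_hom: "f \<in> hom G K" using f by (simp add: two_connected_def)
  have "\<forall>i\<in>{..<n}. \<exists>x t. x \<in> carrier G \<and> gterm_over {\<one>\<^bsub>K\<^esub>} n t \<and> (\<forall>j. expo j t = 0) \<and>
      k i = gval K k t \<otimes>\<^bsub>K\<^esub> f x"
    using two_connected_generators[OF grp(1,2) f K pres(3)] by blast
  then obtain x t where x: "\<And>i. i < n \<Longrightarrow> x i \<in> carrier G"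
      and t: "\<And>i. i < n \<Longrightarrow> gterm_over {\<one>\<^bsub>K\<^esub>} n (t i)" "\<And>i j. i < n \<Longrightarrow> expo j (t i) = 0"
      and k_eq: "\<And>i. i < n \<Longrightarrow> k i = gval K k (t i) \<otimes>\<^bsub>K\<^esub> f (x i)"
    unfolding bchoice_iff by (metis lessThan_iff)
  define w where "w i = Mul (map_gterm (\<lambda>_. \<one>\<^bsub>T\<^esub>) (t i)) (Const (g (x i)))" for i
  have gx: "g a \<in> carrier T" if "a \<in> carrier G" for a using hom_in_carrier[OF g that] .
  have fx: "f a \<in> carrier K" if "a \<in> carrier G" for a using hom_in_carrier[OF f_hom that] .
  have "contractible_system T n w"
    using gx[OF x] t gterm_over_map[of "{\<one>\<^bsub>K\<^esub>}" n _ "\<lambda>_. \<one>\<^bsub>T\<^esub>" "carrier T"]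
    by (simp add: contractible_system_def w_def expo_map)
  then obtain y where "solves T n w y" using US unfolding uniquely_solvable_def by blast
  then have y: "y i \<in> carrier T" "y i = gval T y (map_gterm (\<lambda>_. \<one>\<^bsub>T\<^esub>) (t i)) \<otimes>\<^bsub>T\<^esub> g (x i)" if "i < n" for i
    using that unfolding solves_def w_def gval.simps by blast+
  define P where "P = K \<times>\<times> T"
  interpret P: group P unfolding P_def by (rule DirProd_group[OF grp(2,3)])
  have carP: "e \<in> carrier P \<longleftrightarrow> fst e \<in> carrier K \<and> snd e \<in> carrier T" for e
    by (cases e) (simp add: P_def)
  define X where "X = {(k i, y i) |i. i < n} \<union> {(f a, g a) |a. a \<in> carrier G}"
  have X: "X \<subseteq> carrier P" using pres(3) y(1) fx gx by (auto simp: X_def carP)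
  define E where "E = P\<lparr>carrier := generate P X\<rparr>"
  have subE: "subgroup (generate P X) P" by (rule P.generate_is_subgroup[OF X])
  interpret E: group E unfolding E_def by (rule P.subgroup_imp_group[OF subE])
  have E_P: "e \<in> carrier K \<times> carrier T" if "e \<in> carrier E" for e
    using that P.generate_in_carrier[OF X] carP unfolding E_def by (auto simp: mem_Times_iff)
  have E_mult: "e \<otimes>\<^bsub>E\<^esub> e' = (fst e \<otimes>\<^bsub>K\<^esub> fst e', snd e \<otimes>\<^bsub>T\<^esub> snd e')" for e e'
    by (simp add: E_def P_def DirProd_def split_beta)
  have E_one: "\<one>\<^bsub>E\<^esub> = (\<one>\<^bsub>K\<^esub>, \<one>\<^bsub>T\<^esub>)" by (simp add: E_def P_def)
  have X_E: "e \<in> carrier E" if "e \<in> X" for e using that by (simp add: E_def generate.incl)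
  have E_induct [consumes 1, case_names gen one inv mult]: "Q e" if e: "e \<in> carrier E" and Q: "\<And>e. e \<in> X \<Longrightarrow> Q e" "Q \<one>\<^bsub>E\<^esub>"
      "\<And>e. e \<in> carrier E \<Longrightarrow> Q e \<Longrightarrow> Q (inv\<^bsub>E\<^esub> e)"
      "\<And>e e'. e \<in> carrier E \<Longrightarrow> e' \<in> carrier E \<Longrightarrow> Q e \<Longrightarrow> Q e' \<Longrightarrow> Q (e \<otimes>\<^bsub>E\<^esub> e')" for Q e
  proof -
    have "e \<in> generate P X" using e by (simp add: E_def)
    then show ?thesis
    proof (induction rule: generate.induct)
      case one
      then show ?case using Q(2) by (simp add: E_def)
    next
      case (inv h)
      have "inv\<^bsub>P\<^esub> h = inv\<^bsub>E\<^esub> h"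
        using P.m_inv_consistent[OF subE] inv generate.incl[of h X P] unfolding E_def by simp
      then show ?case using Q(1,3) X_E inv by simp
    next
      case (eng h1 h2)
      then show ?case using Q(4)[of h1 h2] by (simp add: E_def)
    qed (use Q(1) in blast)
  qed
  have fst_hom: "fst \<in> hom E K" and snd_hom: "snd \<in> hom E T"
    using E_P by (auto simp: hom_def E_mult)
  interpret fst: group_hom E K fst using fst_hom grp E.is_group by (simp add: group_hom_def group_hom_axioms_def)
  interpret snd: group_hom E T snd using snd_hom grp E.is_group by (simp add: group_hom_def group_hom_axioms_def)
  have ky: "(k i, y i) \<in> carrier E" if "i < n" for i using that X_E by (auto simp: X_def)
  have fgE: "(f a, g a) \<in> carrier E" if "a \<in> carrier G" for a using that X_E by (auto simp: X_def)
  let ?ky = "\<lambda>i. (k i, y i)" and ?\<phi> = "\<lambda>a. (f a, g a)"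
  have \<phi>: "?\<phi> \<in> hom G E"
    using fgE hom_mult[OF f_hom] hom_mult[OF g] by (auto simp: hom_def E_mult)
  interpret \<phi>: group_hom G E ?\<phi> using \<phi> grp E.is_group by (simp add: group_hom_def group_hom_axioms_def)
  have word_ky: "word_value E ?ky u \<in> carrier E" "fst (word_value E ?ky u) = word_value K k u"
      "snd (word_value E ?ky u) = word_value T y u" if u: "u \<in> words {..<n}" for u
    using E.word_value_closed[of "{..<n}" ?ky u] ky u
      hom_word_value[OF fst_hom E.is_group grp(2), of "{..<n}" ?ky u]
      hom_word_value[OF snd_hom E.is_group grp(3), of "{..<n}" ?ky u] by auto
  have fst_surj: "fst ` carrier E = carrier K"
  proof
    show "carrier K \<subseteq> fst ` carrier E"
    proof
      fix a assume "a \<in> carrier K"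
      then obtain u where u: "u \<in> words {..<n}" "a = word_value K k u" using pres(4) by blast
      show "a \<in> fst ` carrier E" unfolding u(2) using word_ky(1,2)[OF u(1)] by force
    qed
  qed (use fst.hom_closed in blast)
  (* The first homology of E comes from G, as the system is trivial there. *)
  define Q where "Q = bar_chain_group 1 E Mod bar_boundaries 1 E"
  define \<theta> where "\<theta> e = r_coset (bar_chain_group 1 E) (bar_boundaries 1 E) (frag_of [e])" for e
  note H = homology_class_hom[OF E.is_group, folded Q_def \<theta>_def]
  interpret Q: comm_group Q by (rule H(1))
  interpret \<theta>: group_hom E Q \<theta> using H(2) E.is_group Q.is_group by (simp add: group_hom_def group_hom_axioms_def)
  have "\<exists>a\<in>carrier G. \<theta> e = \<theta> (?\<phi> a)" if "e \<in> carrier E" for e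
    using that
  proof (induction rule: E_induct)
    case (gen e)
    then consider i where "i < n" "e = (k i, y i)" | a where "a \<in> carrier G" "e = (f a, g a)"
      unfolding X_def by blast
    then show ?case
    proof cases
      case (1 i)
      let ?t = "map_gterm (\<lambda>_. \<one>\<^bsub>E\<^esub>) (t i)"
      have tK: "gterm_over (carrier K) n (t i)" using t(1)[OF 1(1)] by (rule gterm_over_mono) simp
      have over1: "gterm_over {\<one>\<^bsub>E\<^esub>} n ?t" by (rule gterm_over_map[OF t(1)[OF 1(1)]]) simp
      then have over: "gterm_over (carrier E) n ?t" by (rule gterm_over_mono) simp
      have v: "gval E ?ky ?t \<in> carrier E" by (rule E.gval_closed[OF over ky])
      have fst_v: "fst (gval E ?ky ?t) = gval K k (map_gterm fst ?t)"
        using gval_map[OF fst_hom E.is_group grp(2) over ky] by simp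
      have "map_gterm fst ?t = map_gterm (\<lambda>_. \<one>\<^bsub>K\<^esub>) (t i)" by (simp add: gterm.map_comp comp_def E_one)
      also have "\<dots> = map_gterm (\<lambda>a. a) (t i)"
        by (rule map_gterm_const[symmetric, OF t(1)[OF 1(1)]]) simp
      finally have fst_v': "fst (gval E ?ky ?t) = gval K k (t i)"
        using fst_v by (simp add: gterm.map_ident)
      have snd_v: "snd (gval E ?ky ?t) = gval T y (map_gterm (\<lambda>_. \<one>\<^bsub>T\<^esub>) (t i))"
        using gval_map[OF snd_hom E.is_group grp(3) over ky]
        by (simp add: gterm.map_comp comp_def E_one)
      have "e = gval E ?ky ?t \<otimes>\<^bsub>E\<^esub> ?\<phi> (x i)"
        unfolding 1(2) E_mult fst_v' snd_v fst_conv snd_conv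
        using k_eq[OF 1(1)] y(2)[OF 1(1)] by (rule arg_cong2)
      then have "\<theta> e = \<theta> (gval E ?ky ?t) \<otimes>\<^bsub>Q\<^esub> \<theta> (?\<phi> (x i))"
        using \<theta>.hom_mult[OF v \<phi>.hom_closed[OF x[OF 1(1)]]] by (simp only:)
      also have "\<theta> (gval E ?ky ?t) = gval Q (\<lambda>i. \<theta> (?ky i)) (map_gterm \<theta> ?t)"
        by (rule gval_map[OF H(2) E.is_group Q.is_group over ky])
      also have "\<dots> = gval Q (\<lambda>_. \<one>\<^bsub>Q\<^esub>) (map_gterm \<theta> ?t)"
        by (rule Q.gval_zero_expo[OF gterm_over_map[OF over] \<theta>.hom_closed[OF ky]])
          (use \<theta>.hom_closed t(2)[OF 1(1)] in \<open>auto simp: expo_map\<close>)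
      also have "\<dots> = \<one>\<^bsub>Q\<^esub>"
        by (rule Q.gval_at_one[OF gterm_over_map[OF over1]]) (use \<theta>.hom_one in auto)
      finally have "\<theta> e = \<theta> (?\<phi> (x i))"
        using Q.l_one[OF \<theta>.hom_closed[OF \<phi>.hom_closed[OF x[OF 1(1)]]]] by (simp only:)
      then show ?thesis using x[OF 1(1)] by blast
    qed blast
  next
    case one
    then show ?case using \<phi>.hom_one by (metis G.one_closed)
  next
    case (inv e)
    then obtain a where "a \<in> carrier G" "\<theta> e = \<theta> (?\<phi> a)" by blast
    then have "\<theta> (inv\<^bsub>E\<^esub> e) = \<theta> (?\<phi> (inv\<^bsub>G\<^esub> a))"
      using inv(1) fgE by (simp only: \<theta>.hom_inv \<phi>.hom_inv)
    then show ?case using G.inv_closed \<open>a \<in> carrier G\<close> by blast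
  next
    case (mult e e')
    then obtain a b where ab: "a \<in> carrier G" "\<theta> e = \<theta> (?\<phi> a)" "b \<in> carrier G" "\<theta> e' = \<theta> (?\<phi> b)"
      by blast
    then have "\<theta> (e \<otimes>\<^bsub>E\<^esub> e') = \<theta> (?\<phi> (a \<otimes>\<^bsub>G\<^esub> b))"
      using mult(1,2) fgE by (simp only: \<theta>.hom_mult \<phi>.hom_mult)
    then show ?case using G.m_closed ab by blast
  qed
  then have H1: "\<exists>c\<in>carrier (bar_chain_group 1 G).
      frag_of [e] - bar_chain_map ?\<phi> c \<in> bar_boundaries 1 E" if e: "e \<in> carrier E" for e
  proof -
    obtain a where a: "a \<in> carrier G" "\<theta> e = \<theta> (?\<phi> a)"
      using \<open>\<And>e. e \<in> carrier E \<Longrightarrow> \<exists>a\<in>carrier G. \<theta> e = \<theta> (?\<phi> a)\<close> e by blast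
    then have "frag_of [e] - frag_of [?\<phi> a] \<in> bar_boundaries 1 E"
      using H(3)[OF e fgE[OF a(1)]] by blast
    moreover have "frag_of [a] \<in> carrier (bar_chain_group 1 G)"
      using a(1) by (simp add: carrier_bar_chain_group_closed bar_simplices_1 del: One_nat_def)
    ultimately show ?thesis by (intro bexI[of _ "frag_of [a]"]) (simp_all add: bar_chain_map_simps)
  qed
  let ?N = "{e \<in> carrier E. fst e = \<one>\<^bsub>K\<^esub>}"
  have N_comm: "e \<in> commutator_subgroup E ?N (carrier E)" if "e \<in> ?N" for e
    by (rule two_connected_kernel_le_commutator[OF grp(1,2) E.is_group fst_hom fst_surj \<phi> _ f H1])
      (use that in auto)
  have "\<exists>u\<in>words {..<n}. f (\<gamma> i) = word_value K k u" if "i < p" for i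
    using pres(4)[OF fx[OF presG(3)[OF that]]] .
  then obtain ug where ug: "\<And>i. i < p \<Longrightarrow> ug i \<in> words {..<n}"
      "\<And>i. i < p \<Longrightarrow> f (\<gamma> i) = word_value K k (ug i)" by metis
  (* The elements that obstruct the extension; all of them lie in the kernel of E -> K. *)
  define V where "V = (\<lambda>(u, v). word_value T y u \<otimes>\<^bsub>T\<^esub> inv\<^bsub>T\<^esub> word_value T y v) ` R \<union>
      (\<lambda>i. word_value T y (ug i) \<otimes>\<^bsub>T\<^esub> inv\<^bsub>T\<^esub> g (\<gamma> i)) ` {..<p}"
  have "finite V" using pres(1) by (simp add: V_def)
  then obtain vs where vs: "set vs = V" using finite_list by blast
  define m where "m = length vs"
  define \<nu> where "\<nu> i = vs ! i" for i
  have V_\<nu>: "\<exists>i<m. v = \<nu> i" if "v \<in> V" for v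
    using that unfolding vs[symmetric] in_set_conv_nth m_def \<nu>_def by blast
  have \<nu>_V: "\<nu> i \<in> V" if "i < m" for i using that vs by (auto simp: m_def \<nu>_def)
  have wy: "word_value T y u \<in> carrier T" if "u \<in> words {..<n}" for u
    using T.word_value_closed[of "{..<n}" y u] y(1) that by auto
  have V_ker: "(\<one>\<^bsub>K\<^esub>, v) \<in> ?N" if v: "v \<in> V" for v
  proof -
    consider u u' where "(u, u') \<in> R" "v = word_value T y u \<otimes>\<^bsub>T\<^esub> inv\<^bsub>T\<^esub> word_value T y u'"
      | i where "i < p" "v = word_value T y (ug i) \<otimes>\<^bsub>T\<^esub> inv\<^bsub>T\<^esub> g (\<gamma> i)"
      using v unfolding V_def by auto
    then show ?thesis
    proof cases
      case (1 u u')
      then have u: "u \<in> words {..<n}" "u' \<in> words {..<n}" using pres(2) by auto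
      let ?e = "word_value E ?ky u \<otimes>\<^bsub>E\<^esub> inv\<^bsub>E\<^esub> word_value E ?ky u'"
      have "?e \<in> carrier E" using word_ky(1) u by simp
      moreover have "fst ?e = \<one>\<^bsub>K\<^esub>"
        using word_ky(1,2) u pres(5)[OF 1(1)] K.word_value_closed[of "{..<n}" k u'] pres(3) by simp
      moreover have "snd ?e = v" using word_ky(1,3) u 1(2) by simp
      ultimately show ?thesis by (metis (mono_tags, lifting) mem_Collect_eq prod.collapse fst_conv)
    next
      case (2 i)
      let ?e = "word_value E ?ky (ug i) \<otimes>\<^bsub>E\<^esub> inv\<^bsub>E\<^esub> ?\<phi> (\<gamma> i)"
      have "?e \<in> carrier E" using word_ky(1) ug(1) 2 fgE presG(3) by simp
      moreover have "fst ?e = \<one>\<^bsub>K\<^esub>"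
      proof -
        have "fst ?e = word_value K k (ug i) \<otimes>\<^bsub>K\<^esub> inv\<^bsub>K\<^esub> f (\<gamma> i)"
          using fst.hom_mult[OF word_ky(1)[OF ug(1)[OF 2(1)]] E.inv_closed[OF fgE[OF presG(3)[OF 2(1)]]]]
            fst.hom_inv[OF fgE[OF presG(3)[OF 2(1)]]] word_ky(2)[OF ug(1)[OF 2(1)]]
          by (simp only: fst_conv)
        also have "\<dots> = \<one>\<^bsub>K\<^esub>"
          unfolding ug(2)[OF 2(1), symmetric] by (rule K.r_inv[OF fx[OF presG(3)[OF 2(1)]]])
        finally show ?thesis .
      qed
      moreover have "snd ?e = v" using word_ky(1,3)[OF ug(1)[OF 2(1)]] 2(2) fgE presG(3)[OF 2(1)] by simp
      ultimately show ?thesis by (metis (mono_tags, lifting) mem_Collect_eq prod.collapse fst_conv)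
    qed
  qed
  have \<nu>: "\<nu> i \<in> carrier T" if "i < m" for i
    using snd.hom_closed[of "(\<one>\<^bsub>K\<^esub>, \<nu> i)"] V_ker[OF \<nu>_V[OF that]] by simp
  let ?M = "vanishing_values T m \<nu>"
  have M: "?M \<lhd> T" by (rule T.vanishing_values_normal[OF \<nu>])
  note QM = normal_quotient[OF M]
  let ?\<pi> = "\<lambda>a. r_coset T ?M a"
  interpret \<pi>: group_hom T "T Mod ?M" ?\<pi> using QM(1,2) grp by (simp add: group_hom_def group_hom_axioms_def)
  have \<pi>_word: "word_value (T Mod ?M) (\<lambda>i. ?\<pi> (y i)) u = ?\<pi> (word_value T y u)" if "u \<in> words {..<n}" for u
    using hom_word_value[OF QM(2) grp(3) QM(1), of "{..<n}" y u] y(1) that by auto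
  have V_M: "v \<in> ?M" if "v \<in> V" for v
    using V_\<nu>[OF that] vanishing_values_var[of _ m \<nu> T] by blast
  (* Modulo the normal closure M of V the extension exists, so the kernel of E -> K lies in M. *)
  obtain \<zeta> where \<zeta>: "\<zeta> \<in> hom K (T Mod ?M)" "\<And>i. i < n \<Longrightarrow> \<zeta> (k i) = ?\<pi> (y i)"
  proof (rule presents_von_Dyck[OF K grp(2) QM(1), of "\<lambda>i. ?\<pi> (y i)"])
    show "?\<pi> (y i) \<in> carrier (T Mod ?M)" if "i < n" for i by (rule \<pi>.hom_closed[OF y(1)[OF that]])
    show "word_value (T Mod ?M) (\<lambda>i. ?\<pi> (y i)) u = word_value (T Mod ?M) (\<lambda>i. ?\<pi> (y i)) v"
      if uv: "(u, v) \<in> R" for u v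
    proof -
      have u: "u \<in> words {..<n}" "v \<in> words {..<n}" using pres(2) uv by auto
      have "word_value T y u \<otimes>\<^bsub>T\<^esub> inv\<^bsub>T\<^esub> word_value T y v \<in> ?M"
        by (rule V_M) (use uv in \<open>auto simp: V_def\<close>)
      then show ?thesis unfolding \<pi>_word[OF u(1)] \<pi>_word[OF u(2)] using QM(3)[OF wy wy] u by blast
    qed
  qed blast
  interpret \<zeta>: group_hom K "T Mod ?M" \<zeta> using \<zeta>(1) QM(1) grp by (simp add: group_hom_def group_hom_axioms_def)
  have \<zeta>f: "\<zeta> (f a) = ?\<pi> (g a)" if a: "a \<in> carrier G" for a
  proof -
    have gen: "\<zeta> (f (\<gamma> i)) = ?\<pi> (g (\<gamma> i))" if i: "i < p" for i
    proof -
      have "\<zeta> (f (\<gamma> i)) = word_value (T Mod ?M) (\<lambda>i. \<zeta> (k i)) (ug i)"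
        unfolding ug(2)[OF i]
        using pres(3) ug(1)[OF i] by (intro hom_word_value[OF \<zeta>(1) grp(2) QM(1)]) auto
      also have "\<dots> = word_value (T Mod ?M) (\<lambda>i. ?\<pi> (y i)) (ug i)"
        by (rule word_value_cong[OF ug(1)[OF i]]) (use \<zeta>(2) in auto)
      also have "\<dots> = ?\<pi> (word_value T y (ug i))" by (rule \<pi>_word[OF ug(1)[OF i]])
      also have "\<dots> = ?\<pi> (g (\<gamma> i))"
      proof -
        have "word_value T y (ug i) \<otimes>\<^bsub>T\<^esub> inv\<^bsub>T\<^esub> g (\<gamma> i) \<in> ?M"
          by (rule V_M) (use i in \<open>auto simp: V_def\<close>)
        then show ?thesis using QM(3)[OF wy[OF ug(1)[OF i]] gx[OF presG(3)[OF i]]] by blast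
      qed
      finally show ?thesis .
    qed
    obtain u where u: "u \<in> words {..<p}" "a = word_value G \<gamma> u" using presG(4)[OF a] by blast
    have "(\<zeta> \<circ> f) a = (?\<pi> \<circ> g) a"
      by (rule hom_eq_on_generators[OF grp(1) QM(1) hom_compose[OF f_hom \<zeta>(1)] hom_compose[OF g QM(2)] _ _ u])
        (use presG(3) gen in auto)
    then show ?thesis by simp
  qed
  have \<zeta>E: "\<zeta> (fst e) = ?\<pi> (snd e)" if "e \<in> carrier E" for e
    using that
  proof (induction rule: E_induct)
    case (gen e)
    then show ?case using \<zeta>(2) \<zeta>f unfolding X_def by auto
  next
    case one
    then show ?case unfolding E_one fst_conv snd_conv using \<zeta>.hom_one \<pi>.hom_one by (simp only:)
  next
    case (inv e)
    then show ?case
      using fst.hom_closed[OF inv(1)] snd.hom_closed[OF inv(1)]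
      by (simp only: fst.hom_inv snd.hom_inv \<zeta>.hom_inv \<pi>.hom_inv)
  next
    case (mult e e')
    then show ?case
      using fst.hom_closed[OF mult(1)] snd.hom_closed[OF mult(1)] fst.hom_closed[OF mult(2)] snd.hom_closed[OF mult(2)]
      by (simp only: fst.hom_mult snd.hom_mult \<zeta>.hom_mult \<pi>.hom_mult)
  qed
  have N_M: "snd e \<in> ?M" if e: "e \<in> ?N" for e
  proof -
    have "?\<pi> (snd e) = \<zeta> \<one>\<^bsub>K\<^esub>" using \<zeta>E[of e] e by simp
    also have "\<dots> = \<one>\<^bsub>T Mod ?M\<^esub>" by (rule \<zeta>.hom_one)
    finally show ?thesis using QM(4)[of "snd e"] snd.hom_closed[of e] e by blast
  qed
  let ?P = "\<lambda>t. gterm_over (carrier T) m t \<and> (\<forall>j<m. expo j t = 0) \<and> gval T (\<lambda>_. \<one>\<^bsub>T\<^esub>) t = \<one>\<^bsub>T\<^esub>"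
  have comm: "\<exists>t. ?P t \<and> snd (commutator E e e') = gval T \<nu> t" if e: "e \<in> ?N" "e' \<in> carrier E" for e e'
  proof -
    obtain s where s: "gterm_over (carrier T) m s" "gval T (\<lambda>_. \<one>\<^bsub>T\<^esub>) s = \<one>\<^bsub>T\<^esub>" "snd e = gval T \<nu> s"
      using N_M[OF e(1)] unfolding vanishing_values_def by blast
    let ?b = "snd e'"
    have b: "?b \<in> carrier T" using snd.hom_closed e by blast
    show ?thesis
      by (rule exI[of _ "Mul (Mul (Mul (Inv s) (Inv (Const ?b))) s) (Const ?b)"])
        (use s b e in \<open>simp add: commutator_def\<close>)
  qed
  have "\<exists>t. ?P t \<and> snd e = gval T \<nu> t" if e: "e \<in> ?N" for e
    using N_comm[OF e] unfolding commutator_subgroup_def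
  proof (induction rule: generate.induct)
    case one
    show ?case by (rule exI[of _ "Const \<one>\<^bsub>T\<^esub>"]) (simp add: E_one)
  next
    case (incl h)
    then show ?case using comm by blast
  next
    case (inv h)
    then obtain e e' where h: "h = commutator E e e'" "e \<in> ?N" "e' \<in> carrier E" by blast
    obtain t where t: "?P t" "snd h = gval T \<nu> t" using comm[OF h(2,3)] unfolding h(1) by blast
    have "h \<in> carrier E" unfolding h(1) using h(2,3) by (intro E.commutator_closed) auto
    then show ?case using t by (intro exI[of _ "Inv t"]) simp
  next
    case (eng h1 h2)
    then obtain s t where "?P s" "snd h1 = gval T \<nu> s" "?P t" "snd h2 = gval T \<nu> t" by blast
    then show ?case by (intro exI[of _ "Mul s t"]) (simp add: E_mult)
  qed
  then have "\<exists>t. ?P t \<and> \<nu> i = gval T \<nu> t" if "i < m" for i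
    using V_ker[OF \<nu>_V[OF that]] by fastforce
  (* The obstructions and 1 solve the same system. *)
  then obtain r where r: "\<And>i. i < m \<Longrightarrow> ?P (r i)" "\<And>i. i < m \<Longrightarrow> \<nu> i = gval T \<nu> (r i)" by metis
  have "contractible_system T m r" using r(1) by (simp add: contractible_system_def)
  then obtain x0 where unique: "\<And>z i. solves T m r z \<Longrightarrow> i < m \<Longrightarrow> z i = x0 i"
    using US unfolding uniquely_solvable_def by blast
  have solves_\<nu>: "solves T m r \<nu>" unfolding solves_def using r(2) \<nu> by blast
  have solves_one: "solves T m r (\<lambda>_. \<one>\<^bsub>T\<^esub>)" using r(1) by (simp add: solves_def)
  have \<nu>_one: "\<nu> i = \<one>\<^bsub>T\<^esub>" if "i < m" for i
    using unique[OF solves_\<nu> that] unique[OF solves_one that] by simp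
  have ker: "e = \<one>\<^bsub>E\<^esub>" if e: "e \<in> ?N" for e
  proof -
    obtain s where s: "gterm_over (carrier T) m s" "gval T (\<lambda>_. \<one>\<^bsub>T\<^esub>) s = \<one>\<^bsub>T\<^esub>" "snd e = gval T \<nu> s"
      using N_M[OF e] unfolding vanishing_values_def by blast
    have "gval T \<nu> s = \<one>\<^bsub>T\<^esub>" using gval_cong[OF s(1), of \<nu> "\<lambda>_. \<one>\<^bsub>T\<^esub>" T] \<nu>_one s(2) by simp
    then show ?thesis using s(3) e by (simp add: E_one prod_eq_iff)
  qed
  have fst_inj: "inj_on fst (carrier E)"
    unfolding fst.inj_on_one_iff using ker by auto
  then have iso: "fst \<in> iso E K" using fst_hom fst_surj by (simp add: iso_def bij_betw_def)
  let ?\<psi> = "inv_into (carrier E) fst"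
  have "?\<psi> \<in> iso K E" by (rule E.iso_set_sym[OF iso])
  then have "snd \<circ> ?\<psi> \<in> hom K T" using snd_hom by (intro hom_compose) (auto simp: iso_def)
  moreover have "(snd \<circ> ?\<psi>) (f a) = g a" if a: "a \<in> carrier G" for a
    using inv_into_f_f[OF fst_inj fgE[OF a]] by simp
  ultimately show ?thesis by blast
qed

theorem uniquely_solvable_imp_local:
  assumes "group T" "uniquely_solvable T"
  shows "local_group T"
  unfolding local_group_def
proof (intro conjI allI impI ballI)
  fix G K :: "nat word set monoid" and f g
  assume *: "finitely_presented G \<and> finitely_presented K \<and> two_connected G K f" and g: "g \<in> hom G T"
  have grp: "group G" "group K" using * by (simp_all add: finitely_presented_def)
  have f: "two_connected G K f" using * by blast
  then have f_hom: "f \<in> hom G K" by (simp add: two_connected_def)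
  obtain p R' \<gamma> where G: "presents G p R' \<gamma>" using finitely_presented_presents * by blast
  obtain n R k where K: "presents K n R k" using finitely_presented_presents * by blast
  obtain h where h: "h \<in> hom K T" "\<And>x. x \<in> carrier G \<Longrightarrow> h (f x) = g x"
    using local_extension_exists[OF grp assms f K G g] by blast
  show "\<exists>!h. h \<in> hom K T \<inter> extensional (carrier K) \<and> (\<forall>x\<in>carrier G. h (f x) = g x)"
  proof (rule ex1I[of _ "restrict h (carrier K)"])
    have "restrict h (carrier K) \<in> hom K T"
      using h(1) grp(2) by (auto simp: hom_def group.is_monoid monoid.m_closed)
    then show "restrict h (carrier K) \<in> hom K T \<inter> extensional (carrier K) \<and>
        (\<forall>x\<in>carrier G. restrict h (carrier K) (f x) = g x)"
      using h(2) hom_in_carrier[OF f_hom] by simp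
  next
    fix h' assume h': "h' \<in> hom K T \<inter> extensional (carrier K) \<and> (\<forall>x\<in>carrier G. h' (f x) = g x)"
    show "h' = restrict h (carrier K)"
    proof (rule extensionalityI[of _ "carrier K"])
      show "h' y = restrict h (carrier K) y" if "y \<in> carrier K" for y
        using local_extension_unique[OF grp assms f K _ h(1) _ that, of h'] h' h(2) that by simp
    qed (use h' in auto)
  qed
qed (fact assms)

section \<open>A local group with a quasicyclic kernel\<close>

subsection \<open>The quadratic field\<close>

text \<open>
  \<open>QF a b\<close> stands for \<open>a + b t\<close> in \<open>\<rat>[t]/(t\<^sup>2 - 3t - 1)\<close>, the field of the square root of 13.
\<close>

datatype qfield = QF rat rat

instantiation qfield :: comm_ring_1
begin

definition "0 = QF 0 0"
definition "1 = QF 1 0"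
fun plus_qfield where "QF a b + QF c d = QF (a + c) (b + d)"
fun minus_qfield where "QF a b - QF c d = QF (a - c) (b - d)"
fun uminus_qfield where "- QF a b = QF (- a) (- b)"
fun times_qfield where "QF a b * QF c d = QF (a * c + b * d) (a * d + b * c + 3 * (b * d))"

instance
proof
  fix x y z :: qfield
  obtain a b c d e f where [simp]: "x = QF a b" "y = QF c d" "z = QF e f"
    by (metis qfield.exhaust)
  show "x * y * z = x * (y * z)" "x * y = y * x" "(x + y) * z = x * z + y * z"
    by (simp_all add: algebra_simps)
  show "1 * x = x" "x + y + z = x + (y + z)" "x + y = y + x" "0 + x = x" "- x + x = 0" "x - y = x + - y"
    by (simp_all add: zero_qfield_def one_qfield_def)
qed (simp add: zero_qfield_def one_qfield_def)

end

text \<open>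
  The norm to \<open>\<rat>\<close>, that is, the determinant of multiplication.
\<close>

fun qnorm :: "qfield \<Rightarrow> rat" where "qnorm (QF a b) = a * a + 3 * a * b - b * b"

lemma qnorm_mult: "qnorm (x * y) = qnorm x * qnorm y"
  by (cases x; cases y) (simp add: algebra_simps)

lemma qnorm_one: "qnorm 1 = 1"
  by (simp add: one_qfield_def)

text \<open>
  The form \<open>p\<^sup>2 + 3pq - q\<^sup>2\<close> is anisotropic because it is so modulo 2: it is odd unless \<open>p\<close> and \<open>q\<close> are both even.
\<close>

lemma qnorm_eq_0: "qnorm x = 0 \<Longrightarrow> x = 0"
proof (rule ccontr)
  assume norm: "qnorm x = 0" and "x \<noteq> 0"
  obtain a b where x: "x = QF a b" by (cases x)
  have "b \<noteq> 0" using norm \<open>x \<noteq> 0\<close> by (auto simp: x zero_qfield_def)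
  obtain p q where pq: "quotient_of (a / b) = (p, q)" by fastforce
  have "q > 0" "coprime p q" using quotient_of_denom_pos[OF pq] quotient_of_coprime[OF pq] by auto
  have eq: "a * of_int q = b * of_int p"
    using quotient_of_div[OF pq] \<open>b \<noteq> 0\<close> \<open>q > 0\<close> by (simp add: field_simps)
  have "(b * b) * of_int (p * p + 3 * p * q - q * q) =
      (b * of_int p) * (b * of_int p) + 3 * (b * of_int p) * b * of_int q - b * b * of_int q * of_int q"
    by (simp add: algebra_simps)
  also have "\<dots> = (a * a + 3 * a * b - b * b) * of_int q * of_int q"
    unfolding eq[symmetric] by (simp add: algebra_simps)
  also have "\<dots> = 0" using norm by (simp add: x)
  finally have "of_int (p * p + 3 * p * q - q * q) = (0::rat)" using \<open>b \<noteq> 0\<close> by simp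
  then have zero: "p * p + 3 * p * q - q * q = 0" by (simp only: of_int_eq_0_iff)
  have "even (p * p + 3 * p * q - q * q)" unfolding zero by simp
  then have "even p \<and> even q" by auto
  then show False using \<open>coprime p q\<close> by (metis coprime_common_divisor odd_one)
qed

instantiation qfield :: field
begin

fun inverse_qfield where
  "inverse (QF a b) = QF ((a + 3 * b) / qnorm (QF a b)) (- b / qnorm (QF a b))"
definition divide_qfield :: "qfield \<Rightarrow> qfield \<Rightarrow> qfield" where "divide_qfield x y = x * inverse y"

instance
proof
  fix x y :: qfield
  obtain a b where x: "x = QF a b" by (cases x)
  show "inverse x * x = 1" if "x \<noteq> 0"
  proof -
    define N where "N = qnorm x"
    have n: "N \<noteq> 0" using that qnorm_eq_0 by (auto simp: N_def)
    have N: "N = a * a + 3 * a * b - b * b" by (simp add: N_def x)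
    have inv: "inverse x = QF ((a + 3 * b) / N) (- b / N)" by (simp add: x N)
    have "(a + 3 * b) / N * a + - b / N * b = (a * a + 3 * a * b - b * b) / N"
      by (simp add: diff_divide_distrib add_divide_distrib algebra_simps)
    moreover have "(a + 3 * b) / N * b + - b / N * a + 3 * (- b / N * b) = 0"
      by (simp add: diff_divide_distrib add_divide_distrib algebra_simps)
    ultimately show ?thesis using n by (simp add: inv x one_qfield_def flip: N)
  qed
qed (simp_all add: divide_qfield_def zero_qfield_def)

end

definition int_elt :: "int \<Rightarrow> int \<Rightarrow> qfield" where "int_elt m n = QF (of_int m) (of_int n)"

lemma int_elt_ops:
  "int_elt m n + int_elt p q = int_elt (m + p) (n + q)"
  "int_elt m n - int_elt p q = int_elt (m - p) (n - q)"
  "- int_elt m n = int_elt (- m) (- n)"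
  "int_elt m n * int_elt p q = int_elt (m * p + n * q) (m * q + n * p + 3 * (n * q))"
  "int_elt m n = int_elt p q \<longleftrightarrow> m = p \<and> n = q"
  "1 = int_elt 1 0" "0 = int_elt 0 0"
  by (simp_all add: int_elt_def one_qfield_def zero_qfield_def)

text \<open>
  Integers are sorted by their residue at the prime \<open>(3, t - 1)\<close>, that is, by \<open>m + n\<close> modulo 3. Elements of \<open>\<int>[t, 1/t]\<close>
  whose augmentation is 0 belong to this prime, which is why localising there makes \<open>1 - j\<close> invertible for them.
\<close>

definition prime_ints :: "qfield set" where "prime_ints = {int_elt m n |m n. 3 dvd m + n}"
definition unit_ints :: "qfield set" where "unit_ints = {int_elt m n |m n. \<not> 3 dvd m + n}"

text \<open>
  \<open>t \<mapsto> 1\<close> is a ring homomorphism to the field with three elements, as \<open>1 = 3 + 1\<close> there.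
\<close>

lemma residue_mult:
  fixes m n p q :: int
  shows "3 dvd (m * p + n * q) + (m * q + n * p + 3 * (n * q)) \<longleftrightarrow> 3 dvd m + n \<or> 3 dvd p + q"
proof -
  have eq: "(m * p + n * q) + (m * q + n * p + 3 * (n * q)) = (m + n) * (p + q) + 3 * (n * q)"
    by (simp add: algebra_simps)
  have "3 dvd x * y \<longleftrightarrow> 3 dvd x \<or> 3 dvd y" for x y :: int
  proof -
    have "3 dvd y" if xy: "3 dvd x * y" and x: "\<not> 3 dvd x"
    proof -
      have "(\<exists>k. x = 3 * k + 1) \<or> (\<exists>k. x = 3 * k + 2)" using x by presburger
      then obtain k where "x = 3 * k + 1 \<or> x = 3 * k + 2" by blast
      then have "x * y = 3 * (k * y) + y \<or> x * y = 3 * (k * y) + 2 * y" by (auto simp: algebra_simps)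
      moreover have "3 dvd y" if "3 dvd 3 * w + y \<or> 3 dvd 3 * w + 2 * y" for w :: int
        using that by presburger
      ultimately show ?thesis using xy by metis
    qed
    then show ?thesis by auto
  qed
  moreover have "3 dvd w + 3 * v \<longleftrightarrow> 3 dvd w" for w v :: int by presburger
  ultimately show ?thesis unfolding eq by blast
qed

lemma prime_ints_add: "x \<in> prime_ints \<Longrightarrow> y \<in> prime_ints \<Longrightarrow> x + y \<in> prime_ints"
proof -
  assume "x \<in> prime_ints" "y \<in> prime_ints"
  then obtain m n p q where *: "x = int_elt m n" "3 dvd m + n" "y = int_elt p q" "3 dvd p + q"
    by (auto simp: prime_ints_def)
  have "3 dvd (m + p) + (n + q)" using *(2,4) by presburger
  then show ?thesis unfolding prime_ints_def *(1,3) int_elt_ops(1) by blast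
qed

lemma prime_ints_uminus: "x \<in> prime_ints \<Longrightarrow> - x \<in> prime_ints"
proof -
  assume "x \<in> prime_ints"
  then obtain m n where mn: "x = int_elt m n" "3 dvd m + n" by (auto simp: prime_ints_def)
  have "3 dvd - m + - n" using mn(2) by presburger
  then show ?thesis unfolding prime_ints_def mn(1) int_elt_ops(3) by blast
qed

lemma prime_ints_mult:
  assumes "x \<in> prime_ints" "y \<in> prime_ints \<union> unit_ints"
  shows "x * y \<in> prime_ints"
proof -
  obtain m n p q where *: "x = int_elt m n" "3 dvd m + n" "y = int_elt p q"
    using assms by (auto simp: prime_ints_def unit_ints_def)
  then show ?thesis
    unfolding prime_ints_def *(1,3) int_elt_ops(4) using residue_mult by blast
qed

lemma unit_ints_mult:
  assumes "x \<in> unit_ints" "y \<in> unit_ints"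
  shows "x * y \<in> unit_ints"
proof -
  obtain m n p q where *: "x = int_elt m n" "\<not> 3 dvd m + n" "y = int_elt p q" "\<not> 3 dvd p + q"
    using assms by (auto simp: unit_ints_def)
  then show ?thesis
    unfolding unit_ints_def *(1,3) int_elt_ops(4) using residue_mult by blast
qed

lemma unit_ints_diff: "x \<in> unit_ints \<Longrightarrow> y \<in> prime_ints \<Longrightarrow> x - y \<in> unit_ints"
proof -
  assume "x \<in> unit_ints" "y \<in> prime_ints"
  then obtain m n p q where *: "x = int_elt m n" "\<not> 3 dvd m + n" "y = int_elt p q" "3 dvd p + q"
    by (auto simp: prime_ints_def unit_ints_def)
  have "\<not> 3 dvd (m - p) + (n - q)" using *(2,4) by presburger
  then show ?thesis unfolding unit_ints_def *(1,3) int_elt_ops(2) by blast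
qed

lemma unit_ints_nonzero: "x \<in> unit_ints \<Longrightarrow> x \<noteq> 0"
  by (auto simp: unit_ints_def int_elt_ops)

lemma one_in_unit_ints: "1 \<in> unit_ints"
  unfolding unit_ints_def int_elt_ops(6) by (rule CollectI, rule exI[of _ 1], rule exI[of _ 0]) simp

lemma zero_in_prime_ints: "0 \<in> prime_ints"
  unfolding prime_ints_def int_elt_ops(7) by (rule CollectI, rule exI[of _ 0], rule exI[of _ 0]) simp

definition local_maximal_ideal :: "qfield set"
  where "local_maximal_ideal = {x. \<exists>s\<in>unit_ints. x * s \<in> prime_ints}"

lemma local_maximal_ideal_closed:
  "0 \<in> local_maximal_ideal"
  "x \<in> local_maximal_ideal \<Longrightarrow> y \<in> local_maximal_ideal \<Longrightarrow> x + y \<in> local_maximal_ideal"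
  "x \<in> local_maximal_ideal \<Longrightarrow> - x \<in> local_maximal_ideal"
  "x \<in> local_maximal_ideal \<Longrightarrow> y \<in> local_maximal_ideal \<Longrightarrow> x * y \<in> local_maximal_ideal"
proof -
  show "0 \<in> local_maximal_ideal"
    unfolding local_maximal_ideal_def using one_in_unit_ints zero_in_prime_ints by force
  show "x + y \<in> local_maximal_ideal" if xy: "x \<in> local_maximal_ideal" "y \<in> local_maximal_ideal"
  proof -
    obtain s t where st: "s \<in> unit_ints" "x * s \<in> prime_ints" "t \<in> unit_ints" "y * t \<in> prime_ints"
      using xy by (auto simp: local_maximal_ideal_def)
    have "(x * s) * t + (y * t) * s \<in> prime_ints" using st prime_ints_mult prime_ints_add by blast
    then have "(x + y) * (s * t) \<in> prime_ints" by (simp add: algebra_simps)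
    then show ?thesis unfolding local_maximal_ideal_def using unit_ints_mult st by blast
  qed
  show "- x \<in> local_maximal_ideal" if "x \<in> local_maximal_ideal"
    using that prime_ints_uminus by (force simp: local_maximal_ideal_def)
  show "x * y \<in> local_maximal_ideal" if xy: "x \<in> local_maximal_ideal" "y \<in> local_maximal_ideal"
  proof -
    obtain s t where st: "s \<in> unit_ints" "x * s \<in> prime_ints" "t \<in> unit_ints" "y * t \<in> prime_ints"
      using xy by (auto simp: local_maximal_ideal_def)
    have "(x * s) * (y * t) \<in> prime_ints" using st prime_ints_mult by blast
    then have "(x * y) * (s * t) \<in> prime_ints" by (simp add: algebra_simps)
    then show ?thesis unfolding local_maximal_ideal_def using unit_ints_mult st by blast
  qed
qed

lemma local_maximal_ideal_quasi_inverse: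
  assumes "a \<in> local_maximal_ideal"
  shows "1 - a \<noteq> 0" "a / (1 - a) \<in> local_maximal_ideal"
proof -
  obtain s where s: "s \<in> unit_ints" "a * s \<in> prime_ints"
    using assms by (auto simp: local_maximal_ideal_def)
  have unit: "s - a * s \<in> unit_ints" using s by (rule unit_ints_diff)
  have eq: "(1 - a) * s = s - a * s" by (simp add: algebra_simps)
  then show "1 - a \<noteq> 0" using unit_ints_nonzero[OF unit] by auto
  then have "a / (1 - a) * (s - a * s) = a * s" unfolding eq[symmetric] by simp
  then show "a / (1 - a) \<in> local_maximal_ideal"
    unfolding local_maximal_ideal_def using unit s(2) by force
qed

definition field_radical :: "(qfield \<Rightarrow> qfield) set"
  where "field_radical = (\<lambda>a x. a * x) ` local_maximal_ideal"

lemma radical_field_radical: "radical_endomorphisms field_radical"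
proof
  note cl = local_maximal_ideal_closed
  show "(\<lambda>_. 0) \<in> field_radical" unfolding field_radical_def by (rule image_eqI[OF _ cl(1)]) (simp add: fun_eq_iff)
  fix j assume "j \<in> field_radical"
  then obtain a where a: "a \<in> local_maximal_ideal" and j: "j = (\<lambda>x. a * x)" by (auto simp: field_radical_def)
  show "(\<lambda>a. - j a) \<in> field_radical"
    unfolding field_radical_def by (rule image_eqI[OF _ cl(3)[OF a]]) (simp add: j fun_eq_iff)
  show "j (x + y) = j x + j y" for x y by (simp add: j algebra_simps)
  show "\<exists>r\<in>field_radical. \<forall>x y. y = x + j y \<longleftrightarrow> y = x + r x"
  proof (intro bexI allI)
    note q = local_maximal_ideal_quasi_inverse[OF a]
    show "(\<lambda>x. a / (1 - a) * x) \<in> field_radical" unfolding field_radical_def using q(2) by blast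
    fix x y
    have "y = x + j y \<longleftrightarrow> (1 - a) * y = x" by (auto simp: j algebra_simps)
    also have "\<dots> \<longleftrightarrow> y = x / (1 - a)" using q(1) by (auto simp: field_simps)
    also have "x / (1 - a) = x + a / (1 - a) * x" using q(1) by (simp add: field_simps)
    finally show "y = x + j y \<longleftrightarrow> y = x + a / (1 - a) * x" .
  qed
  fix k assume "k \<in> field_radical"
  then obtain b where b: "b \<in> local_maximal_ideal" and k: "k = (\<lambda>x. b * x)" by (auto simp: field_radical_def)
  show "(\<lambda>a. j a + k a) \<in> field_radical"
    unfolding field_radical_def by (rule image_eqI[OF _ cl(2)[OF a b]]) (simp add: j k fun_eq_iff algebra_simps)
  show "(\<lambda>a. j (k a)) \<in> field_radical"
    unfolding field_radical_def by (rule image_eqI[OF _ cl(4)[OF a b]]) (simp add: j k fun_eq_iff algebra_simps)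
qed

subsection \<open>The quasicyclic group\<close>

text \<open>
  Membership in \<open>\<int>\<close> localised at 2.
\<close>

definition odd_denom :: "rat \<Rightarrow> bool"
  where "odd_denom x \<longleftrightarrow> (\<exists>m n. odd n \<and> x * of_int n = of_int m)"

lemma odd_denom_of_int [simp]: "odd_denom (of_int m)"
  unfolding odd_denom_def by (rule exI[of _ m], rule exI[of _ 1]) simp

lemma odd_denom_simps [simp]: "odd_denom 0" "odd_denom 1" "odd_denom (numeral k)"
  using odd_denom_of_int[of 0] odd_denom_of_int[of 1] odd_denom_of_int[of "numeral k"] by simp_all

lemma odd_denom_add: "odd_denom x \<Longrightarrow> odd_denom y \<Longrightarrow> odd_denom (x + y)"
proof -
  assume "odd_denom x" "odd_denom y"
  then obtain m n p q where *: "odd n" "x * of_int n = of_int m" "odd q" "y * of_int q = of_int p"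
    by (auto simp: odd_denom_def)
  have "(x + y) * of_int (n * q) = (x * of_int n) * of_int q + (y * of_int q) * of_int n"
    by (simp add: algebra_simps)
  then have "(x + y) * of_int (n * q) = of_int (m * q + p * n)" unfolding *(2,4) by simp
  then show ?thesis unfolding odd_denom_def using *(1,3) by (metis even_mult_iff)
qed

lemma odd_denom_mult: "odd_denom x \<Longrightarrow> odd_denom y \<Longrightarrow> odd_denom (x * y)"
proof -
  assume "odd_denom x" "odd_denom y"
  then obtain m n p q where *: "odd n" "x * of_int n = of_int m" "odd q" "y * of_int q = of_int p"
    by (auto simp: odd_denom_def)
  have "(x * y) * of_int (n * q) = (x * of_int n) * (y * of_int q)" by (simp add: algebra_simps)
  then have "(x * y) * of_int (n * q) = of_int (m * p)" unfolding *(2,4) by simp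
  then show ?thesis unfolding odd_denom_def using *(1,3) by (metis even_mult_iff)
qed

lemma odd_denom_minus: "odd_denom x \<Longrightarrow> odd_denom (- x)"
  using odd_denom_mult[of "of_int (- 1)" x] odd_denom_of_int[of "- 1"] by simp

lemma odd_denom_inverse:
  assumes "odd_denom z"
  shows "1 - 2 * z \<noteq> 0" "odd_denom (1 / (1 - 2 * z))"
proof -
  obtain m n where mn: "odd n" "z * of_int n = of_int m" using assms by (auto simp: odd_denom_def)
  have "(1 - 2 * z) * of_int n = of_int n - 2 * (z * of_int n)" by (simp add: algebra_simps)
  then have eq: "(1 - 2 * z) * of_int n = of_int (n - 2 * m)" unfolding mn(2) by simp
  have "odd (n - 2 * m)" using mn(1) by simp
  then have "of_int (n - 2 * m) \<noteq> (0::rat)" by (metis dvd_0_right of_int_eq_0_iff)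
  then show nz: "1 - 2 * z \<noteq> 0" using eq by auto
  have "1 / (1 - 2 * z) * of_int (n - 2 * m) = of_int n" unfolding eq[symmetric] using nz by simp
  then show "odd_denom (1 / (1 - 2 * z))" unfolding odd_denom_def using \<open>odd (n - 2 * m)\<close> by blast
qed

lemma odd_denom_half: "\<not> odd_denom (1 / 2)"
proof
  assume "odd_denom (1 / 2)"
  then obtain m n where mn: "odd n" "(1 / 2) * of_int n = (of_int m :: rat)" by (auto simp: odd_denom_def)
  then have "of_int n = (of_int (2 * m) :: rat)" by (simp add: field_simps)
  then have "n = 2 * m" by (simp only: of_int_eq_iff)
  then show False using mn(1) by simp
qed

definition cong4 :: "rat \<Rightarrow> rat \<Rightarrow> bool" where "cong4 x y \<longleftrightarrow> odd_denom ((x - y) / 4)"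

text \<open>
  The rationals modulo four times the integers localised at 2, a group isomorphic to the quasicyclic 2-group. The modulus is
  chosen such that the commutator of the basis elements \<open>1\<close> and \<open>t\<close>, which will be the class of 2, has order 2.
\<close>

quotient_type quasicyclic = rat / cong4
proof (rule equivpI)
  show "reflp cong4" by (rule reflpI) (simp add: cong4_def)
  show "symp cong4"
  proof (rule sympI)
    show "cong4 y x" if "cong4 x y" for x y
      using odd_denom_minus[OF that[unfolded cong4_def]] by (simp add: cong4_def diff_divide_distrib)
  qed
  show "transp cong4"
  proof (rule transpI)
    show "cong4 x z" if "cong4 x y" "cong4 y z" for x y z
      using odd_denom_add[OF that[unfolded cong4_def]] by (simp add: cong4_def diff_divide_distrib)
  qed
qed

instantiation quasicyclic :: ab_group_add
begin

lift_definition zero_quasicyclic :: quasicyclic is 0 .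
lift_definition plus_quasicyclic :: "quasicyclic \<Rightarrow> quasicyclic \<Rightarrow> quasicyclic" is "(+)"
proof -
  show "cong4 (x + x') (y + y')" if "cong4 x y" "cong4 x' y'" for x y x' y'
    using odd_denom_add[OF that[unfolded cong4_def]]
    by (simp add: cong4_def diff_divide_distrib add_divide_distrib algebra_simps)
qed
lift_definition uminus_quasicyclic :: "quasicyclic \<Rightarrow> quasicyclic" is uminus
proof -
  show "cong4 (- x) (- y)" if "cong4 x y" for x y
    using odd_denom_minus[OF that[unfolded cong4_def]] by (simp add: cong4_def diff_divide_distrib)
qed
definition minus_quasicyclic :: "quasicyclic \<Rightarrow> quasicyclic \<Rightarrow> quasicyclic"
  where "minus_quasicyclic x y = x + - y"

instance
proof
  fix x y z :: quasicyclic
  show "x + y + z = x + (y + z)" by transfer (simp add: cong4_def algebra_simps)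
  show "x + y = y + x" by transfer (simp add: cong4_def algebra_simps)
  show "0 + x = x" by transfer (simp add: cong4_def)
  show "- x + x = 0" by transfer (simp add: cong4_def)
qed (simp add: minus_quasicyclic_def)

end

abbreviation cls4 :: "rat \<Rightarrow> quasicyclic" where "cls4 \<equiv> abs_quasicyclic"

lemma cls4_ops:
  "cls4 x + cls4 y = cls4 (x + y)" "- cls4 x = cls4 (- x)" "0 = cls4 0"
  "cls4 x = cls4 y \<longleftrightarrow> odd_denom ((x - y) / 4)"
  by (simp_all add: plus_quasicyclic.abs_eq uminus_quasicyclic.abs_eq zero_quasicyclic_def
      quasicyclic.abs_eq_iff cong4_def)

lemma cls4_cases: obtains x where "d = cls4 x"
  by (metis Quotient_quasicyclic Quotient_abs_rep)

text \<open>
  Multiplications by even elements of \<open>\<int>\<close> localised at 2; \<open>1 - 2z\<close> is a unit there.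
\<close>

definition quasicyclic_radical :: "(quasicyclic \<Rightarrow> quasicyclic) set"
  where "quasicyclic_radical = {j. \<exists>z. odd_denom z \<and> (\<forall>x. j (cls4 x) = cls4 (2 * z * x))}"

lemma quasicyclic_radical_exists:
  assumes "odd_denom z"
  obtains j where "\<And>x. j (cls4 x) = cls4 (2 * z * x)" "j \<in> quasicyclic_radical"
proof -
  define j where "j d = cls4 (2 * z * rep_quasicyclic d)" for d
  have j: "j (cls4 x) = cls4 (2 * z * x)" for x
  proof -
    have "cls4 (rep_quasicyclic (cls4 x)) = cls4 x" by (metis Quotient_quasicyclic Quotient_abs_rep)
    then have "odd_denom ((rep_quasicyclic (cls4 x) - x) / 4)" by (simp add: cls4_ops)
    then have "odd_denom ((2 * z) * ((rep_quasicyclic (cls4 x) - x) / 4))"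
      using odd_denom_mult[OF _ assms, of 2] by (intro odd_denom_mult[of "2 * z"]) simp_all
    then show ?thesis by (simp add: j_def cls4_ops algebra_simps diff_divide_distrib)
  qed
  then have "j \<in> quasicyclic_radical" using assms unfolding quasicyclic_radical_def by blast
  then show thesis using j that by blast
qed

lemma radical_quasicyclic_radical: "radical_endomorphisms quasicyclic_radical"
proof
  show "(\<lambda>_. 0) \<in> quasicyclic_radical"
    unfolding quasicyclic_radical_def by (intro CollectI exI[of _ 0]) (simp add: cls4_ops(3))
  fix j assume "j \<in> quasicyclic_radical"
  then obtain z where z: "odd_denom z" and j: "\<And>x. j (cls4 x) = cls4 (2 * z * x)"
    by (auto simp: quasicyclic_radical_def)
  show "(\<lambda>a. - j a) \<in> quasicyclic_radical"
    unfolding quasicyclic_radical_def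
    using odd_denom_minus[OF z] by (intro CollectI exI[of _ "- z"]) (simp add: j cls4_ops(2))
  show "j (a + b) = j a + j b" for a b
    by (cases a rule: cls4_cases; cases b rule: cls4_cases) (simp add: cls4_ops(1) j algebra_simps)
  show "\<exists>r\<in>quasicyclic_radical. \<forall>a b. b = a + j b \<longleftrightarrow> b = a + r a"
  proof -
    note inv = odd_denom_inverse[OF z]
    let ?q = "1 / (1 - 2 * z)"
    obtain r where r: "\<And>x. r (cls4 x) = cls4 (2 * (z * ?q) * x)" "r \<in> quasicyclic_radical"
      using quasicyclic_radical_exists[OF odd_denom_mult[OF z inv(2)]] by blast
    have "b = a + j b \<longleftrightarrow> b = a + r a" for a b
    proof -
      obtain x y where ab: "a = cls4 x" "b = cls4 y" by (metis cls4_cases)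
      have "b = a + j b \<longleftrightarrow> odd_denom (((1 - 2 * z) * y - x) / 4)"
        by (simp add: ab j cls4_ops(1,4) algebra_simps)
      also have "\<dots> \<longleftrightarrow> odd_denom ((y - ?q * x) / 4)"
      proof
        have *: "c * ((u - d * v) / 4) = (c * u - v) / 4" if "c * d = 1" for c d u v :: rat
        proof -
          have "c * ((u - d * v) / 4) = (c * u - (c * d) * v) / 4" by (simp add: field_simps)
          then show ?thesis by (simp add: that)
        qed
        have cq: "(1 - 2 * z) * ?q = 1" using inv(1) by simp
        show "odd_denom ((y - ?q * x) / 4)" if "odd_denom (((1 - 2 * z) * y - x) / 4)"
        proof -
          have "?q * (((1 - 2 * z) * y - x) / 4) = (y - ?q * x) / 4"
            unfolding *[OF cq, symmetric] using inv(1) by simp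
          then show ?thesis using odd_denom_mult[OF inv(2) that] by (simp only:)
        qed
        have "odd_denom (1 - 2 * z)"
          using odd_denom_add[OF _ odd_denom_minus[OF odd_denom_mult[OF _ z]], of 1 2] by simp
        from odd_denom_mult[OF this] show "odd_denom (((1 - 2 * z) * y - x) / 4)"
          if "odd_denom ((y - ?q * x) / 4)"
          using that unfolding *[OF cq, symmetric] by blast
      qed
      also have "?q * x = x + 2 * (z * ?q) * x" using inv(1) by (simp add: field_simps)
      also have "odd_denom ((y - (x + 2 * (z * ?q) * x)) / 4) \<longleftrightarrow> b = a + r a"
        by (simp add: ab r(1) cls4_ops(1,4))
      finally show ?thesis .
    qed
    then show ?thesis using r(2) by blast
  qed
  fix k assume "k \<in> quasicyclic_radical"
  then obtain w where w: "odd_denom w" and k: "\<And>x. k (cls4 x) = cls4 (2 * w * x)"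
    by (auto simp: quasicyclic_radical_def)
  show "(\<lambda>a. j a + k a) \<in> quasicyclic_radical"
    unfolding quasicyclic_radical_def
    using odd_denom_add[OF z w]
    by (intro CollectI exI[of _ "z + w"]) (simp add: j k cls4_ops(1) algebra_simps)
  show "(\<lambda>a. j (k a)) \<in> quasicyclic_radical"
    unfolding quasicyclic_radical_def
    using odd_denom_mult[OF odd_denom_mult[OF _ z] w, of 2]
    by (intro CollectI exI[of _ "2 * z * w"]) (simp add: j k algebra_simps)
qed

subsection \<open>The extension\<close>

text \<open>
  The unit \<open>t\<close> belongs to this set. Both differences that have to be radical are so by definition: \<open>u - 1\<close>
  acting on the field, and \<open>\<plusminus>1 - 1\<close>, which is even, acting on the quasicyclic group.
\<close>

definition norm_units :: "qfield set"
  where "norm_units = {u. u - 1 \<in> local_maximal_ideal \<and> (qnorm u = 1 \<or> qnorm u = - 1)}"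

lemma norm_units_closed:
  "1 \<in> norm_units"
  "u \<in> norm_units \<Longrightarrow> u \<noteq> 0"
  "u \<in> norm_units \<Longrightarrow> v \<in> norm_units \<Longrightarrow> u * v \<in> norm_units"
  "u \<in> norm_units \<Longrightarrow> inverse u \<in> norm_units"
proof -
  note cl = local_maximal_ideal_closed
  show "1 \<in> norm_units" by (simp add: norm_units_def cl(1) qnorm_one)
  show nz: "u \<noteq> 0" if "u \<in> norm_units" for u
    using that by (auto simp: norm_units_def zero_qfield_def)
  show "u * v \<in> norm_units" if uv: "u \<in> norm_units" "v \<in> norm_units"
  proof -
    have "(u - 1) * (v - 1) + (u - 1) + (v - 1) \<in> local_maximal_ideal"
      using uv by (intro cl(2,4)) (auto simp: norm_units_def)
    then have "u * v - 1 \<in> local_maximal_ideal" by (simp add: algebra_simps)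
    then show ?thesis using uv by (auto simp: norm_units_def qnorm_mult)
  qed
  show "inverse u \<in> norm_units" if u: "u \<in> norm_units"
  proof -
    have a: "1 - u \<in> local_maximal_ideal" using cl(3)[of "u - 1"] u by (simp add: norm_units_def)
    have "inverse u - 1 = (1 - u) / (1 - (1 - u))" using nz[OF u] by (simp add: field_simps)
    then have "inverse u - 1 \<in> local_maximal_ideal"
      using local_maximal_ideal_quasi_inverse(2)[OF a] by simp
    moreover have "qnorm (inverse u) * qnorm u = 1"
      using nz[OF u] by (simp add: qnorm_one flip: qnorm_mult)
    ultimately show ?thesis using u by (auto simp: norm_units_def)
  qed
qed

definition unit_group :: "qfield monoid"
  where "unit_group = \<lparr>carrier = norm_units, monoid.mult = (*), one = 1\<rparr>"

lemma comm_group_unit_group: "comm_group unit_group"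
proof (rule comm_groupI)
  show "\<exists>y\<in>carrier unit_group. y \<otimes>\<^bsub>unit_group\<^esub> x = \<one>\<^bsub>unit_group\<^esub>" if "x \<in> carrier unit_group" for x
    using that norm_units_closed(2,4)
    by (intro bexI[of _ "inverse x"]) (auto simp: unit_group_def)
qed (auto simp: unit_group_def norm_units_closed(1,3) algebra_simps)

definition affine_group :: "(qfield \<times> qfield) monoid"
  where "affine_group = \<lparr>carrier = norm_units \<times> UNIV,
    monoid.mult = (\<lambda>(u, v) (u', v'). (u * u', u' * v + v')), one = (1, 0)\<rparr>"

lemma group_affine_group: "group affine_group"
proof (rule groupI)
  show "\<exists>y\<in>carrier affine_group. y \<otimes>\<^bsub>affine_group\<^esub> x = \<one>\<^bsub>affine_group\<^esub>"
    if "x \<in> carrier affine_group" for x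
    using that norm_units_closed(2,4)
    by (intro bexI[of _ "(inverse (fst x), - (snd x * inverse (fst x)))"])
      (auto simp: affine_group_def algebra_simps)
qed (auto simp: affine_group_def norm_units_closed(1,3) algebra_simps)

text \<open>
  The determinant form with respect to the basis \<open>1, t\<close>; multiplication by \<open>u\<close> scales it by the norm of \<open>u\<close>.
\<close>

fun symplectic :: "qfield \<Rightarrow> qfield \<Rightarrow> rat" where "symplectic (QF a b) (QF c d) = a * d - b * c"

lemma symplectic_simps:
  "symplectic (x + y) z = symplectic x z + symplectic y z"
  "symplectic x (y + z) = symplectic x y + symplectic x z"
  "symplectic (u * x) (u * y) = qnorm u * symplectic x y"
  "symplectic x x = 0"
  "symplectic (- x) y = - symplectic x y"
  "symplectic 0 x = 0" "symplectic x 0 = 0"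
  by (cases x; cases y; cases z; cases u; simp add: algebra_simps zero_qfield_def)+

text \<open>
  The action of a unit of norm \<open>\<plusminus>1\<close> on the quasicyclic group through its norm.
\<close>

definition twist :: "qfield \<Rightarrow> quasicyclic \<Rightarrow> quasicyclic"
  where "twist u d = (if qnorm u = 1 then d else - d)"

lemma twist_simps:
  "twist u (d + e) = twist u d + twist u e"
  "twist 1 d = d"
  "twist u 0 = 0"
  "twist u (- d) = - twist u d"
  "twist u (twist v d) = twist v (twist u d)"
  by (simp_all add: twist_def qnorm_one)

lemma twist_mult:
  assumes "u \<in> norm_units" "v \<in> norm_units"
  shows "twist (u * v) d = twist v (twist u d)"
  using assms by (auto simp: twist_def norm_units_def qnorm_mult)

lemma twist_cls4: "u \<in> norm_units \<Longrightarrow> twist u (cls4 x) = cls4 (qnorm u * x)"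
  by (auto simp: twist_def norm_units_def cls4_ops(2))

text \<open>
  Units act on the right on the Heisenberg group that \<open>symplectic\<close>, reduced modulo \<open>cong4\<close>, defines on the field.
\<close>

definition heisenberg_group :: "(qfield \<times> qfield \<times> quasicyclic) monoid"
  where "heisenberg_group = \<lparr>carrier = norm_units \<times> UNIV,
    monoid.mult = (\<lambda>(u, v, d) (u', v', d').
      (u * u', u' * v + v', twist u' d + d' + cls4 (symplectic (u' * v) v'))),
    one = (1, 0, 0)\<rparr>"

lemma heisenberg_mult:
  "(u, v, d) \<otimes>\<^bsub>heisenberg_group\<^esub> (u', v', d') =
    (u * u', u' * v + v', twist u' d + d' + cls4 (symplectic (u' * v) v'))"
  by (simp add: heisenberg_group_def)

lemma group_heisenberg_group: "group heisenberg_group"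
proof (rule groupI)
  fix x y z assume "x \<in> carrier heisenberg_group" "y \<in> carrier heisenberg_group"
    "z \<in> carrier heisenberg_group"
  then obtain u v d u' v' d' u'' v'' d'' where *: "x = (u, v, d)" "y = (u', v', d')" "z = (u'', v'', d'')"
    "u \<in> norm_units" "u' \<in> norm_units" "u'' \<in> norm_units"
    by (auto simp: heisenberg_group_def)
  have "cls4 (symplectic (u'' * (u' * v + v')) v'') =
      cls4 (symplectic (u' * u'' * v) v'') + cls4 (symplectic (u'' * v') v'')"
    by (simp add: cls4_ops(1) distrib_left symplectic_simps mult.assoc mult.left_commute)
  moreover have "cls4 (symplectic (u' * u'' * v) (u'' * v' + v'')) =
      twist u'' (cls4 (symplectic (u' * v) v')) + cls4 (symplectic (u' * u'' * v) v'')"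
    using symplectic_simps(3)[of u'' "u' * v" v'] *(6)
    by (simp add: cls4_ops(1) symplectic_simps(2) twist_cls4 mult.assoc mult.left_commute)
  ultimately show "x \<otimes>\<^bsub>heisenberg_group\<^esub> y \<otimes>\<^bsub>heisenberg_group\<^esub> z =
      x \<otimes>\<^bsub>heisenberg_group\<^esub> (y \<otimes>\<^bsub>heisenberg_group\<^esub> z)"
    using *(4-6) by (simp add: *(1-3) heisenberg_mult twist_mult twist_simps algebra_simps)
next
  fix x assume "x \<in> carrier heisenberg_group"
  then obtain u v d where x: "x = (u, v, d)" "u \<in> norm_units" by (auto simp: heisenberg_group_def)
  show "\<one>\<^bsub>heisenberg_group\<^esub> \<otimes>\<^bsub>heisenberg_group\<^esub> x = x"
    by (simp add: x heisenberg_group_def twist_simps symplectic_simps zero_quasicyclic_def[symmetric]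
        flip: cls4_ops(3))
  let ?y = "(inverse u, - (v * inverse u), - twist u d)"
  have "twist u (twist u d) = d" for d
    using x(2) by (simp add: twist_def)
  moreover have uv: "u * (v * inverse u) = v"
    using norm_units_closed(2)[OF x(2)] by (simp add: mult.left_commute[of u v])
  ultimately have "?y \<otimes>\<^bsub>heisenberg_group\<^esub> x = \<one>\<^bsub>heisenberg_group\<^esub>"
    using norm_units_closed(2)[OF x(2)]
    by (simp add: x(1) heisenberg_group_def twist_simps symplectic_simps algebra_simps flip: cls4_ops(3))
      (simp only: uv symplectic_simps minus_zero cls4_ops(3))
  moreover have "?y \<in> carrier heisenberg_group"
    using norm_units_closed(4)[OF x(2)] by (simp add: heisenberg_group_def)
  ultimately show "\<exists>y\<in>carrier heisenberg_group. y \<otimes>\<^bsub>heisenberg_group\<^esub> x = \<one>\<^bsub>heisenberg_group\<^esub>"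
    by blast
qed (auto simp: heisenberg_group_def norm_units_closed(1,3))

lemma conj_from_commutation:
  assumes "group T" "t \<in> carrier T" "a \<in> carrier T" "b \<in> carrier T" "a \<otimes>\<^bsub>T\<^esub> t = t \<otimes>\<^bsub>T\<^esub> b"
  shows "inv\<^bsub>T\<^esub> t \<otimes>\<^bsub>T\<^esub> a \<otimes>\<^bsub>T\<^esub> t = b"
proof -
  interpret group T by fact
  show ?thesis using assms by (simp add: m_assoc)
qed

lemma uniquely_solvable_affine_group: "uniquely_solvable affine_group"
proof (rule radical_endomorphisms.uniquely_solvable_extension[OF radical_field_radical])
  show "group affine_group" by (rule group_affine_group)
  show "group unit_group" using comm_group_unit_group by (rule comm_group.axioms(2))
  show "uniquely_solvable unit_group" by (rule comm_group.uniquely_solvable[OF comm_group_unit_group])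
  show "fst \<in> hom affine_group unit_group"
    by (auto simp: hom_def affine_group_def unit_group_def)
  show "fst ` carrier affine_group = carrier unit_group"
    by (simp add: affine_group_def unit_group_def)
  let ?\<iota> = "\<lambda>v. (1, v) :: qfield \<times> qfield"
  show \<iota>: "?\<iota> v \<in> carrier affine_group" for v by (simp add: affine_group_def norm_units_closed)
  show "?\<iota> (v + w) = ?\<iota> v \<otimes>\<^bsub>affine_group\<^esub> ?\<iota> w" for v w by (simp add: affine_group_def)
  show "inj ?\<iota>" by (simp add: inj_def)
  show "fst t = \<one>\<^bsub>unit_group\<^esub> \<longleftrightarrow> t \<in> range ?\<iota>" if "t \<in> carrier affine_group" for t
    by (cases t) (auto simp: unit_group_def)
  fix t assume t: "t \<in> carrier affine_group"
  then obtain u w where uw: "t = (u, w)" "u \<in> norm_units" by (auto simp: affine_group_def)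
  have "inv\<^bsub>affine_group\<^esub> t \<otimes>\<^bsub>affine_group\<^esub> ?\<iota> v \<otimes>\<^bsub>affine_group\<^esub> t = ?\<iota> (v + (u - 1) * v)" for v
    by (rule conj_from_commutation[OF group_affine_group t \<iota> \<iota>])
      (simp add: uw affine_group_def algebra_simps)
  moreover have "(\<lambda>v. (u - 1) * v) \<in> field_radical"
    unfolding field_radical_def using uw(2) by (auto simp: norm_units_def)
  ultimately show "\<exists>k\<in>field_radical. \<forall>v.
      inv\<^bsub>affine_group\<^esub> t \<otimes>\<^bsub>affine_group\<^esub> ?\<iota> v \<otimes>\<^bsub>affine_group\<^esub> t = ?\<iota> (v + k v)" by blast
qed

lemma uniquely_solvable_heisenberg_group: "uniquely_solvable heisenberg_group"
proof (rule radical_endomorphisms.uniquely_solvable_extension[OF radical_quasicyclic_radical])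
  show "group heisenberg_group" by (rule group_heisenberg_group)
  show "group affine_group" by (rule group_affine_group)
  show "uniquely_solvable affine_group" by (rule uniquely_solvable_affine_group)
  let ?\<pi> = "\<lambda>(u, v, d). (u, v) :: qfield \<times> qfield"
  show "?\<pi> \<in> hom heisenberg_group affine_group"
    by (auto simp: hom_def affine_group_def heisenberg_group_def)
  show "?\<pi> ` carrier heisenberg_group = carrier affine_group"
    by (force simp: heisenberg_group_def affine_group_def image_iff)
  let ?\<iota> = "\<lambda>d. (1, 0, d) :: qfield \<times> qfield \<times> quasicyclic"
  show \<iota>: "?\<iota> d \<in> carrier heisenberg_group" for d by (simp add: heisenberg_group_def norm_units_closed)
  show "?\<iota> (d + e) = ?\<iota> d \<otimes>\<^bsub>heisenberg_group\<^esub> ?\<iota> e" for d e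
    by (simp add: heisenberg_mult symplectic_simps twist_simps flip: cls4_ops(3))
  show "inj ?\<iota>" by (simp add: inj_def)
  show "?\<pi> t = \<one>\<^bsub>affine_group\<^esub> \<longleftrightarrow> t \<in> range ?\<iota>" if "t \<in> carrier heisenberg_group" for t
    by (cases t) (auto simp: affine_group_def)
  fix t assume t: "t \<in> carrier heisenberg_group"
  then obtain u w e where uw: "t = (u, w, e)" "u \<in> norm_units" by (auto simp: heisenberg_group_def)
  let ?z = "if qnorm u = 1 then 0 else - 1 :: rat"
  have "odd_denom ?z" using odd_denom_minus[of 1] by simp
  then obtain k where k: "\<And>x. k (cls4 x) = cls4 (2 * ?z * x)" "k \<in> quasicyclic_radical"
    using quasicyclic_radical_exists by blast
  have "twist u d = d + k d" for d
    by (cases d rule: cls4_cases) (simp add: k(1) twist_def cls4_ops(1,2) flip: cls4_ops(3))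
  then have "inv\<^bsub>heisenberg_group\<^esub> t \<otimes>\<^bsub>heisenberg_group\<^esub> ?\<iota> d \<otimes>\<^bsub>heisenberg_group\<^esub> t = ?\<iota> (d + k d)" for d
    by (intro conj_from_commutation[OF group_heisenberg_group t \<iota> \<iota>])
      (simp add: uw heisenberg_mult symplectic_simps twist_simps add.commute flip: cls4_ops(3))
  then show "\<exists>k\<in>quasicyclic_radical. \<forall>d.
      inv\<^bsub>heisenberg_group\<^esub> t \<otimes>\<^bsub>heisenberg_group\<^esub> ?\<iota> d \<otimes>\<^bsub>heisenberg_group\<^esub> t = ?\<iota> (d + k d)"
    using k(2) by blast
qed

lemma map_gterm_id_on:
  "gterm_over A n t \<Longrightarrow> (\<And>a. a \<in> A \<Longrightarrow> f a = a) \<Longrightarrow> map_gterm f t = t"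
  by (induction t) auto

lemma uniquely_solvable_iso:
  assumes "group S" "group T" "h \<in> iso S T" "uniquely_solvable S"
  shows "uniquely_solvable T"
  unfolding uniquely_solvable_def
proof (intro allI impI)
  fix n w assume w: "contractible_system T n w"
  let ?g = "inv_into (carrier S) h"
  have h: "h \<in> hom S T" "bij_betw h (carrier S) (carrier T)" using assms(3) by (auto simp: iso_def)
  have "?g \<in> iso T S" by (rule group.iso_set_sym[OF assms(1,3)])
  then have g: "?g \<in> hom T S" "?g ` carrier T = carrier S" by (auto simp: iso_def bij_betw_def)
  have hg: "h (?g a) = a" if "a \<in> carrier T" for a using bij_betw_inv_into_right[OF h(2) that] .
  have gh: "?g (h a) = a" if "a \<in> carrier S" for a using bij_betw_inv_into_left[OF h(2) that] .
  have wT: "gterm_over (carrier T) n (w i)" if "i < n" for i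
    using w that by (simp add: contractible_system_def)
  have wS: "gterm_over (carrier S) n (map_gterm ?g (w i))" if "i < n" for i
    using gterm_over_map[OF wT[OF that], of ?g "carrier S"] g(2) by simp
  have "contractible_system S n (\<lambda>i. map_gterm ?g (w i))"
    using w wS by (simp add: contractible_system_def expo_map)
  then obtain x where x: "solves S n (\<lambda>i. map_gterm ?g (w i)) x"
    and unique: "\<And>y i. solves S n (\<lambda>i. map_gterm ?g (w i)) y \<Longrightarrow> i < n \<Longrightarrow> y i = x i"
    using \<open>uniquely_solvable S\<close> unfolding uniquely_solvable_def by blast
  have xS: "x i \<in> carrier S" if "i < n" for i using x that unfolding solves_def by blast
  have "h (x i) = gval T (\<lambda>i. h (x i)) (w i)" if i: "i < n" for i
  proof -
    have "x i = gval S x (map_gterm ?g (w i))" using x i unfolding solves_def by blast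
    then have "h (x i) = h (gval S x (map_gterm ?g (w i)))" by (rule arg_cong)
    also have "\<dots> = gval T (\<lambda>i. h (x i)) (map_gterm h (map_gterm ?g (w i)))"
      by (rule gval_map[OF h(1) assms(1,2) wS[OF i] xS])
    also have "map_gterm h (map_gterm ?g (w i)) = w i"
      unfolding gterm.map_comp by (rule map_gterm_id_on[OF wT[OF i]]) (simp add: hg)
    finally show ?thesis .
  qed
  then have "solves T n w (\<lambda>i. h (x i))"
    using hom_in_carrier[OF h(1) xS] unfolding solves_def by blast
  moreover have "y i = h (x i)" if y: "solves T n w y" and i: "i < n" for y i
  proof -
    have yT: "y i \<in> carrier T" if "i < n" for i using y that unfolding solves_def by blast
    have "?g (y i) = gval S (\<lambda>i. ?g (y i)) (map_gterm ?g (w i))" if i: "i < n" for i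
    proof -
      have "y i = gval T y (w i)" using y i unfolding solves_def by blast
      then have "?g (y i) = ?g (gval T y (w i))" by (rule arg_cong)
      also have "\<dots> = gval S (\<lambda>i. ?g (y i)) (map_gterm ?g (w i))"
        by (rule gval_map[OF g(1) assms(2,1) wT[OF i] yT])
      finally show ?thesis .
    qed
    then have "solves S n (\<lambda>i. map_gterm ?g (w i)) (\<lambda>i. ?g (y i))"
      using hom_in_carrier[OF g(1) yT] unfolding solves_def by blast
    from unique[OF this i] show ?thesis using hg[OF yT[OF i]] by simp
  qed
  ultimately show "\<exists>x. solves T n w x \<and> (\<forall>y. solves T n w y \<longrightarrow> (\<forall>i<n. y i = x i))" by blast
qed

instance qfield :: countable
proof (rule countable_classI[of "\<lambda>x. case x of QF a b \<Rightarrow> to_nat (a, b)"])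
qed (auto split: qfield.splits)

instance quasicyclic :: countable
proof (rule countable_classI[of "\<lambda>d. to_nat (rep_quasicyclic d)"])
  show "x = y" if "to_nat (rep_quasicyclic x) = to_nat (rep_quasicyclic y)" for x y
    using that by (metis Quotient_quasicyclic Quotient_abs_rep from_nat_to_nat)
qed

text \<open>
  With \<open>x = (1, 1, d)\<close> and \<open>b = (t, 0, 0)\<close> the relation \<open>x^(b\<^sup>2) = x x^(3b)\<close> reads \<open>d = - 2 d + 3\<close> in the last component,
  which is where \<open>d = 1\<close> comes from.
\<close>

definition heisenberg_x :: "qfield \<times> qfield \<times> quasicyclic" where "heisenberg_x = (1, 1, cls4 1)"
definition heisenberg_b :: "qfield \<times> qfield \<times> quasicyclic" where "heisenberg_b = (QF 0 1, 0, 0)"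

lemma heisenberg_relations:
  fixes X B
  defines "Y \<equiv> inv\<^bsub>heisenberg_group\<^esub> B \<otimes>\<^bsub>heisenberg_group\<^esub> (X \<otimes>\<^bsub>heisenberg_group\<^esub> B)"
  defines "Z \<equiv> commutator heisenberg_group X Y"
  assumes "X = heisenberg_x" "B = heisenberg_b"
  shows "X \<in> carrier heisenberg_group" "B \<in> carrier heisenberg_group"
    "inv\<^bsub>heisenberg_group\<^esub> B \<otimes>\<^bsub>heisenberg_group\<^esub> (Y \<otimes>\<^bsub>heisenberg_group\<^esub> B) =
      X \<otimes>\<^bsub>heisenberg_group\<^esub> (Y \<otimes>\<^bsub>heisenberg_group\<^esub> (Y \<otimes>\<^bsub>heisenberg_group\<^esub> Y))"
    "Z \<otimes>\<^bsub>heisenberg_group\<^esub> X = X \<otimes>\<^bsub>heisenberg_group\<^esub> Z"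
    "Z \<otimes>\<^bsub>heisenberg_group\<^esub> Y = Y \<otimes>\<^bsub>heisenberg_group\<^esub> Z"
    "Z [^]\<^bsub>heisenberg_group\<^esub> (4::nat) = \<one>\<^bsub>heisenberg_group\<^esub>"
    "Z \<noteq> \<one>\<^bsub>heisenberg_group\<^esub>"
proof -
  let ?H = heisenberg_group
  interpret group ?H by (rule group_heisenberg_group)
  define \<tau> where "\<tau> = QF 0 1"
  have "\<tau> - 1 \<in> local_maximal_ideal"
    unfolding local_maximal_ideal_def
  proof (intro CollectI bexI)
    have "\<tau> - 1 = int_elt (- 1) 1" by (simp add: \<tau>_def int_elt_def one_qfield_def)
    moreover have "3 dvd (- 1 + 1 :: int)" by simp
    ultimately have "\<tau> - 1 \<in> prime_ints" unfolding prime_ints_def by blast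
    then show "(\<tau> - 1) * 1 \<in> prime_ints" by simp
  qed (rule one_in_unit_ints)
  then have \<tau>: "\<tau> \<in> norm_units" by (simp add: norm_units_def) (simp add: \<tau>_def)
  have carrier: "(u, v, d) \<in> carrier ?H" if "u \<in> norm_units" for u v d
    using that by (simp add: heisenberg_group_def)
  have two: "(2::qfield) = QF 2 0" using one_add_one[where 'a = qfield] by (simp add: one_qfield_def)
  have "(3::qfield) = 2 + 1" by simp
  then have numerals: "(2::qfield) = QF 2 0" "(3::qfield) = QF 3 0" by (simp_all add: two one_qfield_def)
  have one: "\<one>\<^bsub>?H\<^esub> = (1, 0, 0)" by (simp add: heisenberg_group_def)
  show X: "X \<in> carrier ?H" and B: "B \<in> carrier ?H"
    unfolding assms heisenberg_x_def heisenberg_b_def \<tau>_def[symmetric]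
    by (rule carrier, rule norm_units_closed(1), rule carrier, rule \<tau>)
  have XB: "X = (1, 1, cls4 1)" "B = (\<tau>, 0, 0)"
    by (simp_all add: assms heisenberg_x_def heisenberg_b_def \<tau>_def)
  have conj: "inv\<^bsub>?H\<^esub> B \<otimes>\<^bsub>?H\<^esub> ((1, v, d) \<otimes>\<^bsub>?H\<^esub> B) = (1, \<tau> * v, - d)" for v d
  proof -
    have "(1, v, d) \<otimes>\<^bsub>?H\<^esub> B = B \<otimes>\<^bsub>?H\<^esub> (1, \<tau> * v, - d)"
      by (simp add: XB heisenberg_mult symplectic_simps twist_simps flip: cls4_ops(3))
        (simp add: twist_def \<tau>_def)
    then show ?thesis
      using conj_from_commutation[OF group_heisenberg_group B carrier carrier] norm_units_closed(1) B carrier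
      by (simp add: m_assoc)
  qed
  have Y: "Y = (1, \<tau>, cls4 (- 1))"
    unfolding Y_def XB(1) conj by (simp add: cls4_ops(2))
  have YH: "Y \<in> carrier ?H" unfolding Y by (rule carrier[OF norm_units_closed(1)])
  have comm: "X \<otimes>\<^bsub>?H\<^esub> Y = (Y \<otimes>\<^bsub>?H\<^esub> X) \<otimes>\<^bsub>?H\<^esub> (1, 0, cls4 2)"
    by (simp add: XB(1) Y heisenberg_mult twist_simps symplectic_simps cls4_ops(1) add.commute)
      (simp add: \<tau>_def one_qfield_def)
  have Z: "Z = (1, 0, cls4 2)"
    unfolding Z_def commutator_def using comm X YH carrier[OF norm_units_closed(1)] by (simp add: m_assoc)
  show "inv\<^bsub>?H\<^esub> B \<otimes>\<^bsub>?H\<^esub> (Y \<otimes>\<^bsub>?H\<^esub> B) = X \<otimes>\<^bsub>?H\<^esub> (Y \<otimes>\<^bsub>?H\<^esub> (Y \<otimes>\<^bsub>?H\<^esub> Y))"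
    unfolding Y conj unfolding XB(1)
    by (simp add: heisenberg_mult twist_simps symplectic_simps cls4_ops(1,2) add.commute)
      (simp add: \<tau>_def numerals one_qfield_def)
  show "Z \<otimes>\<^bsub>?H\<^esub> X = X \<otimes>\<^bsub>?H\<^esub> Z" "Z \<otimes>\<^bsub>?H\<^esub> Y = Y \<otimes>\<^bsub>?H\<^esub> Z"
    by (simp_all add: Z XB(1) Y heisenberg_mult twist_simps symplectic_simps cls4_ops(1) add.commute)
  have "Z [^]\<^bsub>?H\<^esub> (4::nat) = (1, 0, cls4 8)"
    by (simp add: numeral_eq_Suc Z heisenberg_mult one twist_simps symplectic_simps cls4_ops(1,3))
  also have "\<dots> = \<one>\<^bsub>?H\<^esub>" by (simp add: one cls4_ops(3,4))
  finally show "Z [^]\<^bsub>?H\<^esub> (4::nat) = \<one>\<^bsub>?H\<^esub>" .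
  show "Z \<noteq> \<one>\<^bsub>?H\<^esub>"
    using odd_denom_half by (simp add: Z one cls4_ops(3,4))
qed

section \<open>Heisenberg relations\<close>

text \<open>
  \<open>n(n-1)/2\<close>, as an integer since it occurs as an exponent together with negative ones.
\<close>

definition triangular :: "nat \<Rightarrow> int" where "triangular n = (\<Sum>i<n. int i)"

lemma triangular_simps [simp]: "triangular 0 = 0" "triangular (Suc n) = triangular n + int n"
  by (simp_all add: triangular_def)

lemma triangular_double: "2 * triangular n = int n * (int n - 1)"
  by (induction n) (simp_all add: algebra_simps)

text \<open>
  Every product of powers of \<open>X\<close>, \<open>Y\<close>, \<open>Z\<close> has the normal form \<open>X^i Y^j Z^k\<close>, which reduces all computations below to
  integer arithmetic.
\<close>

locale heisenberg_triple = group G for G (structure) +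
  fixes X Y Z
  assumes XYZ [simp]: "X \<in> carrier G" "Y \<in> carrier G" "Z \<in> carrier G"
    and XY: "X \<otimes> Y = Y \<otimes> X \<otimes> Z"
    and ZX: "Z \<otimes> X = X \<otimes> Z" and ZY: "Z \<otimes> Y = Y \<otimes> Z"
begin

definition nf :: "int \<Rightarrow> int \<Rightarrow> int \<Rightarrow> 'a"
  where "nf i j k = X [^] i \<otimes> Y [^] j \<otimes> Z [^] k"

lemma nf_closed [simp]: "nf i j k \<in> carrier G" by (simp add: nf_def)

lemma commute_int_pow:
  assumes "a \<in> carrier G" "b \<in> carrier G" "a \<otimes> b = b \<otimes> a"
  shows "a [^] (i::int) \<otimes> b = b \<otimes> a [^] i"
proof -
  have *: "inv b \<otimes> a \<otimes> b = a" using assms by (simp add: m_assoc)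
  have "(\<lambda>x. inv b \<otimes> x \<otimes> b) \<in> hom G G" using assms(2) by (auto simp: hom_def m_assoc)
  then have "inv b \<otimes> a [^] i \<otimes> b = (inv b \<otimes> a \<otimes> b) [^] i"
    using assms(1) by (intro hom_int_pow[of "\<lambda>x. inv b \<otimes> x \<otimes> b" G G]) (auto intro: is_group)
  then have "b \<otimes> (inv b \<otimes> a [^] i \<otimes> b) = b \<otimes> a [^] i" by (simp add: *)
  then show ?thesis using assms(1,2) by (simp add: m_assoc)
qed

lemma commute_int_pow2:
  assumes "a \<in> carrier G" "b \<in> carrier G" "a \<otimes> b = b \<otimes> a"
  shows "a [^] (i::int) \<otimes> b [^] (j::int) = b [^] j \<otimes> a [^] i"
  using commute_int_pow[of b "a [^] i" j] commute_int_pow[OF assms, of i] assms by simp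

lemma swap_single: "Y \<otimes> X = X \<otimes> Y \<otimes> inv Z"
  using XY by (simp add: m_assoc)

lemma swap_pow: "Y [^] (j::int) \<otimes> X [^] (i::int) = X [^] i \<otimes> Y [^] j \<otimes> Z [^] (- i * j)"
proof -
  have conj_hom: "(\<lambda>x. inv b \<otimes> x \<otimes> b) \<in> hom G G" if "b \<in> carrier G" for b
    using that by (auto simp: hom_def m_assoc)
  have conj_pow: "inv b \<otimes> a [^] (k::int) \<otimes> b = (inv b \<otimes> a \<otimes> b) [^] k"
    if "a \<in> carrier G" "b \<in> carrier G" for a b k
    using hom_int_pow[OF conj_hom[OF that(2)] that(1) is_group is_group] .
  have Z_inv: "inv Z \<otimes> X = X \<otimes> inv Z" "inv Z \<otimes> Y = Y \<otimes> inv Z"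
    using commute_int_pow[of Z X "- 1"] commute_int_pow[of Z Y "- 1"] ZX ZY by (simp_all add: int_pow_neg)
  have "inv (inv Y) \<otimes> X \<otimes> inv Y = X \<otimes> inv Z"
  proof -
    have "Y \<otimes> X \<otimes> inv Y = X \<otimes> Y \<otimes> (inv Z \<otimes> inv Y)" by (simp add: swap_single m_assoc)
    also have "inv Z \<otimes> inv Y = inv Y \<otimes> inv Z" using ZY by (simp flip: inv_mult_group)
    finally show ?thesis by (simp add: m_assoc)
  qed
  then have "Y \<otimes> X [^] i \<otimes> inv Y = (X \<otimes> inv Z) [^] i" using conj_pow[of X "inv Y" i] by simp
  also have "\<dots> = X [^] i \<otimes> inv Z [^] i" using Z_inv(1) by (intro int_pow_mult_distrib) simp_all
  finally have "(Y \<otimes> X [^] i \<otimes> inv Y) \<otimes> Y = (X [^] i \<otimes> inv Z [^] i) \<otimes> Y" by simp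
  then have "Y \<otimes> X [^] i = X [^] i \<otimes> (inv Z [^] i \<otimes> Y)" by (simp add: m_assoc)
  also have "inv Z [^] i \<otimes> Y = Y \<otimes> Z [^] (- i)"
    using commute_int_pow[of "inv Z" Y i] Z_inv(2) by (simp add: int_pow_inv int_pow_neg)
  finally have 1: "inv (X [^] i) \<otimes> Y \<otimes> X [^] i = Y \<otimes> Z [^] (- i)" by (simp add: m_assoc)
  have "inv (X [^] i) \<otimes> Y [^] j \<otimes> X [^] i = (Y \<otimes> Z [^] (- i)) [^] j"
    using conj_pow[of Y "X [^] i" j] 1 by simp
  also have "\<dots> = Y [^] j \<otimes> (Z [^] (- i)) [^] j"
    using commute_int_pow[of Z Y "- i"] ZY by (intro int_pow_mult_distrib) simp_all
  finally have "X [^] i \<otimes> (inv (X [^] i) \<otimes> Y [^] j \<otimes> X [^] i) = X [^] i \<otimes> (Y [^] j \<otimes> Z [^] (- i * j))"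
    by (simp add: int_pow_pow)
  then show ?thesis by (simp add: m_assoc)
qed

lemma nf_mult: "nf i j k \<otimes> nf i' j' k' = nf (i + i') (j + j') (k + k' - j * i')"
proof -
  have "nf i j k \<otimes> nf i' j' k' = X [^] i \<otimes> (Y [^] j \<otimes> ((Z [^] k \<otimes> X [^] i') \<otimes> (Y [^] j' \<otimes> Z [^] k')))"
    by (simp add: nf_def m_assoc)
  also have "Z [^] k \<otimes> X [^] i' = X [^] i' \<otimes> Z [^] k" by (intro commute_int_pow2 ZX) simp_all
  also have "X [^] i' \<otimes> Z [^] k \<otimes> (Y [^] j' \<otimes> Z [^] k') = X [^] i' \<otimes> ((Z [^] k \<otimes> Y [^] j') \<otimes> Z [^] k')"
    by (simp add: m_assoc)
  also have "Z [^] k \<otimes> Y [^] j' = Y [^] j' \<otimes> Z [^] k" by (intro commute_int_pow2 ZY) simp_all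
  also have "Y [^] j \<otimes> (X [^] i' \<otimes> (Y [^] j' \<otimes> Z [^] k \<otimes> Z [^] k')) =
      (Y [^] j \<otimes> X [^] i') \<otimes> (Y [^] j' \<otimes> (Z [^] k \<otimes> Z [^] k'))" by (simp add: m_assoc)
  also have "\<dots> = X [^] i' \<otimes> (Y [^] j \<otimes> ((Z [^] (- i' * j) \<otimes> Y [^] j') \<otimes> (Z [^] k \<otimes> Z [^] k')))"
    unfolding swap_pow by (simp add: m_assoc)
  also have "Z [^] (- i' * j) \<otimes> Y [^] j' = Y [^] j' \<otimes> Z [^] (- i' * j)"
    by (intro commute_int_pow2 ZY) simp_all
  also have "X [^] i \<otimes> (X [^] i' \<otimes> (Y [^] j \<otimes> (Y [^] j' \<otimes> Z [^] (- i' * j) \<otimes> (Z [^] k \<otimes> Z [^] k')))) =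
      (X [^] i \<otimes> X [^] i') \<otimes> (Y [^] j \<otimes> Y [^] j') \<otimes> (Z [^] (- i' * j) \<otimes> (Z [^] k \<otimes> Z [^] k'))"
    by (simp add: m_assoc)
  also have "\<dots> = nf (i + i') (j + j') (k + k' - j * i')"
    by (simp add: nf_def int_pow_mult[symmetric] algebra_simps)
  finally show ?thesis .
qed

lemma nf_0 [simp]: "nf 0 0 0 = \<one>" by (simp add: nf_def)

lemma nf_XYZ: "X = nf 1 0 0" "Y = nf 0 1 0" "Z = nf 0 0 1" by (simp_all add: nf_def)

lemma nf_generator_mult:
  "X \<otimes> nf i j k = nf (i + 1) j k" "nf i j k \<otimes> X = nf (i + 1) j (k - j)"
  "Y \<otimes> nf i j k = nf i (j + 1) (k - i)" "nf i j k \<otimes> Y = nf i (j + 1) k"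
  "Z \<otimes> nf i j k = nf i j (k + 1)" "nf i j k \<otimes> Z = nf i j (k + 1)"
  using nf_mult[of 1 0 0 i j k] nf_mult[of i j k 1 0 0] nf_mult[of 0 1 0 i j k]
    nf_mult[of i j k 0 1 0] nf_mult[of 0 0 1 i j k] nf_mult[of i j k 0 0 1]
  by (simp_all flip: nf_XYZ add: add.commute)

lemma nf_generator_square: "X \<otimes> X = nf 2 0 0" "Y \<otimes> Y = nf 0 2 0"
  using nf_mult[of 1 0 0 1 0 0] nf_mult[of 0 1 0 0 1 0] by (simp_all flip: nf_XYZ)

lemma nf_inv: "inv (nf i j k) = nf (- i) (- j) (- k - i * j)"
  by (rule inv_equality) (simp_all add: nf_mult algebra_simps)

lemma nf_pow: "nf i j k [^] (m::nat) = nf (int m * i) (int m * j) (int m * k - triangular m * (i * j))"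
  by (induction m) (simp_all add: nf_mult algebra_simps)

lemma nf_Z_pow: "Z [^] (k::int) = nf 0 0 k" "X [^] (k::int) = nf k 0 0" "Y [^] (k::int) = nf 0 k 0"
  by (simp_all add: nf_def)

lemma nf_Z_nat_pow: "Z [^] (k::nat) = nf 0 0 (int k)" "X [^] (k::nat) = nf (int k) 0 0"
  "Y [^] (k::nat) = nf 0 (int k) 0"
  by (simp_all add: nf_def int_pow_int)

end

text \<open>
  The relations of \<open>K\<^sub>n\<close>. For \<open>n = 1\<close> they say that \<open>X\<close> commutes with its conjugate, and so they are
  the relations of \<open>H\<close>.
\<close>

definition heisenberg_rel :: "('a, 'm) monoid_scheme \<Rightarrow> nat \<Rightarrow> 'a \<Rightarrow> 'a \<Rightarrow> bool"
  where "heisenberg_rel G n X B \<longleftrightarrow> X \<in> carrier G \<and> B \<in> carrier G \<and>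
    (let Y = inv\<^bsub>G\<^esub> B \<otimes>\<^bsub>G\<^esub> (X \<otimes>\<^bsub>G\<^esub> B); Z = commutator G X Y
     in inv\<^bsub>G\<^esub> B \<otimes>\<^bsub>G\<^esub> (Y \<otimes>\<^bsub>G\<^esub> B) = X \<otimes>\<^bsub>G\<^esub> (Y \<otimes>\<^bsub>G\<^esub> (Y \<otimes>\<^bsub>G\<^esub> Y)) \<and>
        Z \<otimes>\<^bsub>G\<^esub> X = X \<otimes>\<^bsub>G\<^esub> Z \<and> Z \<otimes>\<^bsub>G\<^esub> Y = Y \<otimes>\<^bsub>G\<^esub> Z \<and> Z [^]\<^bsub>G\<^esub> (n * n) = \<one>\<^bsub>G\<^esub>)"

lemma (in group) heisenberg_triple_commutator:
  assumes "X \<in> carrier G" "Y \<in> carrier G"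
    "commutator G X Y \<otimes> X = X \<otimes> commutator G X Y" "commutator G X Y \<otimes> Y = Y \<otimes> commutator G X Y"
  shows "heisenberg_triple G X Y (commutator G X Y)"
  by unfold_locales (use assms in \<open>auto simp: commutator_def m_assoc\<close>)

lemma (in group) commutator_eqI:
  assumes "x \<in> carrier G" "y \<in> carrier G" "z \<in> carrier G" "x \<otimes> y = y \<otimes> x \<otimes> z"
  shows "commutator G x y = z"
proof -
  have "commutator G x y = inv (y \<otimes> x) \<otimes> (x \<otimes> y)" using assms by (simp add: commutator_def word_simps)
  also have "\<dots> = z" unfolding assms(4) using assms(1-3) by (simp add: word_simps)
  finally show ?thesis .
qed

context group
begin

definition conj_by :: "'a \<Rightarrow> 'a \<Rightarrow> 'a" where "conj_by B x = inv B \<otimes> (x \<otimes> B)"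

lemma conj_by_hom: "B \<in> carrier G \<Longrightarrow> conj_by B \<in> hom G G"
  by (auto simp: hom_def conj_by_def m_assoc)

lemma conj_by_simps:
  assumes "B \<in> carrier G" "x \<in> carrier G"
  shows "conj_by B x \<in> carrier G" "y \<in> carrier G \<Longrightarrow> conj_by B (x \<otimes> y) = conj_by B x \<otimes> conj_by B y"
    "conj_by B (inv x) = inv conj_by B x" "conj_by B (x [^] (k::int)) = conj_by B x [^] k"
    "conj_by B (x [^] (m::nat)) = conj_by B x [^] m"
    "y \<in> carrier G \<Longrightarrow> conj_by B (commutator G x y) = commutator G (conj_by B x) (conj_by B y)"
proof -
  interpret group_hom G G "conj_by B"
    using conj_by_hom[OF assms(1)] by (simp add: group_hom_def group_hom_axioms_def is_group)
  show "conj_by B x \<in> carrier G" using assms(2) by simp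
  show "conj_by B (x \<otimes> y) = conj_by B x \<otimes> conj_by B y" if "y \<in> carrier G" using assms that by simp
  show "conj_by B (inv x) = inv conj_by B x" using assms by simp
  show "conj_by B (x [^] (k::int)) = conj_by B x [^] k" using assms(2) by (rule hom_int_pow)
  show "conj_by B (x [^] (m::nat)) = conj_by B x [^] m" using assms(2) by (rule hom_nat_pow)
  show "conj_by B (commutator G x y) = commutator G (conj_by B x) (conj_by B y)" if "y \<in> carrier G"
    using assms that by (simp add: commutator_def)
qed

end

locale heisenberg_relations = group G for G (structure) +
  fixes n :: nat and X B
  assumes rel: "heisenberg_rel G n X B"
begin

definition Y where "Y = conj_by B X"
definition Z where "Z = commutator G X Y"

lemma rels: "X \<in> carrier G" "B \<in> carrier G" "conj_by B Y = X \<otimes> (Y \<otimes> (Y \<otimes> Y))"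
  "Z \<otimes> X = X \<otimes> Z" "Z \<otimes> Y = Y \<otimes> Z" "Z [^] (n * n) = \<one>"
  using rel unfolding heisenberg_rel_def Let_def Y_def Z_def conj_by_def by blast+

lemma Y_closed: "Y \<in> carrier G" unfolding Y_def by (rule conj_by_simps(1)[OF rels(2,1)])

sublocale heisenberg_triple G X Y Z
  unfolding Z_def
  by (rule heisenberg_triple_commutator[OF rels(1) Y_closed rels(4,5)[unfolded Z_def]])

lemma conj_Y: "conj_by B Y = nf 1 3 0"
  unfolding rels(3) by (simp add: nf_generator_mult nf_generator_square)

lemma conj_Z: "conj_by B Z = nf 0 0 (- 1)"
proof -
  have "conj_by B Z = conj_by B (commutator G X Y)" by (simp only: Z_def)
  also have "\<dots> = commutator G (conj_by B X) (conj_by B Y)"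
    by (rule conj_by_simps(6)[OF rels(2,1) Y_closed])
  also have "\<dots> = commutator G Y (nf 1 3 0)" by (simp only: Y_def[symmetric] conj_Y)
  also have "\<dots> = nf 0 0 (- 1)"
    by (rule commutator_eqI) (simp_all add: nf_generator_mult nf_mult Y_closed)
  finally show ?thesis .
qed

lemma conj_nf: "conj_by B (nf i (int j) k) = nf (int j) (i + 3 * int j) (- k - 3 * triangular j - i * int j)"
proof -
  have "conj_by B (nf i (int j) k) = Y [^] i \<otimes> nf 1 3 0 [^] j \<otimes> nf 0 0 (- 1) [^] k"
    unfolding nf_def[of i] using rels(1,2) Y_closed
    by (simp add: conj_by_simps int_pow_int conj_Y conj_Z flip: Y_def)
  also have "nf 0 0 (- 1) [^] k = nf 0 0 (- k)"
    using int_pow_pow[of Z "- 1" k] by (simp flip: nf_Z_pow add: int_pow_neg)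
  finally show ?thesis by (simp add: nf_pow nf_Z_pow nf_mult algebra_simps)
qed

lemma Z_order: "nf i j (k + int n * int n) = nf i j k"
proof -
  have "nf 0 0 (int n * int n) = \<one>" using rels(6) by (simp add: nf_Z_nat_pow)
  then show ?thesis using nf_mult[of i j k 0 0 "int n * int n"] by simp
qed

text \<open>
  The homomorphism \<open>H \<rightarrow> K\<^sub>n\<close>. Comparing exponents of \<open>Z\<close> in \<open>a^(b\<^sup>2) = a a^(3b)\<close> for \<open>a = X^n Z^j\<close> gives
  \<open>j - 3 n(n-1)/2 = - 2 j\<close>, so \<open>j = n(n-1)/2\<close>.
\<close>

lemma abelian_subrelation: "heisenberg_rel G 1 (nf (int n) 0 (triangular n)) B"
proof -
  let ?A = "nf (int n) 0 (triangular n)"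
  have A': "inv B \<otimes> (?A \<otimes> B) = nf 0 (int n) (- triangular n)"
    using conj_nf[of "int n" 0 "triangular n"] by (simp add: conj_by_def)
  have A'': "inv B \<otimes> (nf 0 (int n) (- triangular n) \<otimes> B) = nf (int n) (3 * int n) (- 2 * triangular n)"
    using conj_nf[of 0 n "- triangular n"] by (simp add: conj_by_def)
  have "commutator G ?A (nf 0 (int n) (- triangular n)) = \<one>"
    using Z_order[of "int n" "int n" "- (int n * int n)"]
    by (intro commutator_eqI) (simp_all add: nf_mult)
  then show ?thesis
    unfolding heisenberg_rel_def Let_def A' A'' using rels(2) by (simp add: nf_mult)
qed

end

text \<open>
  The homomorphism \<open>K\<^sub>n \<rightarrow> K\<^sub>2\<^sub>n\<close> under \<open>H\<close>: it has the shape of \<open>abelian_subrelation\<close> for the exponent 2.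
\<close>

lemma (in group) heisenberg_rel_double:
  assumes "heisenberg_rel G (2 * n) X B"
  defines "Y \<equiv> conj_by B X" defines "Z \<equiv> commutator G X Y"
  defines "X' \<equiv> X \<otimes> X \<otimes> Z" defines "Y' \<equiv> conj_by B X'"
  shows "heisenberg_rel G n X' B" "commutator G X' Y' = Z [^] (4::nat)"
    "X' [^] n \<otimes> commutator G X' Y' [^] triangular n = X [^] (2 * n) \<otimes> Z [^] triangular (2 * n)"
    "conj_by B Z = inv Z"
proof -
  interpret H: heisenberg_relations G "2 * n" X B by unfold_locales (fact assms(1))
  have eq: "H.Y = Y" "H.Z = Z" by (simp_all add: H.Y_def H.Z_def Y_def Z_def)
  have X': "X' = H.nf 2 0 1"
    unfolding X'_def eq(2)[symmetric] by (simp add: H.nf_generator_mult H.nf_generator_square)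
  have Y': "Y' = H.nf 0 2 (- 1)"
    unfolding Y'_def X' using H.conj_nf[of 2 0 1] by simp
  have Y'': "conj_by B Y' = H.nf 2 6 (- 2)"
    unfolding Y' using H.conj_nf[of 0 2 "- 1"] by (simp add: numeral_2_eq_2)
  have Z': "commutator G X' Y' = H.nf 0 0 4"
    unfolding X' Y' by (rule commutator_eqI) (simp_all add: H.nf_mult)
  then show "commutator G X' Y' = Z [^] (4::nat)" by (simp add: H.nf_Z_nat_pow flip: eq(2))
  have one: "H.nf 0 0 (4 * (int n * int n)) = \<one>"
    using H.Z_order[of 0 0 0] by (simp add: algebra_simps)
  have order: "H.nf 0 0 4 [^] (n * n) = \<one>"
    using one by (simp add: H.nf_pow algebra_simps)
  show "heisenberg_rel G n X' B"
    unfolding heisenberg_rel_def Let_def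
    unfolding conj_by_def[symmetric] Y'_def[symmetric] Z' Y'' order
    using H.rels(2) by (simp add: X' Y' H.nf_mult)
  have "H.nf 0 0 4 [^] triangular n = H.nf 0 0 (4 * triangular n)"
    using int_pow_pow[of H.Z 4 "triangular n"] H.XYZ(3) by (simp add: H.nf_Z_pow)
  then have "X' [^] n \<otimes> commutator G X' Y' [^] triangular n = H.nf (2 * int n) 0 (int n + 4 * triangular n)"
    unfolding Z' unfolding X' by (simp add: H.nf_pow H.nf_mult algebra_simps)
  also have "int n + 4 * triangular n = triangular (2 * n)"
    using triangular_double[of n] triangular_double[of "2 * n"] by (simp add: algebra_simps)
  also have "H.nf (2 * int n) 0 (triangular (2 * n)) = X [^] (2 * n) \<otimes> Z [^] triangular (2 * n)"
  proof -
    have "H.nf (2 * int n) 0 (triangular (2 * n)) = X [^] (2 * int n) \<otimes> H.Z [^] triangular (2 * n)"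
      by (simp add: H.nf_def H.rels(1))
    then show ?thesis unfolding eq using int_pow_int[of G X "2 * n"] by simp
  qed
  finally show "X' [^] n \<otimes> commutator G X' Y' [^] triangular n = X [^] (2 * n) \<otimes> Z [^] triangular (2 * n)" .
  show "conj_by B Z = inv Z"
  proof -
    have "inv H.Z = H.nf 0 0 (- 1)" using H.nf_inv[of 0 0 1] by (simp flip: H.nf_XYZ(3))
    then show ?thesis using H.conj_Z by (simp only: eq)
  qed
qed

subsection \<open>Lifting Heisenberg relations through central extensions\<close>

lemma (in group) bezout_power_one:
  fixes n :: nat and u v :: int
  assumes uv: "u * int n + 3 * v = 1" and r: "r \<in> carrier G" "r [^] (3::nat) = \<one>" "r [^] (n * n) = \<one>"
  shows "r = \<one>"
proof -
  have "int (n * n) * (u * u) + int 3 * (v * (1 + u * int n)) =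
      (u * int n + 3 * v) * (u * int n) + 3 * v"
    by (simp add: algebra_simps)
  also have "\<dots> = u * int n + 3 * v" by (simp only: uv mult_1_left)
  also note uv
  finally have eq: "int (n * n) * (u * u) + int 3 * (v * (1 + u * int n)) = 1" .
  have "r = r [^] (int (n * n) * (u * u) + int 3 * (v * (1 + u * int n)))"
    unfolding eq using r(1) by simp
  also have "\<dots> = (r [^] (n * n)) [^] (u * u) \<otimes> (r [^] (3::nat)) [^] (v * (1 + u * int n))"
    using r(1) int_pow_pow[of r "int (n * n)" "u * u"] int_pow_pow[of r "int 3" "v * (1 + u * int n)"]
    by (simp only: int_pow_mult int_pow_int)
  also have "\<dots> = \<one>" unfolding r(2,3) by simp
  finally show ?thesis .
qed

lemma (in group) central_mult_simps:
  assumes "\<And>x. x \<in> carrier G \<Longrightarrow> a \<otimes> x = x \<otimes> a" "a \<in> carrier G" "b \<in> carrier G" "x \<in> carrier G" "y \<in> carrier G"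
  shows "(x \<otimes> a) \<otimes> (y \<otimes> b) = (x \<otimes> y) \<otimes> (a \<otimes> b)"
proof -
  have "(x \<otimes> a) \<otimes> (y \<otimes> b) = x \<otimes> (a \<otimes> y) \<otimes> b" using assms by (simp add: m_assoc)
  also have "\<dots> = (x \<otimes> y) \<otimes> (a \<otimes> b)" unfolding assms(1)[OF assms(5)] using assms by (simp add: m_assoc)
  finally show ?thesis .
qed

text \<open>
  The commutators \<open>p = [Z, X]\<close> and \<open>r = [Z, Y]\<close> are central. Conjugation by \<open>B\<close> inverts \<open>Z\<close> up to central elements, so it gives
  \<open>r = p\<inverse>\<close>, and with \<open>Y^B = X Y\<^sup>3\<close> up to central elements also \<open>p r\<^sup>3 = r\<inverse>\<close>; hence \<open>r\<^sup>3 = 1\<close>.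
  As \<open>Z^(n\<^sup>2)\<close> is central, \<open>r^(n\<^sup>2) = 1\<close>, and \<open>n\<close> is prime to 3.
\<close>

lemma central_lift_commutes:
  assumes grp: "group E" "group K"
    and q: "q \<in> hom E K"
    and central: "\<And>c e. c \<in> carrier E \<Longrightarrow> q c = \<one>\<^bsub>K\<^esub> \<Longrightarrow> e \<in> carrier E \<Longrightarrow> c \<otimes>\<^bsub>E\<^esub> e = e \<otimes>\<^bsub>E\<^esub> c"
    and rel: "heisenberg_rel K n (q X) (q B)" and XB: "X \<in> carrier E" "B \<in> carrier E"
    and uv: "u * int n + 3 * v = 1"
  defines "Y \<equiv> group.conj_by E B X" defines "Z \<equiv> commutator E X Y"
  shows "Z \<otimes>\<^bsub>E\<^esub> X = X \<otimes>\<^bsub>E\<^esub> Z" "Z \<otimes>\<^bsub>E\<^esub> Y = Y \<otimes>\<^bsub>E\<^esub> Z"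
proof -
  interpret E: group E by fact
  interpret K: group K by fact
  interpret q: group_hom E K q using q grp by (simp add: group_hom_def group_hom_axioms_def)
  interpret R: heisenberg_relations K n "q X" "q B" by unfold_locales (fact rel)
  let ?\<kappa> = "E.conj_by B"
  have YZ: "Y \<in> carrier E" "Z \<in> carrier E"
    using XB by (simp_all add: Y_def Z_def E.conj_by_simps E.commutator_closed)
  have q\<kappa>: "q (?\<kappa> e) = K.conj_by (q B) (q e)" if "e \<in> carrier E" for e
    using that XB by (simp add: E.conj_by_def K.conj_by_def)
  have qY: "q Y = R.Y" unfolding Y_def R.Y_def using q\<kappa> XB by simp
  have qZ: "q Z = R.Z" unfolding Z_def R.Z_def using XB YZ qY by (simp add: commutator_def)
  define A where "A = {c \<in> carrier E. q c = \<one>\<^bsub>K\<^esub>}"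
  have AE: "c \<in> carrier E" if "c \<in> A" for c using that by (simp add: A_def)
  have A_comm: "c \<otimes>\<^bsub>E\<^esub> e = e \<otimes>\<^bsub>E\<^esub> c" if "c \<in> A" "e \<in> carrier E" for c e
    using that by (intro central) (simp_all add: A_def)
  have \<kappa>A: "?\<kappa> c = c" if "c \<in> A" for c
    using A_comm[OF that XB(2)] AE[OF that] XB by (simp add: E.conj_by_def)
  have A_mult: "c \<otimes>\<^bsub>E\<^esub> d \<in> A" "inv\<^bsub>E\<^esub> c \<in> A" if "c \<in> A" "d \<in> A" for c d
    using that by (simp_all add: A_def)
  have diff: "\<exists>c\<in>A. x = y \<otimes>\<^bsub>E\<^esub> c" if "x \<in> carrier E" "y \<in> carrier E" "q x = q y" for x y
    using that by (intro bexI[of _ "inv\<^bsub>E\<^esub> y \<otimes>\<^bsub>E\<^esub> x"]) (simp_all add: A_def)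
  (* The commutator of Z with e is the central element c. *)
  define cf where "cf e c \<longleftrightarrow> c \<in> A \<and> Z \<otimes>\<^bsub>E\<^esub> e = e \<otimes>\<^bsub>E\<^esub> Z \<otimes>\<^bsub>E\<^esub> c" for e c
  have cf_unique: "c = d" if "cf e c" "cf e d" "e \<in> carrier E" for e c d
  proof -
    have "e \<otimes>\<^bsub>E\<^esub> Z \<otimes>\<^bsub>E\<^esub> c = e \<otimes>\<^bsub>E\<^esub> Z \<otimes>\<^bsub>E\<^esub> d" using that by (simp add: cf_def)
    then show ?thesis using that AE YZ by (simp add: cf_def)
  qed
  have cf_mult: "cf (e \<otimes>\<^bsub>E\<^esub> e') (c \<otimes>\<^bsub>E\<^esub> c')" if cc: "cf e c" "cf e' c'" "e \<in> carrier E" "e' \<in> carrier E" for e e' c c'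
  proof -
    have c: "c \<in> A" "c' \<in> A" using cc by (simp_all add: cf_def)
    have "Z \<otimes>\<^bsub>E\<^esub> (e \<otimes>\<^bsub>E\<^esub> e') = e \<otimes>\<^bsub>E\<^esub> Z \<otimes>\<^bsub>E\<^esub> c \<otimes>\<^bsub>E\<^esub> e'"
      using cc YZ by (simp add: cf_def E.m_assoc[symmetric])
    also have "\<dots> = e \<otimes>\<^bsub>E\<^esub> (Z \<otimes>\<^bsub>E\<^esub> e') \<otimes>\<^bsub>E\<^esub> c"
      using A_comm[OF c(1) cc(4)] cc AE[OF c(1)] YZ by (simp add: E.m_assoc)
    also have "Z \<otimes>\<^bsub>E\<^esub> e' = e' \<otimes>\<^bsub>E\<^esub> Z \<otimes>\<^bsub>E\<^esub> c'" using cc by (simp add: cf_def)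
    also have "e \<otimes>\<^bsub>E\<^esub> (e' \<otimes>\<^bsub>E\<^esub> Z \<otimes>\<^bsub>E\<^esub> c') \<otimes>\<^bsub>E\<^esub> c = e \<otimes>\<^bsub>E\<^esub> e' \<otimes>\<^bsub>E\<^esub> Z \<otimes>\<^bsub>E\<^esub> (c' \<otimes>\<^bsub>E\<^esub> c)"
      using cc AE[OF c(1)] AE[OF c(2)] YZ by (simp add: E.m_assoc)
    also have "c' \<otimes>\<^bsub>E\<^esub> c = c \<otimes>\<^bsub>E\<^esub> c'" by (rule A_comm[OF c(2) AE[OF c(1)]])
    finally show ?thesis using A_mult c by (simp add: cf_def)
  qed
  have "q (Z \<otimes>\<^bsub>E\<^esub> X) = q (X \<otimes>\<^bsub>E\<^esub> Z)" "q (Z \<otimes>\<^bsub>E\<^esub> Y) = q (Y \<otimes>\<^bsub>E\<^esub> Z)"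
    using XB YZ R.rels(4,5) by (simp_all add: qY qZ)
  then obtain p r where p: "cf X p" and r: "cf Y r"
    using diff[of "Z \<otimes>\<^bsub>E\<^esub> X" "X \<otimes>\<^bsub>E\<^esub> Z"] diff[of "Z \<otimes>\<^bsub>E\<^esub> Y" "Y \<otimes>\<^bsub>E\<^esub> Z"] XB YZ
    unfolding cf_def by auto
  have pr: "p \<in> A" "r \<in> A" using p r by (simp_all add: cf_def)
  note prE = AE[OF pr(1)] AE[OF pr(2)]
  obtain s where s: "s \<in> A" "?\<kappa> Z = inv\<^bsub>E\<^esub> Z \<otimes>\<^bsub>E\<^esub> s"
  proof -
    have "q (?\<kappa> Z) = q (inv\<^bsub>E\<^esub> Z)"
      using q\<kappa>[OF YZ(2)] R.conj_Z R.nf_inv[of 0 0 1] YZ by (simp add: qZ flip: R.nf_XYZ(3))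
    then show thesis using diff[of "?\<kappa> Z" "inv\<^bsub>E\<^esub> Z"] that XB YZ by (auto simp: E.conj_by_simps)
  qed
  have conj_cf: "cf (?\<kappa> e) (inv\<^bsub>E\<^esub> c)" if c: "cf e c" "e \<in> carrier E" for e c
  proof -
    have cA: "c \<in> A" using c by (simp add: cf_def)
    have cE: "c \<in> carrier E" "s \<in> carrier E" using AE cA s by simp_all
    let ?e = "?\<kappa> e"
    have e: "?e \<in> carrier E" using c XB by (simp add: E.conj_by_simps)
    have "?\<kappa> (Z \<otimes>\<^bsub>E\<^esub> e) = ?\<kappa> (e \<otimes>\<^bsub>E\<^esub> Z \<otimes>\<^bsub>E\<^esub> c)" using c by (simp add: cf_def)
    then have "inv\<^bsub>E\<^esub> Z \<otimes>\<^bsub>E\<^esub> s \<otimes>\<^bsub>E\<^esub> ?e = ?e \<otimes>\<^bsub>E\<^esub> (inv\<^bsub>E\<^esub> Z \<otimes>\<^bsub>E\<^esub> s) \<otimes>\<^bsub>E\<^esub> c"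
      using c(2) XB YZ cE by (simp add: E.conj_by_simps \<kappa>A[OF cA] s(2))
    then have "inv\<^bsub>E\<^esub> Z \<otimes>\<^bsub>E\<^esub> ?e \<otimes>\<^bsub>E\<^esub> s = ?e \<otimes>\<^bsub>E\<^esub> inv\<^bsub>E\<^esub> Z \<otimes>\<^bsub>E\<^esub> c \<otimes>\<^bsub>E\<^esub> s"
      using A_comm[OF s(1) e] A_comm[OF s(1) cE(1)] e cE YZ by (simp add: E.m_assoc)
    then have "inv\<^bsub>E\<^esub> Z \<otimes>\<^bsub>E\<^esub> ?e = ?e \<otimes>\<^bsub>E\<^esub> inv\<^bsub>E\<^esub> Z \<otimes>\<^bsub>E\<^esub> c" using e cE YZ by simp
    then have "Z \<otimes>\<^bsub>E\<^esub> (inv\<^bsub>E\<^esub> Z \<otimes>\<^bsub>E\<^esub> ?e) \<otimes>\<^bsub>E\<^esub> Z \<otimes>\<^bsub>E\<^esub> inv\<^bsub>E\<^esub> c = Z \<otimes>\<^bsub>E\<^esub> (?e \<otimes>\<^bsub>E\<^esub> inv\<^bsub>E\<^esub> Z \<otimes>\<^bsub>E\<^esub> c) \<otimes>\<^bsub>E\<^esub> Z \<otimes>\<^bsub>E\<^esub> inv\<^bsub>E\<^esub> c"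
      by simp
    then have "Z \<otimes>\<^bsub>E\<^esub> ?e = ?e \<otimes>\<^bsub>E\<^esub> Z \<otimes>\<^bsub>E\<^esub> inv\<^bsub>E\<^esub> c"
      using e cE YZ A_comm[OF cA, of "Z \<otimes>\<^bsub>E\<^esub> inv\<^bsub>E\<^esub> c"] by (simp add: E.m_assoc)
    then show ?thesis using A_mult[OF cA cA] by (simp add: cf_def)
  qed
  have "cf Y (inv\<^bsub>E\<^esub> p)" using conj_cf[OF p XB(1)] by (simp add: Y_def)
  then have r_p: "r = inv\<^bsub>E\<^esub> p" using cf_unique r YZ by blast
  have "q (?\<kappa> Y) = q (X \<otimes>\<^bsub>E\<^esub> (Y \<otimes>\<^bsub>E\<^esub> (Y \<otimes>\<^bsub>E\<^esub> Y)))"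
    using q\<kappa>[OF YZ(1)] R.rels(3) XB YZ by (simp add: qY)
  then obtain t where t: "t \<in> A" "?\<kappa> Y = X \<otimes>\<^bsub>E\<^esub> (Y \<otimes>\<^bsub>E\<^esub> (Y \<otimes>\<^bsub>E\<^esub> Y)) \<otimes>\<^bsub>E\<^esub> t"
    using diff[of "?\<kappa> Y" "X \<otimes>\<^bsub>E\<^esub> (Y \<otimes>\<^bsub>E\<^esub> (Y \<otimes>\<^bsub>E\<^esub> Y))"] XB YZ by (auto simp: E.conj_by_simps)
  have "cf t \<one>\<^bsub>E\<^esub>" using A_comm[OF t(1) YZ(2)] AE[OF t(1)] YZ by (simp add: cf_def A_def)
  then have "cf (?\<kappa> Y) (p \<otimes>\<^bsub>E\<^esub> (r \<otimes>\<^bsub>E\<^esub> (r \<otimes>\<^bsub>E\<^esub> r)) \<otimes>\<^bsub>E\<^esub> \<one>\<^bsub>E\<^esub>)"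
    unfolding t(2) using p r XB YZ AE[OF t(1)] by (intro cf_mult) simp_all
  moreover have "cf (?\<kappa> Y) (inv\<^bsub>E\<^esub> r)" by (rule conj_cf[OF r YZ(1)])
  ultimately have "p \<otimes>\<^bsub>E\<^esub> (r \<otimes>\<^bsub>E\<^esub> (r \<otimes>\<^bsub>E\<^esub> r)) \<otimes>\<^bsub>E\<^esub> \<one>\<^bsub>E\<^esub> = inv\<^bsub>E\<^esub> r"
    using cf_unique XB YZ by (meson E.conj_by_simps(1))
  then have "r \<otimes>\<^bsub>E\<^esub> (r \<otimes>\<^bsub>E\<^esub> r) = \<one>\<^bsub>E\<^esub>"
    using prE unfolding r_p
    by (simp add: E.m_assoc)
  then have r3: "r [^]\<^bsub>E\<^esub> (3::nat) = \<one>\<^bsub>E\<^esub>" using prE by (simp add: numeral_3_eq_3 E.m_assoc)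
  have "Z [^]\<^bsub>E\<^esub> m \<otimes>\<^bsub>E\<^esub> Y = Y \<otimes>\<^bsub>E\<^esub> Z [^]\<^bsub>E\<^esub> m \<otimes>\<^bsub>E\<^esub> r [^]\<^bsub>E\<^esub> m" for m :: nat
  proof (induction m)
    case (Suc m)
    have "Z [^]\<^bsub>E\<^esub> Suc m \<otimes>\<^bsub>E\<^esub> Y = Z [^]\<^bsub>E\<^esub> m \<otimes>\<^bsub>E\<^esub> (Z \<otimes>\<^bsub>E\<^esub> Y)" using YZ by (simp add: E.m_assoc)
    also have "Z \<otimes>\<^bsub>E\<^esub> Y = Y \<otimes>\<^bsub>E\<^esub> Z \<otimes>\<^bsub>E\<^esub> r" using r by (simp add: cf_def)
    also have "Z [^]\<^bsub>E\<^esub> m \<otimes>\<^bsub>E\<^esub> (Y \<otimes>\<^bsub>E\<^esub> Z \<otimes>\<^bsub>E\<^esub> r) = (Z [^]\<^bsub>E\<^esub> m \<otimes>\<^bsub>E\<^esub> Y) \<otimes>\<^bsub>E\<^esub> Z \<otimes>\<^bsub>E\<^esub> r"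
      using YZ prE by (simp add: E.m_assoc)
    also have "\<dots> = Y \<otimes>\<^bsub>E\<^esub> Z [^]\<^bsub>E\<^esub> m \<otimes>\<^bsub>E\<^esub> (r [^]\<^bsub>E\<^esub> m \<otimes>\<^bsub>E\<^esub> Z) \<otimes>\<^bsub>E\<^esub> r"
      unfolding Suc using YZ prE by (simp add: E.m_assoc)
    also have "r [^]\<^bsub>E\<^esub> m \<otimes>\<^bsub>E\<^esub> Z = Z \<otimes>\<^bsub>E\<^esub> r [^]\<^bsub>E\<^esub> m"
    proof -
      have "r [^]\<^bsub>E\<^esub> m \<in> A" using pr(2) by (simp add: A_def q.hom_nat_pow)
      then show ?thesis using A_comm YZ by blast
    qed
    finally show ?case using YZ prE by (simp add: E.m_assoc)
  qed (use YZ in simp)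
  from this[of "n * n"]
  have "Z [^]\<^bsub>E\<^esub> (n * n) \<otimes>\<^bsub>E\<^esub> Y = Y \<otimes>\<^bsub>E\<^esub> Z [^]\<^bsub>E\<^esub> (n * n) \<otimes>\<^bsub>E\<^esub> r [^]\<^bsub>E\<^esub> (n * n)" .
  moreover have "Z [^]\<^bsub>E\<^esub> (n * n) \<in> A" using YZ R.rels(6) by (simp add: A_def q.hom_nat_pow qZ)
  ultimately have "r [^]\<^bsub>E\<^esub> (n * n) = \<one>\<^bsub>E\<^esub>"
    using A_comm[of "Z [^]\<^bsub>E\<^esub> (n * n)" Y] YZ prE by simp
  then have "r = \<one>\<^bsub>E\<^esub>" using E.bezout_power_one[OF uv prE(2) r3] by blast
  moreover from this have "p = \<one>\<^bsub>E\<^esub>" using r_p prE(1) by simp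
  ultimately show "Z \<otimes>\<^bsub>E\<^esub> X = X \<otimes>\<^bsub>E\<^esub> Z" "Z \<otimes>\<^bsub>E\<^esub> Y = Y \<otimes>\<^bsub>E\<^esub> Z"
    using p r XB YZ by (simp_all add: cf_def)
qed

text \<open>
  Let \<open>X\<close> be any lift of \<open>x\<close>. There are central errors \<open>t\<close> in \<open>Y^B = X Y\<^sup>3 t\<close> and \<open>c\<close> in \<open>a = X^n Z^(n(n-1)/2) c\<close>. The relation
  \<open>[a, a^B] = 1\<close> yields \<open>Z^(n\<^sup>2) = 1\<close>, and \<open>a^(B\<^sup>2) = a a^(3B)\<close> yields \<open>t^n = c\<^sup>3\<close>. Replacing \<open>X\<close> by \<open>X e\<close> with \<open>e\<close>
  central changes \<open>t\<close> by \<open>e^(-3)\<close> and \<open>c\<close> by \<open>e^(-n)\<close>, so both errors vanish for \<open>e = t^v c^u\<close>, where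
  \<open>u n + 3 v = 1\<close>.
\<close>

lemma heisenberg_rel_central_lift:
  assumes grp: "group E" "group K"
    and q: "q \<in> hom E K" "q ` carrier E = carrier K"
    and central: "\<And>c e. c \<in> carrier E \<Longrightarrow> q c = \<one>\<^bsub>K\<^esub> \<Longrightarrow> e \<in> carrier E \<Longrightarrow> c \<otimes>\<^bsub>E\<^esub> e = e \<otimes>\<^bsub>E\<^esub> c"
    and rel: "heisenberg_rel K n x (q B)" and a: "heisenberg_rel E 1 a B"
    and qa: "q a = x [^]\<^bsub>K\<^esub> n \<otimes>\<^bsub>K\<^esub> commutator K x (group.conj_by K (q B) x) [^]\<^bsub>K\<^esub> triangular n"
    and uv: "u * int n + 3 * v = 1"
  obtains X where "heisenberg_rel E n X B" "q X = x"
    "X [^]\<^bsub>E\<^esub> n \<otimes>\<^bsub>E\<^esub> commutator E X (group.conj_by E B X) [^]\<^bsub>E\<^esub> triangular n = a"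
proof -
  interpret E: group E by fact
  interpret K: group K by fact
  interpret q: group_hom E K q using q(1) grp by (simp add: group_hom_def group_hom_axioms_def)
  interpret a: heisenberg_relations E 1 a B by unfold_locales (fact a)
  have B: "B \<in> carrier E" by (rule a.rels(2))
  obtain X where X: "X \<in> carrier E" "q X = x"
  proof -
    have "x \<in> q ` carrier E" using rel by (simp add: q(2) heisenberg_rel_def)
    then show thesis using that by blast
  qed
  interpret R: heisenberg_relations K n "q X" "q B" by unfold_locales (use rel X in simp)
  let ?\<kappa> = "E.conj_by B"
  define Y where "Y = ?\<kappa> X"
  define Z where "Z = commutator E X Y"
  have YZ: "Y \<in> carrier E" "Z \<in> carrier E"
    using X B by (simp_all add: Y_def Z_def E.conj_by_simps E.commutator_closed)
  have ZXY: "Z \<otimes>\<^bsub>E\<^esub> X = X \<otimes>\<^bsub>E\<^esub> Z" "Z \<otimes>\<^bsub>E\<^esub> Y = Y \<otimes>\<^bsub>E\<^esub> Z"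
    unfolding Z_def Y_def
    by (rule central_lift_commutes[OF grp q(1) central _ X(1) B uv], assumption+,
        simp add: X(2) rel)+
  interpret T: heisenberg_triple E X Y Z
    unfolding Z_def by (rule E.heisenberg_triple_commutator[OF X(1) YZ(1) ZXY[unfolded Z_def]])
  have q\<kappa>: "q (?\<kappa> e) = K.conj_by (q B) (q e)" if "e \<in> carrier E" for e
    using that B by (simp add: E.conj_by_def K.conj_by_def)
  have qY: "q Y = R.Y" unfolding Y_def R.Y_def using q\<kappa> X by simp
  have qZ: "q Z = R.Z" unfolding Z_def R.Z_def using X YZ qY by (simp add: commutator_def)
  define A where "A = E\<lparr>carrier := {c \<in> carrier E. q c = \<one>\<^bsub>K\<^esub>}\<rparr>"
  have subA: "subgroup {c \<in> carrier E. q c = \<one>\<^bsub>K\<^esub>} E" by (rule E.subgroupI) auto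
  have A: "c \<in> carrier A \<longleftrightarrow> c \<in> carrier E \<and> q c = \<one>\<^bsub>K\<^esub>" for c by (simp add: A_def)
  have "group A" unfolding A_def by (rule E.subgroup_imp_group[OF subA])
  then interpret A: comm_group A
    by (rule group.group_comm_groupI) (use central in \<open>auto simp: A_def\<close>)
  have A_ops: "c \<otimes>\<^bsub>A\<^esub> d = c \<otimes>\<^bsub>E\<^esub> d" "\<one>\<^bsub>A\<^esub> = \<one>\<^bsub>E\<^esub>" "c [^]\<^bsub>A\<^esub> (m::nat) = c [^]\<^bsub>E\<^esub> m" for c d m
    by (simp_all add: A_def nat_pow_def)
  have A_comm: "c \<otimes>\<^bsub>E\<^esub> e = e \<otimes>\<^bsub>E\<^esub> c" if "c \<in> carrier A" "e \<in> carrier E" for c e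
    using that by (intro central) (simp_all add: A)
  have AE: "c \<in> carrier E" if "c \<in> carrier A" for c using that by (simp add: A)
  have \<kappa>A: "?\<kappa> c = c" if "c \<in> carrier A" for c
    using A_comm[OF that B] AE[OF that] B by (simp add: E.conj_by_def)
  have diff: "\<exists>c\<in>carrier A. e = d \<otimes>\<^bsub>E\<^esub> c" if "e \<in> carrier E" "d \<in> carrier E" "q e = q d" for e d
    using that by (intro bexI[of _ "inv\<^bsub>E\<^esub> d \<otimes>\<^bsub>E\<^esub> e"]) (simp_all add: A)
  have mult: "(e \<otimes>\<^bsub>E\<^esub> c) \<otimes>\<^bsub>E\<^esub> (e' \<otimes>\<^bsub>E\<^esub> c') = (e \<otimes>\<^bsub>E\<^esub> e') \<otimes>\<^bsub>E\<^esub> (c \<otimes>\<^bsub>A\<^esub> c')"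
    if "c \<in> carrier A" "c' \<in> carrier A" "e \<in> carrier E" "e' \<in> carrier E" for e e' c c'
    unfolding A_ops using that A_comm AE by (intro E.central_mult_simps) auto
  have cancel: "c = c'" if "e \<otimes>\<^bsub>E\<^esub> c = e \<otimes>\<^bsub>E\<^esub> c'" "c \<in> carrier A" "c' \<in> carrier A" "e \<in> carrier E" for e c c'
    using that AE by simp
  have powA: "(e \<otimes>\<^bsub>E\<^esub> c) [^]\<^bsub>E\<^esub> m = e [^]\<^bsub>E\<^esub> m \<otimes>\<^bsub>E\<^esub> c [^]\<^bsub>A\<^esub> m"
    if "c \<in> carrier A" "e \<in> carrier E" for e c and m :: nat
    by (induction m) (use that mult in \<open>simp_all add: A_ops(2)\<close>)
  have "q (?\<kappa> Y) = q (X \<otimes>\<^bsub>E\<^esub> (Y \<otimes>\<^bsub>E\<^esub> (Y \<otimes>\<^bsub>E\<^esub> Y)))"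
    using q\<kappa>[OF YZ(1)] R.rels(3) X YZ by (simp add: qY)
  then obtain t where t: "t \<in> carrier A" "?\<kappa> Y = X \<otimes>\<^bsub>E\<^esub> (Y \<otimes>\<^bsub>E\<^esub> (Y \<otimes>\<^bsub>E\<^esub> Y)) \<otimes>\<^bsub>E\<^esub> t"
    using diff[of "?\<kappa> Y" "X \<otimes>\<^bsub>E\<^esub> (Y \<otimes>\<^bsub>E\<^esub> (Y \<otimes>\<^bsub>E\<^esub> Y))"] X B YZ by (auto simp: E.conj_by_simps)
  have \<kappa>Y: "?\<kappa> Y = T.nf 1 3 0 \<otimes>\<^bsub>E\<^esub> t"
    unfolding t(2) by (simp add: T.nf_generator_mult T.nf_generator_square)
  have \<kappa>Z: "?\<kappa> Z = T.nf 0 0 (- 1)"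
  proof -
    have "?\<kappa> Z = ?\<kappa> (commutator E X Y)" by (simp only: Z_def)
    also have "\<dots> = commutator E Y (T.nf 1 3 0 \<otimes>\<^bsub>E\<^esub> t)"
      using E.conj_by_simps(6)[OF B X(1) YZ(1)] \<kappa>Y by (simp only: Y_def[symmetric])
    also have "\<dots> = T.nf 0 0 (- 1)"
    proof (rule E.commutator_eqI)
      have "Y \<otimes>\<^bsub>E\<^esub> (T.nf 1 3 0 \<otimes>\<^bsub>E\<^esub> t) = T.nf 1 4 (- 1) \<otimes>\<^bsub>E\<^esub> t"
        using E.m_assoc[OF YZ(1) T.nf_closed AE[OF t(1)], symmetric] by (simp add: T.nf_generator_mult)
      also have "\<dots> = T.nf 1 3 0 \<otimes>\<^bsub>E\<^esub> (T.nf 0 1 (- 1) \<otimes>\<^bsub>E\<^esub> t)"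
        using E.m_assoc[OF T.nf_closed T.nf_closed AE[OF t(1)]] by (simp flip: E.m_assoc add: T.nf_mult AE[OF t(1)])
      also have "T.nf 0 1 (- 1) \<otimes>\<^bsub>E\<^esub> t = t \<otimes>\<^bsub>E\<^esub> (Y \<otimes>\<^bsub>E\<^esub> T.nf 0 0 (- 1))"
        using A_comm[OF t(1)] by (simp add: T.nf_generator_mult)
      finally show "Y \<otimes>\<^bsub>E\<^esub> (T.nf 1 3 0 \<otimes>\<^bsub>E\<^esub> t) =
          T.nf 1 3 0 \<otimes>\<^bsub>E\<^esub> t \<otimes>\<^bsub>E\<^esub> Y \<otimes>\<^bsub>E\<^esub> T.nf 0 0 (- 1)"
        using YZ AE[OF t(1)] by (simp add: E.m_assoc)
    qed (use YZ AE[OF t(1)] in simp_all)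
    finally show ?thesis .
  qed
  let ?\<tau> = "triangular n"
  have "q (T.nf (int n) 0 ?\<tau>) = x [^]\<^bsub>K\<^esub> n \<otimes>\<^bsub>K\<^esub> R.Z [^]\<^bsub>K\<^esub> ?\<tau>"
    unfolding T.nf_def using X YZ
    by (simp add: q.hom_int_pow q.hom_nat_pow qZ int_pow_int)
  moreover have "q a = x [^]\<^bsub>K\<^esub> n \<otimes>\<^bsub>K\<^esub> R.Z [^]\<^bsub>K\<^esub> ?\<tau>"
    unfolding R.Z_def R.Y_def unfolding X(2) by (rule qa)
  ultimately have "q a = q (T.nf (int n) 0 ?\<tau>)" by (simp only:)
  then obtain c where c: "c \<in> carrier A" "a = T.nf (int n) 0 ?\<tau> \<otimes>\<^bsub>E\<^esub> c"
    using diff[of a "T.nf (int n) 0 ?\<tau>"] a.rels(1) by auto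
  have \<kappa>nf: "?\<kappa> (T.nf i (int j) k) = T.nf (int j) (i + 3 * int j) (- k - 3 * triangular j - i * int j) \<otimes>\<^bsub>E\<^esub> t [^]\<^bsub>A\<^esub> j"
    for i k and j :: nat
  proof -
    have "?\<kappa> (T.nf i (int j) k) = Y [^]\<^bsub>E\<^esub> i \<otimes>\<^bsub>E\<^esub> (T.nf 1 3 0 [^]\<^bsub>E\<^esub> j \<otimes>\<^bsub>E\<^esub> t [^]\<^bsub>A\<^esub> j) \<otimes>\<^bsub>E\<^esub> T.nf 0 0 (- 1) [^]\<^bsub>E\<^esub> k"
      unfolding T.nf_def[of i] using X(1) B YZ powA[OF t(1) T.nf_closed]
      by (simp add: E.conj_by_simps int_pow_int \<kappa>Y \<kappa>Z flip: Y_def)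
    also have "T.nf 0 0 (- 1) [^]\<^bsub>E\<^esub> k = T.nf 0 0 (- k)"
      using E.int_pow_pow[of Z "- 1" k] YZ by (simp flip: T.nf_Z_pow add: E.int_pow_neg)
    also have "Y [^]\<^bsub>E\<^esub> i \<otimes>\<^bsub>E\<^esub> (T.nf 1 3 0 [^]\<^bsub>E\<^esub> j \<otimes>\<^bsub>E\<^esub> t [^]\<^bsub>A\<^esub> j) \<otimes>\<^bsub>E\<^esub> T.nf 0 0 (- k) =
        T.nf 0 i 0 \<otimes>\<^bsub>E\<^esub> (T.nf 1 3 0 [^]\<^bsub>E\<^esub> j \<otimes>\<^bsub>E\<^esub> T.nf 0 0 (- k)) \<otimes>\<^bsub>E\<^esub> t [^]\<^bsub>A\<^esub> j"
      using A_comm[of "t [^]\<^bsub>A\<^esub> j" "T.nf 0 0 (- k)"] t(1) AE YZ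
      by (simp add: E.m_assoc T.nf_Z_pow)
    finally show ?thesis by (simp add: T.nf_pow T.nf_mult algebra_simps)
  qed
  have aY: "a.Y = T.nf 0 (int n) (- ?\<tau>) \<otimes>\<^bsub>E\<^esub> c"
    unfolding a.Y_def unfolding c(2) using \<kappa>nf[of "int n" 0 ?\<tau>] B AE[OF c(1)]
    by (simp add: E.conj_by_simps \<kappa>A[OF c(1)] A_ops(2))
  have Z_order: "Z [^]\<^bsub>E\<^esub> (n * n) = \<one>\<^bsub>E\<^esub>"
  proof -
    have "a \<otimes>\<^bsub>E\<^esub> a.Y = a.Y \<otimes>\<^bsub>E\<^esub> a \<otimes>\<^bsub>E\<^esub> a.Z" by (rule a.XY)
    also have "a.Z = \<one>\<^bsub>E\<^esub>" using a.rels(6) by simp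
    finally have "a \<otimes>\<^bsub>E\<^esub> a.Y = a.Y \<otimes>\<^bsub>E\<^esub> a" by simp
    then have "T.nf (int n) (int n) 0 \<otimes>\<^bsub>E\<^esub> (c \<otimes>\<^bsub>A\<^esub> c) = T.nf (int n) (int n) (- (int n * int n)) \<otimes>\<^bsub>E\<^esub> (c \<otimes>\<^bsub>A\<^esub> c)"
      unfolding aY unfolding c(2) by (simp add: mult c(1) T.nf_mult)
    then have "T.nf (int n) (int n) 0 = T.nf (int n) (int n) (- (int n * int n))"
      using AE[OF A.m_closed[OF c(1) c(1)]] by simp
    then have "T.nf (- int n) (- int n) (- (int n * int n)) \<otimes>\<^bsub>E\<^esub> T.nf (int n) (int n) (int n * int n) =
        T.nf (- int n) (- int n) (- (int n * int n)) \<otimes>\<^bsub>E\<^esub> T.nf (int n) (int n) 0"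
      using T.nf_mult[of "int n" "int n" 0 0 0 "int n * int n"]
        T.nf_mult[of "int n" "int n" "- (int n * int n)" 0 0 "int n * int n"] by simp
    then show ?thesis by (simp add: T.nf_mult T.nf_Z_nat_pow)
  qed
  have tc: "t [^]\<^bsub>A\<^esub> n = c [^]\<^bsub>A\<^esub> (3::nat)"
  proof -
    have "?\<kappa> a.Y = a \<otimes>\<^bsub>E\<^esub> (a.Y \<otimes>\<^bsub>E\<^esub> (a.Y \<otimes>\<^bsub>E\<^esub> a.Y))" by (rule a.rels(3))
    moreover have "?\<kappa> a.Y = T.nf (int n) (3 * int n) (- 2 * ?\<tau>) \<otimes>\<^bsub>E\<^esub> (t [^]\<^bsub>A\<^esub> n \<otimes>\<^bsub>A\<^esub> c)"
      unfolding aY using \<kappa>nf[of 0 n "- ?\<tau>"] B AE[OF c(1)] AE[OF A.nat_pow_closed[OF t(1)]]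
      by (simp add: E.conj_by_simps \<kappa>A[OF c(1)] A_ops(1) E.m_assoc)
    moreover have "a \<otimes>\<^bsub>E\<^esub> (a.Y \<otimes>\<^bsub>E\<^esub> (a.Y \<otimes>\<^bsub>E\<^esub> a.Y)) =
        T.nf (int n) (3 * int n) (- 2 * ?\<tau>) \<otimes>\<^bsub>E\<^esub> (c \<otimes>\<^bsub>A\<^esub> (c \<otimes>\<^bsub>A\<^esub> (c \<otimes>\<^bsub>A\<^esub> c)))"
      unfolding aY unfolding c(2) by (simp add: mult c(1) T.nf_mult)
    ultimately have "T.nf (int n) (3 * int n) (- 2 * ?\<tau>) \<otimes>\<^bsub>E\<^esub> (t [^]\<^bsub>A\<^esub> n \<otimes>\<^bsub>A\<^esub> c) =
        T.nf (int n) (3 * int n) (- 2 * ?\<tau>) \<otimes>\<^bsub>E\<^esub> (c \<otimes>\<^bsub>A\<^esub> (c \<otimes>\<^bsub>A\<^esub> (c \<otimes>\<^bsub>A\<^esub> c)))"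
      by (simp only:)
    then have "t [^]\<^bsub>A\<^esub> n \<otimes>\<^bsub>A\<^esub> c = c \<otimes>\<^bsub>A\<^esub> (c \<otimes>\<^bsub>A\<^esub> (c \<otimes>\<^bsub>A\<^esub> c))"
      by (rule cancel) (use c(1) t(1) in simp_all)
    then have "t [^]\<^bsub>A\<^esub> n \<otimes>\<^bsub>A\<^esub> c = (c \<otimes>\<^bsub>A\<^esub> (c \<otimes>\<^bsub>A\<^esub> c)) \<otimes>\<^bsub>A\<^esub> c" using c(1) by (simp add: A.m_assoc)
    then have "t [^]\<^bsub>A\<^esub> n = c \<otimes>\<^bsub>A\<^esub> (c \<otimes>\<^bsub>A\<^esub> c)"
      using A.right_cancel[of c "t [^]\<^bsub>A\<^esub> n" "c \<otimes>\<^bsub>A\<^esub> (c \<otimes>\<^bsub>A\<^esub> c)"] c(1) t(1) by simp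
    then show ?thesis using c(1) by (simp add: numeral_3_eq_3 A.m_assoc)
  qed
  define e where "e = t [^]\<^bsub>A\<^esub> v \<otimes>\<^bsub>A\<^esub> c [^]\<^bsub>A\<^esub> u"
  have eA: "e \<in> carrier A" using t(1) c(1) by (simp add: e_def)
  have tc': "t [^]\<^bsub>A\<^esub> (int n * k) = c [^]\<^bsub>A\<^esub> (3 * k)" for k :: int
    using A.int_pow_pow[OF t(1), of "int n" k] A.int_pow_pow[OF c(1), of "int 3" k] tc
    by (simp add: int_pow_int flip: int_pow_int)
  have e3: "e [^]\<^bsub>A\<^esub> (3::int) = t"
  proof -
    have "e [^]\<^bsub>A\<^esub> (3::int) = t [^]\<^bsub>A\<^esub> (v * 3) \<otimes>\<^bsub>A\<^esub> c [^]\<^bsub>A\<^esub> (u * 3)"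
      unfolding e_def using t(1) c(1) by (simp add: A.int_pow_distrib A.int_pow_pow)
    also have "c [^]\<^bsub>A\<^esub> (u * 3) = t [^]\<^bsub>A\<^esub> (int n * u)" using tc'[of u] by (simp add: mult.commute)
    also have "t [^]\<^bsub>A\<^esub> (v * 3) \<otimes>\<^bsub>A\<^esub> t [^]\<^bsub>A\<^esub> (int n * u) = t [^]\<^bsub>A\<^esub> (1::int)"
      using uv A.int_pow_mult[OF t(1), of "v * 3" "int n * u"] by (simp add: algebra_simps)
    finally show ?thesis using t(1) by simp
  qed
  have en: "e [^]\<^bsub>A\<^esub> int n = c"
  proof -
    have "e [^]\<^bsub>A\<^esub> int n = t [^]\<^bsub>A\<^esub> (v * int n) \<otimes>\<^bsub>A\<^esub> c [^]\<^bsub>A\<^esub> (u * int n)"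
      unfolding e_def using t(1) c(1) by (simp add: A.int_pow_distrib A.int_pow_pow)
    also have "t [^]\<^bsub>A\<^esub> (v * int n) = c [^]\<^bsub>A\<^esub> (3 * v)" using tc'[of v] by (simp add: mult.commute)
    also have "c [^]\<^bsub>A\<^esub> (3 * v) \<otimes>\<^bsub>A\<^esub> c [^]\<^bsub>A\<^esub> (u * int n) = c [^]\<^bsub>A\<^esub> (1::int)"
      using uv A.int_pow_mult[OF c(1), of "3 * v" "u * int n"] by (simp add: algebra_simps)
    finally show ?thesis using c(1) by simp
  qed
  define X' where "X' = X \<otimes>\<^bsub>E\<^esub> e"
  have X': "X' \<in> carrier E" using X AE[OF eA] by (simp add: X'_def)
  have Y': "?\<kappa> X' = Y \<otimes>\<^bsub>E\<^esub> e"
    unfolding X'_def using X B AE[OF eA] \<kappa>A[OF eA] by (simp add: E.conj_by_simps Y_def)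
  have Z': "commutator E X' (Y \<otimes>\<^bsub>E\<^esub> e) = Z"
  proof (rule E.commutator_eqI)
    show "X' \<otimes>\<^bsub>E\<^esub> (Y \<otimes>\<^bsub>E\<^esub> e) = Y \<otimes>\<^bsub>E\<^esub> e \<otimes>\<^bsub>E\<^esub> X' \<otimes>\<^bsub>E\<^esub> Z"
    proof -
      have ee: "e \<otimes>\<^bsub>A\<^esub> e \<in> carrier A" using eA by simp
      have "(X \<otimes>\<^bsub>E\<^esub> e) \<otimes>\<^bsub>E\<^esub> (Y \<otimes>\<^bsub>E\<^esub> e) = Y \<otimes>\<^bsub>E\<^esub> X \<otimes>\<^bsub>E\<^esub> (Z \<otimes>\<^bsub>E\<^esub> (e \<otimes>\<^bsub>A\<^esub> e))"
        unfolding mult[OF eA eA X(1) YZ(1)] T.XY using X(1) YZ AE[OF ee] by (simp add: E.m_assoc)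
      also have "Z \<otimes>\<^bsub>E\<^esub> (e \<otimes>\<^bsub>A\<^esub> e) = (e \<otimes>\<^bsub>A\<^esub> e) \<otimes>\<^bsub>E\<^esub> Z" using A_comm[OF ee YZ(2)] by simp
      also have "Y \<otimes>\<^bsub>E\<^esub> X \<otimes>\<^bsub>E\<^esub> ((e \<otimes>\<^bsub>A\<^esub> e) \<otimes>\<^bsub>E\<^esub> Z) = (Y \<otimes>\<^bsub>E\<^esub> X \<otimes>\<^bsub>E\<^esub> (e \<otimes>\<^bsub>A\<^esub> e)) \<otimes>\<^bsub>E\<^esub> Z"
        using X(1) YZ AE[OF ee] by (simp add: E.m_assoc)
      finally show ?thesis unfolding X'_def mult[OF eA eA YZ(1) X(1)] .
    qed
  qed (use X' YZ AE[OF eA] in simp_all)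
  have "heisenberg_rel E n X' B"
  proof -
    have "?\<kappa> (Y \<otimes>\<^bsub>E\<^esub> e) = T.nf 1 3 0 \<otimes>\<^bsub>E\<^esub> (t \<otimes>\<^bsub>A\<^esub> e)"
      using YZ B AE[OF eA] AE[OF t(1)] \<kappa>A[OF eA] \<kappa>Y by (simp add: E.conj_by_simps E.m_assoc A_ops(1))
    also have "t = e \<otimes>\<^bsub>A\<^esub> (e \<otimes>\<^bsub>A\<^esub> e)"
    proof -
      have "t = e [^]\<^bsub>A\<^esub> (3::nat)" using e3 int_pow_int[of A e 3] by simp
      then show ?thesis using eA by (simp add: numeral_3_eq_3 A.m_assoc)
    qed
    also have "T.nf 1 3 0 \<otimes>\<^bsub>E\<^esub> (e \<otimes>\<^bsub>A\<^esub> (e \<otimes>\<^bsub>A\<^esub> e) \<otimes>\<^bsub>A\<^esub> e) =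
        X' \<otimes>\<^bsub>E\<^esub> (Y \<otimes>\<^bsub>E\<^esub> e \<otimes>\<^bsub>E\<^esub> (Y \<otimes>\<^bsub>E\<^esub> e \<otimes>\<^bsub>E\<^esub> (Y \<otimes>\<^bsub>E\<^esub> e)))"
      unfolding X'_def using X YZ eA
      by (simp add: mult A.m_assoc T.nf_generator_mult T.nf_generator_square)
    finally have conj: "inv\<^bsub>E\<^esub> B \<otimes>\<^bsub>E\<^esub> (Y \<otimes>\<^bsub>E\<^esub> e \<otimes>\<^bsub>E\<^esub> B) =
        X' \<otimes>\<^bsub>E\<^esub> (Y \<otimes>\<^bsub>E\<^esub> e \<otimes>\<^bsub>E\<^esub> (Y \<otimes>\<^bsub>E\<^esub> e \<otimes>\<^bsub>E\<^esub> (Y \<otimes>\<^bsub>E\<^esub> e)))"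
      by (simp only: E.conj_by_def)
    have comm: "Z \<otimes>\<^bsub>E\<^esub> (w \<otimes>\<^bsub>E\<^esub> e) = w \<otimes>\<^bsub>E\<^esub> e \<otimes>\<^bsub>E\<^esub> Z"
      if "w \<in> carrier E" "Z \<otimes>\<^bsub>E\<^esub> w = w \<otimes>\<^bsub>E\<^esub> Z" for w
    proof -
      have "Z \<otimes>\<^bsub>E\<^esub> (w \<otimes>\<^bsub>E\<^esub> e) = w \<otimes>\<^bsub>E\<^esub> (Z \<otimes>\<^bsub>E\<^esub> e)"
        using that YZ AE[OF eA] by (simp flip: E.m_assoc)
      also have "Z \<otimes>\<^bsub>E\<^esub> e = e \<otimes>\<^bsub>E\<^esub> Z" using A_comm[OF eA YZ(2)] by simp
      finally show ?thesis using that YZ AE[OF eA] by (simp add: E.m_assoc)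
    qed
    show ?thesis
      unfolding heisenberg_rel_def Let_def Y'[unfolded E.conj_by_def] Z'
      using X' B conj comm[OF X(1) ZXY(1)] comm[OF YZ(1) ZXY(2)] Z_order by (simp add: X'_def)
  qed
  moreover have "q X' = x" using X AE[OF eA] eA by (simp add: X'_def A) (use rel in \<open>simp add: heisenberg_rel_def\<close>)
  moreover have "X' [^]\<^bsub>E\<^esub> n \<otimes>\<^bsub>E\<^esub> commutator E X' (?\<kappa> X') [^]\<^bsub>E\<^esub> ?\<tau> = a"
  proof -
    have "X' [^]\<^bsub>E\<^esub> n = T.nf (int n) 0 0 \<otimes>\<^bsub>E\<^esub> c"
      unfolding X'_def using powA[OF eA X(1), of n] en by (simp add: int_pow_int T.nf_Z_nat_pow)
    then have "X' [^]\<^bsub>E\<^esub> n \<otimes>\<^bsub>E\<^esub> Z [^]\<^bsub>E\<^esub> ?\<tau> = T.nf (int n) 0 0 \<otimes>\<^bsub>E\<^esub> (c \<otimes>\<^bsub>E\<^esub> T.nf 0 0 ?\<tau>)"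
      using AE[OF c(1)] by (simp add: E.m_assoc T.nf_Z_pow)
    also have "c \<otimes>\<^bsub>E\<^esub> T.nf 0 0 ?\<tau> = T.nf 0 0 ?\<tau> \<otimes>\<^bsub>E\<^esub> c" by (rule A_comm[OF c(1) T.nf_closed])
    finally show ?thesis
      unfolding Y' Z' c(2) using AE[OF c(1)] by (simp add: T.nf_mult flip: E.m_assoc)
  qed
  ultimately show thesis by (rule that)
qed

subsection \<open>The presented Heisenberg extensions\<close>

(* The generators are the letters 0 and 1, which are to keep this form. *)
declare One_nat_def [simp del]

definition word_power :: "'x word \<Rightarrow> nat \<Rightarrow> 'x word" where "word_power u n = concat (replicate n u)"

lemma words_word_power [simp]: "u \<in> words S \<Longrightarrow> word_power u n \<in> words S"
  by (induction n) (simp_all add: word_power_def)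

lemma (in group) word_value_power:
  assumes "\<And>x. x \<in> S \<Longrightarrow> \<xi> x \<in> carrier G" "u \<in> words S"
  shows "word_value G \<xi> (word_power u n) = word_value G \<xi> u [^] n"
proof (induction n)
  case (Suc n)
  have "word_value G \<xi> (word_power u (Suc n)) = word_value G \<xi> u \<otimes> word_value G \<xi> (word_power u n)"
    using word_value_append[OF assms(1) assms(2) words_word_power[OF assms(2), of n]]
    by (simp add: word_power_def)
  also have "\<dots> = word_value G \<xi> u [^] Suc n"
    unfolding Suc using nat_pow_Suc2[OF word_value_closed[OF assms(1) assms(2)]] by simp
  finally show ?case .
qed (simp add: word_power_def)

definition H_relators :: "(nat word \<times> nat word) set"
  where "H_relators = (let a = [(0, True)]; b = [(1, True)] in
    {(word_conj a (b @ b), a @ word_conj (a @ a @ a) b), (word_comm a (word_conj a b), [])})"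

lemma H_group_eq: "H_group = presented_group {0, 1} H_relators"
  by (simp add: H_group_def H_relators_def Let_def)

definition K_relators :: "nat \<Rightarrow> (nat word \<times> nat word) set"
  where "K_relators n =
    (let x = [(0, True)]; b = [(1, True)]; y = word_conj x b; z = word_comm x y in
    {(word_conj x (b @ b), x @ word_conj (x @ x @ x) b), (z @ x, x @ z), (z @ y, y @ z),
     (word_power z (n * n), [])})"

abbreviation K_group :: "nat \<Rightarrow> nat word set monoid" where "K_group n \<equiv> presented_group {0, 1} (K_relators n)"

lemma relators_words:
  "finite H_relators" "H_relators \<subseteq> words {0, 1} \<times> words {0, 1}"
  "finite (K_relators n)" "K_relators n \<subseteq> words {0, 1} \<times> words {0, 1}"
  by (simp_all add: H_relators_def K_relators_def Let_def)

context group
begin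

context
  fixes \<xi> :: "nat \<Rightarrow> 'a"
  assumes \<xi>: "\<xi> 0 \<in> carrier G" "\<xi> 1 \<in> carrier G"
begin

lemma \<xi>_closed: "i \<in> {0, 1} \<Longrightarrow> \<xi> i \<in> carrier G" using \<xi> by auto

lemma first_relator_value:
  "word_value G \<xi> (word_conj [(0, True)] ([(1, True)] @ [(1, True)])) =
      conj_by (\<xi> 1) (conj_by (\<xi> 1) (\<xi> 0))"
  "word_value G \<xi> ([(0, True)] @ word_conj ([(0, True)] @ [(0, True)] @ [(0, True)]) [(1, True)]) =
      \<xi> 0 \<otimes> (conj_by (\<xi> 1) (\<xi> 0) \<otimes> (conj_by (\<xi> 1) (\<xi> 0) \<otimes> conj_by (\<xi> 1) (\<xi> 0)))"
  "word_value G \<xi> (word_conj [(0, True)] [(1, True)]) = conj_by (\<xi> 1) (\<xi> 0)"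
proof -
  have conj: "word_value G \<xi> (word_conj u v) = conj_by (word_value G \<xi> v) (word_value G \<xi> u)"
    if "u \<in> words {0, 1}" "v \<in> words {0, 1}" for u v
    using word_value_conj[of "{0, 1}" \<xi> u v] \<xi>_closed that unfolding conj_by_def by blast
  show "word_value G \<xi> (word_conj [(0, True)] ([(1, True)] @ [(1, True)])) =
      conj_by (\<xi> 1) (conj_by (\<xi> 1) (\<xi> 0))"
    using \<xi> by (subst conj) (simp_all add: conj_by_def word_simps)
  show "word_value G \<xi> (word_conj [(0, True)] [(1, True)]) = conj_by (\<xi> 1) (\<xi> 0)"
    using \<xi> by (subst conj) simp_all
  have "word_value G \<xi> (word_conj ([(0, True)] @ [(0, True)] @ [(0, True)]) [(1, True)]) =
      conj_by (\<xi> 1) (\<xi> 0) \<otimes> (conj_by (\<xi> 1) (\<xi> 0) \<otimes> conj_by (\<xi> 1) (\<xi> 0))"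
    using \<xi> by (subst conj) (simp_all add: conj_by_def word_simps)
  then show "word_value G \<xi> ([(0, True)] @ word_conj ([(0, True)] @ [(0, True)] @ [(0, True)]) [(1, True)]) =
      \<xi> 0 \<otimes> (conj_by (\<xi> 1) (\<xi> 0) \<otimes> (conj_by (\<xi> 1) (\<xi> 0) \<otimes> conj_by (\<xi> 1) (\<xi> 0)))"
    using \<xi> by simp
qed

lemma K_relators_hold_iff:
  "(\<forall>(u, v)\<in>K_relators n. word_value G \<xi> u = word_value G \<xi> v) \<longleftrightarrow> heisenberg_rel G n (\<xi> 0) (\<xi> 1)"
proof -
  let ?x = "[(0, True)] :: nat word" let ?y = "word_conj ?x [(1, True)]"
  let ?z = "word_comm ?x ?y" let ?Y = "conj_by (\<xi> 1) (\<xi> 0)" let ?Z = "commutator G (\<xi> 0) ?Y"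
  have "word_value G \<xi> ?x = \<xi> 0" using \<xi> by simp
  moreover have "word_value G \<xi> ?z = ?Z"
    using \<xi> word_value_comm[of "{0, 1}" \<xi> ?x ?y] \<xi>_closed first_relator_value(3) by simp
  ultimately have "word_value G \<xi> (?z @ ?x) = ?Z \<otimes> \<xi> 0" "word_value G \<xi> (?x @ ?z) = \<xi> 0 \<otimes> ?Z"
      "word_value G \<xi> (?z @ ?y) = ?Z \<otimes> ?Y" "word_value G \<xi> (?y @ ?z) = ?Y \<otimes> ?Z"
      "word_value G \<xi> (word_power ?z (n * n)) = ?Z [^] (n * n)"
    using word_value_append[of "{0, 1}" \<xi>, OF \<xi>_closed] word_value_power[of "{0, 1}" \<xi>, OF \<xi>_closed]
      first_relator_value(3) by (simp_all del: append.simps)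
  then show ?thesis
    unfolding K_relators_def heisenberg_rel_def Let_def
    using \<xi> first_relator_value by (simp add: conj_by_def del: append.simps)
qed

lemma H_relators_hold_iff:
  "(\<forall>(u, v)\<in>H_relators. word_value G \<xi> u = word_value G \<xi> v) \<longleftrightarrow> heisenberg_rel G 1 (\<xi> 0) (\<xi> 1)"
proof -
  let ?x = "[(0, True)] :: nat word" let ?y = "word_conj ?x [(1, True)]"
  let ?Y = "conj_by (\<xi> 1) (\<xi> 0)" let ?Z = "commutator G (\<xi> 0) ?Y"
  have Y: "?Y \<in> carrier G" using \<xi> conj_by_simps by simp
  then have Z: "?Z \<in> carrier G" using \<xi> by (simp add: commutator_closed)
  have "word_value G \<xi> (word_comm ?x ?y) = ?Z"
    using \<xi> word_value_comm[of "{0, 1}" \<xi> ?x ?y] \<xi>_closed first_relator_value(3) by simp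
  then have "(\<forall>(u, v)\<in>H_relators. word_value G \<xi> u = word_value G \<xi> v) \<longleftrightarrow>
      conj_by (\<xi> 1) ?Y = \<xi> 0 \<otimes> (?Y \<otimes> (?Y \<otimes> ?Y)) \<and> ?Z = \<one>"
    unfolding H_relators_def Let_def
    using first_relator_value by (simp del: append.simps)
  also have "\<dots> \<longleftrightarrow> heisenberg_rel G 1 (\<xi> 0) (\<xi> 1)"
  proof
    assume L: "conj_by (\<xi> 1) ?Y = \<xi> 0 \<otimes> (?Y \<otimes> (?Y \<otimes> ?Y)) \<and> ?Z = \<one>"
    show "heisenberg_rel G 1 (\<xi> 0) (\<xi> 1)"
      unfolding heisenberg_rel_def Let_def conj_by_def[symmetric] conjunct2[OF L]
      using \<xi> Y L by simp
  next
    assume R: "heisenberg_rel G 1 (\<xi> 0) (\<xi> 1)"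
    then show "conj_by (\<xi> 1) ?Y = \<xi> 0 \<otimes> (?Y \<otimes> (?Y \<otimes> ?Y)) \<and> ?Z = \<one>"
      unfolding heisenberg_rel_def Let_def conj_by_def[symmetric] using Z by (simp add: One_nat_def)
  qed
  finally show ?thesis .
qed

end

end

lemma pres_gen_relators:
  assumes "R \<subseteq> words S \<times> words S" "(u, v) \<in> R"
  shows "word_value (presented_group S R) (pres_gen S R) u = word_value (presented_group S R) (pres_gen S R) v"
proof -
  have "u \<in> words S" "v \<in> words S" using assms by auto
  then show ?thesis
    using pres_eq.relation[OF assms(2)] by (simp add: word_value_pres_gen pres_class_eq_iff)
qed

lemma presented_two_generators:
  fixes R :: "(nat word \<times> nat word) set"
  assumes R: "R \<subseteq> words {0, 1} \<times> words {0, 1}"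
  defines "P \<equiv> presented_group {0, 1} R"
  shows "pres_gen {0, 1} R 0 \<in> carrier P" "pres_gen {0, 1} R 1 \<in> carrier P"
    and "\<And>T h h' y. group T \<Longrightarrow> h \<in> hom P T \<Longrightarrow> h' \<in> hom P T \<Longrightarrow>
      h (pres_gen {0, 1} R 0) = h' (pres_gen {0, 1} R 0) \<Longrightarrow>
      h (pres_gen {0, 1} R 1) = h' (pres_gen {0, 1} R 1) \<Longrightarrow> y \<in> carrier P \<Longrightarrow> h y = h' y"
    and "finite R \<Longrightarrow> finitely_presented P"
proof -
  show gens: "pres_gen {0, 1} R 0 \<in> carrier P" "pres_gen {0, 1} R 1 \<in> carrier P"
    by (auto simp: P_def carrier_presented_group)
  have grp: "group P" unfolding P_def by (rule group_presented_group)
  show "h y = h' y" if T: "group T" and h: "h \<in> hom P T" "h' \<in> hom P T"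
    and eq: "h (pres_gen {0, 1} R 0) = h' (pres_gen {0, 1} R 0)"
      "h (pres_gen {0, 1} R 1) = h' (pres_gen {0, 1} R 1)" and y: "y \<in> carrier P" for T h h' y
  proof -
    obtain u where u: "u \<in> words {0, 1}" "y = pres_class {0, 1} R u"
      using y unfolding P_def carrier_presented_group by blast
    then have val: "y = word_value P (pres_gen {0, 1} R) u"
      unfolding P_def by (simp add: word_value_pres_gen)
    show ?thesis
      by (rule hom_eq_on_generators[OF grp T h _ _ u(1) val]) (use gens eq in auto)
  qed
  show "finitely_presented P" if "finite R"
  proof -
    have "{0, 1} = {..<2::nat}" by auto
    then have "P = presented_group {..<2} R" "R \<subseteq> words {..<2} \<times> words {..<2}"
      using R by (simp_all add: P_def)
    then show ?thesis
      using grp that iso_refl[of P] unfolding finitely_presented_def by blast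
  qed
qed

abbreviation "H_a \<equiv> pres_gen {0, 1} H_relators 0"
abbreviation "H_b \<equiv> pres_gen {0, 1} H_relators 1"
abbreviation "K_x n \<equiv> pres_gen {0, 1} (K_relators n) 0"
abbreviation "K_b n \<equiv> pres_gen {0, 1} (K_relators n) 1"

lemmas H_generators = presented_two_generators[OF relators_words(2), folded H_group_eq]
lemmas K_generators = presented_two_generators[OF relators_words(4)]

lemma group_H_group: "group H_group"
  unfolding H_group_eq by (rule group_presented_group)

lemma heisenberg_rel_H: "heisenberg_rel H_group 1 H_a H_b"
proof -
  interpret group H_group by (rule group_H_group)
  show ?thesis
    using H_relators_hold_iff[of "pres_gen {0, 1} H_relators"] H_generators(1,2)
      pres_gen_relators[OF relators_words(2)] unfolding H_group_eq by blast
qed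

lemma heisenberg_rel_K: "heisenberg_rel (K_group n) n (K_x n) (K_b n)"
proof -
  interpret group "K_group n" by (rule group_presented_group)
  show ?thesis
    using K_relators_hold_iff[of "pres_gen {0, 1} (K_relators n)" n] K_generators(1,2)
      pres_gen_relators[OF relators_words(4)] by blast
qed

lemma K_hom_exists:
  assumes "group T" "heisenberg_rel T n X B"
  obtains h where "h \<in> hom (K_group n) T" "h (K_x n) = X" "h (K_b n) = B"
proof -
  interpret T: group T by fact
  let ?\<xi> = "\<lambda>i::nat. if i = 0 then X else B"
  have XB: "X \<in> carrier T" "B \<in> carrier T" using assms(2) by (simp_all add: heisenberg_rel_def)
  have rel: "word_value T ?\<xi> u = word_value T ?\<xi> v" if "(u, v) \<in> K_relators n" for u v
    using T.K_relators_hold_iff[of ?\<xi> n] XB assms(2) that by auto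
  obtain h where h: "h \<in> hom (K_group n) T" "\<And>i. i \<in> {0, 1} \<Longrightarrow> h (pres_gen {0, 1} (K_relators n) i) = ?\<xi> i"
    by (rule von_Dyck[OF assms(1) relators_words(4)[of n], of ?\<xi>]) (use XB rel in auto)
  show thesis using that[OF h(1)] h(2)[of 0] h(2)[of 1] by simp
qed

lemma H_hom_exists:
  assumes "group T" "heisenberg_rel T 1 X B"
  obtains h where "h \<in> hom H_group T" "h H_a = X" "h H_b = B"
proof -
  interpret T: group T by fact
  let ?\<xi> = "\<lambda>i::nat. if i = 0 then X else B"
  have XB: "X \<in> carrier T" "B \<in> carrier T" using assms(2) by (simp_all add: heisenberg_rel_def)
  have rel: "word_value T ?\<xi> u = word_value T ?\<xi> v" if "(u, v) \<in> H_relators" for u v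
    using T.H_relators_hold_iff[of ?\<xi>] XB assms(2) that by auto
  obtain h where h: "h \<in> hom H_group T" "\<And>i. i \<in> {0, 1} \<Longrightarrow> h (pres_gen {0, 1} H_relators i) = ?\<xi> i"
    unfolding H_group_eq by (rule von_Dyck[OF assms(1) relators_words(2), of ?\<xi>]) (use XB rel in auto)
  show thesis using that[OF h(1)] h(2)[of 0] h(2)[of 1] by simp
qed

text \<open>
  The image of \<open>a\<close> under the homomorphism from \<open>H\<close>, once \<open>X\<close> and \<open>B\<close> satisfy the relations of \<open>K\<^sub>n\<close>.
\<close>

definition root_product :: "('a, 'm) monoid_scheme \<Rightarrow> nat \<Rightarrow> 'a \<Rightarrow> 'a \<Rightarrow> 'a"
  where "root_product G n X B =
    X [^]\<^bsub>G\<^esub> n \<otimes>\<^bsub>G\<^esub> commutator G X (group.conj_by G B X) [^]\<^bsub>G\<^esub> triangular n"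

lemma hom_heisenberg:
  assumes "h \<in> hom G T" "group G" "group T" "heisenberg_rel G n X B"
  shows "heisenberg_rel T n (h X) (h B)" "h (root_product G n X B) = root_product T n (h X) (h B)"
    "h (commutator G X (group.conj_by G B X)) = commutator T (h X) (group.conj_by T (h B) (h X))"
proof -
  interpret group_hom G T h using assms by (simp add: group_hom_def group_hom_axioms_def)
  interpret R: heisenberg_relations G n X B by unfold_locales (fact assms(4))
  have Y: "h R.Y = H.conj_by (h B) (h X)"
    unfolding R.Y_def G.conj_by_def H.conj_by_def using R.rels(1,2) by simp
  have Z: "h R.Z = commutator T (h X) (H.conj_by (h B) (h X))"
    unfolding R.Z_def using R.rels(1) R.Y_closed Y by (simp add: commutator_def)
  then show "h (commutator G X (group.conj_by G B X)) = commutator T (h X) (group.conj_by T (h B) (h X))"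
    by (simp only: R.Z_def R.Y_def)
  have "h (G.conj_by B R.Y) = h (X \<otimes>\<^bsub>G\<^esub> (R.Y \<otimes>\<^bsub>G\<^esub> (R.Y \<otimes>\<^bsub>G\<^esub> R.Y)))"
    "h (R.Z \<otimes>\<^bsub>G\<^esub> X) = h (X \<otimes>\<^bsub>G\<^esub> R.Z)" "h (R.Z \<otimes>\<^bsub>G\<^esub> R.Y) = h (R.Y \<otimes>\<^bsub>G\<^esub> R.Z)"
    "h (R.Z [^]\<^bsub>G\<^esub> (n * n)) = h \<one>\<^bsub>G\<^esub>"
    by (simp_all only: R.rels(3-6))
  then show "heisenberg_rel T n (h X) (h B)"
    unfolding heisenberg_rel_def Let_def H.conj_by_def[symmetric]
    unfolding Y[symmetric] unfolding Z[symmetric, folded Y]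
    using R.rels(1,2) R.Y_closed by (simp add: H.conj_by_def G.conj_by_def hom_nat_pow)
  show "h (root_product G n X B) = root_product T n (h X) (h B)"
    unfolding root_product_def unfolding Z[symmetric] using R.rels(1)
    by (simp add: hom_nat_pow hom_int_pow flip: R.Z_def R.Y_def)
qed

text \<open>
  In an abelian group the relations of \<open>K\<^sub>n\<close> make \<open>x\<^sup>3\<close> trivial, and \<open>x^n\<close> comes from \<open>a\<close>; this settles the cokernel in degree 1.
  Lifts to central extensions are those of \<open>heisenberg_rel_central_lift\<close>.
\<close>

lemma two_connected_H_K:
  assumes f: "f \<in> hom H_group (K_group n)" "f H_a = root_product (K_group n) n (K_x n) (K_b n)" "f H_b = K_b n"
    and uv: "u * int n + 3 * v = 1"
  shows "two_connected H_group (K_group n) f"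
proof (rule two_connectedI)
  show "group H_group" by (rule group_H_group)
  show grpK: "group (K_group n)" by (rule group_presented_group)
  show "f \<in> hom H_group (K_group n)" by fact
  interpret K: group "K_group n" by fact
  interpret R: heisenberg_relations "K_group n" n "K_x n" "K_b n" by unfold_locales (rule heisenberg_rel_K)
  show "\<theta> k = \<one>\<^bsub>A\<^esub>" if A: "comm_group A" and \<theta>: "\<theta> \<in> hom (K_group n) A"
    and triv: "\<And>g. g \<in> carrier H_group \<Longrightarrow> \<theta> (f g) = \<one>\<^bsub>A\<^esub>" and k: "k \<in> carrier (K_group n)"
    for A :: "(nat word set list \<Rightarrow>\<^sub>0 int) set monoid" and \<theta> k
  proof -
    interpret A: comm_group A by (rule A)
    interpret \<theta>: group_hom "K_group n" A \<theta> using \<theta> by (simp add: group_hom_def group_hom_axioms_def grpK A.is_group)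
    let ?r = "\<theta> (K_x n)"
    have r: "?r \<in> carrier A" using R.rels(1) by simp
    have b: "\<theta> (K_b n) = \<one>\<^bsub>A\<^esub>" using triv[OF H_generators(2)] f(3) by simp
    have Y: "\<theta> R.Y = ?r" unfolding R.Y_def K.conj_by_def using R.rels(1,2) r by (simp add: b)
    have Z: "\<theta> R.Z = \<one>\<^bsub>A\<^esub>"
      unfolding R.Z_def commutator_def using R.rels(1) R.Y_closed r by (simp add: Y A.m_ac)
    have "\<theta> (f H_a) = ?r [^]\<^bsub>A\<^esub> n"
      unfolding f(2) root_product_def using R.rels(1) r Z
      by (simp add: \<theta>.hom_nat_pow \<theta>.hom_int_pow flip: R.Z_def R.Y_def)
    then have rn: "?r [^]\<^bsub>A\<^esub> n = \<one>\<^bsub>A\<^esub>" using triv[OF H_generators(1)] by simp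
    have "\<theta> (K.conj_by (K_b n) R.Y) = \<theta> (K_x n \<otimes>\<^bsub>K_group n\<^esub> (R.Y \<otimes>\<^bsub>K_group n\<^esub> (R.Y \<otimes>\<^bsub>K_group n\<^esub> R.Y)))"
      by (simp only: R.rels(3))
    then have "?r = ?r \<otimes>\<^bsub>A\<^esub> (?r \<otimes>\<^bsub>A\<^esub> (?r \<otimes>\<^bsub>A\<^esub> ?r))"
      using R.rels(1,2) R.Y_closed r by (simp add: K.conj_by_def b Y)
    then have r3: "?r [^]\<^bsub>A\<^esub> (3::nat) = \<one>\<^bsub>A\<^esub>" using r by (simp add: numeral_3_eq_3 A.m_assoc)
    have "?r [^]\<^bsub>A\<^esub> (n * n) = \<one>\<^bsub>A\<^esub>" using A.nat_pow_pow[OF r, of n n] rn by simp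
    then have x: "?r = \<one>\<^bsub>A\<^esub>" by (rule A.bezout_power_one[OF uv r r3])
    have one: "(\<lambda>_. \<one>\<^bsub>A\<^esub>) \<in> hom (K_group n) A" by (simp add: hom_def)
    show "\<theta> k = \<one>\<^bsub>A\<^esub>"
      using K_generators(3)[OF A.is_group \<theta> one _ _ k] x b by simp
  qed
  show "\<exists>s\<in>hom (K_group n) E. (\<forall>k\<in>carrier (K_group n). fst (s k) = k) \<and> (\<forall>g\<in>carrier H_group. s (f g) = \<phi> g)"
    if E: "group E" and q: "fst \<in> hom E (K_group n)" "fst ` carrier E = carrier (K_group n)"
      and central: "\<And>m e. m \<in> carrier E \<Longrightarrow> fst m = \<one>\<^bsub>K_group n\<^esub> \<Longrightarrow> e \<in> carrier E \<Longrightarrow>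
        m \<otimes>\<^bsub>E\<^esub> e = e \<otimes>\<^bsub>E\<^esub> m"
      and \<phi>: "\<phi> \<in> hom H_group E" "\<And>g. g \<in> carrier H_group \<Longrightarrow> fst (\<phi> g) = f g"
    for E :: "(nat word set \<times> ((nat word set list \<Rightarrow>\<^sub>0 int) \<times> (nat word set list \<Rightarrow>\<^sub>0 int)) set) monoid" and \<phi>
  proof -
    have qB: "fst (\<phi> H_b) = K_b n" using \<phi>(2)[OF H_generators(2)] f(3) by simp
    have qa: "fst (\<phi> H_a) = root_product (K_group n) n (K_x n) (fst (\<phi> H_b))"
      using \<phi>(2)[OF H_generators(1)] f(2) qB by simp
    have rel: "heisenberg_rel (K_group n) n (K_x n) (fst (\<phi> H_b))" using heisenberg_rel_K qB by simp
    have a: "heisenberg_rel E 1 (\<phi> H_a) (\<phi> H_b)"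
      by (rule hom_heisenberg(1)[OF \<phi>(1) group_H_group E heisenberg_rel_H])
    obtain X where X: "heisenberg_rel E n X (\<phi> H_b)" "fst X = K_x n"
        "root_product E n X (\<phi> H_b) = \<phi> H_a"
      by (rule heisenberg_rel_central_lift[OF E grpK q central rel a qa[unfolded root_product_def] uv])
        (auto simp: root_product_def)
    obtain s where s: "s \<in> hom (K_group n) E" "s (K_x n) = X" "s (K_b n) = \<phi> H_b"
      by (rule K_hom_exists[OF E X(1)])
    have "(fst \<circ> s) k = id k" if "k \<in> carrier (K_group n)" for k
      by (rule K_generators(3)[OF grpK hom_compose[OF s(1) q(1)] _ _ _ that])
        (use s X qB in \<open>auto simp: hom_def\<close>)
    moreover have "(s \<circ> f) g = \<phi> g" if "g \<in> carrier H_group" for g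
    proof (rule H_generators(3)[OF E hom_compose[OF f(1) s(1)] \<phi>(1) _ _ that])
      show "(s \<circ> f) H_a = \<phi> H_a"
        using hom_heisenberg(2)[OF s(1) grpK E heisenberg_rel_K] X(3) s(2,3) f(2) by simp
    qed (use f(3) s(3) in simp)
    ultimately show ?thesis using s(1) by auto
  qed
qed

text \<open>
  Homomorphisms from \<open>K\<^sub>n\<close> that extend a given one from \<open>H\<close> are the same as solutions \<open>X\<close> of the two equations.
\<close>

lemma local_group_unique_root:
  assumes "local_group T" and a: "heisenberg_rel T 1 a B" and uv: "u * int n + 3 * v = 1"
  shows "\<exists>X. heisenberg_rel T n X B \<and> root_product T n X B = a"
    and "heisenberg_rel T n X B \<Longrightarrow> root_product T n X B = a \<Longrightarrow>
      heisenberg_rel T n X' B \<Longrightarrow> root_product T n X' B = a \<Longrightarrow> X = X'"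
proof -
  have T: "group T" using assms(1) by (simp add: local_group_def)
  have grpK: "group (K_group n)" by (rule group_presented_group)
  interpret R: heisenberg_relations "K_group n" n "K_x n" "K_b n"
    using grpK by (simp add: heisenberg_relations_def heisenberg_relations_axioms_def heisenberg_rel_K)
  have "root_product (K_group n) n (K_x n) (K_b n) = R.nf (int n) 0 (triangular n)"
    unfolding R.nf_def root_product_def using R.rels(1) by (simp add: int_pow_int R.Z_def R.Y_def)
  then have "heisenberg_rel (K_group n) 1 (root_product (K_group n) n (K_x n) (K_b n)) (K_b n)"
    using R.abelian_subrelation by simp
  then obtain f where f: "f \<in> hom H_group (K_group n)"
      "f H_a = root_product (K_group n) n (K_x n) (K_b n)" "f H_b = K_b n"
    by (rule H_hom_exists[OF grpK])
  have conn: "two_connected H_group (K_group n) f" by (rule two_connected_H_K[OF f uv])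
  obtain g where g: "g \<in> hom H_group T" "g H_a = a" "g H_b = B" by (rule H_hom_exists[OF T a])
  have fp: "finitely_presented H_group" "finitely_presented (K_group n)"
    using H_generators(4) K_generators(4) relators_words(1,3) by blast+
  have ex: "\<exists>!h. h \<in> hom (K_group n) T \<inter> extensional (carrier (K_group n)) \<and>
      (\<forall>x\<in>carrier H_group. h (f x) = g x)"
    using assms(1) fp conn g(1) unfolding local_group_def by blast
  show "\<exists>X. heisenberg_rel T n X B \<and> root_product T n X B = a"
  proof -
    obtain h where h: "h \<in> hom (K_group n) T" "\<And>x. x \<in> carrier H_group \<Longrightarrow> h (f x) = g x"
      using ex by blast
    note hh = hom_heisenberg[OF h(1) grpK T heisenberg_rel_K]
    have "h (K_b n) = B" using h(2)[OF H_generators(2)] f(3) g(3) by simp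
    moreover have "h (root_product (K_group n) n (K_x n) (K_b n)) = a"
      using h(2)[OF H_generators(1)] f(2) g(2) by simp
    ultimately show ?thesis using hh(1,2) by auto
  qed
  have root: "\<exists>h. (h \<in> hom (K_group n) T \<inter> extensional (carrier (K_group n)) \<and>
      (\<forall>x\<in>carrier H_group. h (f x) = g x)) \<and> h (K_x n) = X"
    if X: "heisenberg_rel T n X B" "root_product T n X B = a" for X
  proof -
    obtain h where h: "h \<in> hom (K_group n) T" "h (K_x n) = X" "h (K_b n) = B"
      by (rule K_hom_exists[OF T X(1)])
    have hf: "(h \<circ> f) x = g x" if "x \<in> carrier H_group" for x
    proof (rule H_generators(3)[OF T hom_compose[OF f(1) h(1)] g(1) _ _ that])
      show "(h \<circ> f) H_a = g H_a"
        using hom_heisenberg(2)[OF h(1) grpK T heisenberg_rel_K] h(2,3) f(2) g(2) X(2) by simp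
    qed (use f(3) g(3) h(3) in simp)
    have "restrict h (carrier (K_group n)) \<in> hom (K_group n) T"
      using h(1) R.m_closed by (auto simp: hom_def)
    then show ?thesis
      using hf hom_in_carrier[OF f(1)] h(2) K_generators(1)[of n]
      by (intro exI[of _ "restrict h (carrier (K_group n))"]) simp
  qed
  show "X = X'" if "heisenberg_rel T n X B" "root_product T n X B = a"
      "heisenberg_rel T n X' B" "root_product T n X' B = a"
    using root[OF that(1,2)] root[OF that(3,4)] ex by blast
qed

section \<open>The transfinite lower central series\<close>

lemma (in group) commutator_subgroup_mono:
  "A \<subseteq> A' \<Longrightarrow> commutator_subgroup G A B \<subseteq> commutator_subgroup G A' B"
  unfolding commutator_subgroup_def
  by (rule mono_generate) blast

lemma le_lower_central:
  assumes "group G" "N \<subseteq> carrier G" "N \<subseteq> commutator_subgroup G N (carrier G)" and r: "Well_order r"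
  shows "N \<subseteq> lower_central G r \<alpha>"
proof -
  have wf: "wf (r - Id)" using r by (simp add: well_order_on_def)
  have antisym: "antisym r"
    using r by (auto simp: well_order_on_def linear_order_on_def partial_order_on_def)
  show ?thesis
  proof (induction \<alpha> rule: wf_induct_rule[OF wf])
    case (1 \<alpha>)
    have below: "N \<subseteq> lower_central G r \<beta>" if "\<beta> \<in> underS r \<alpha>" for \<beta>
      using 1[of \<beta>] that by (auto simp: underS_def)
    define \<gamma> where "\<gamma> = cut (lower_central G r) (r - Id) \<alpha>"
    have \<gamma>: "\<gamma> \<beta> = lower_central G r \<beta>" if "\<beta> \<in> underS r \<alpha>" for \<beta>
      using that by (simp add: \<gamma>_def cut_def underS_def)
    have unfold: "lower_central G r \<alpha> = (if underS r \<alpha> = {} then carrier G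
      else if \<exists>\<beta> \<in> underS r \<alpha>. underS r \<alpha> = under r \<beta>
        then commutator_subgroup G (\<gamma> (THE \<beta>. \<beta> \<in> underS r \<alpha> \<and> underS r \<alpha> = under r \<beta>)) (carrier G)
      else (\<Inter>\<beta> \<in> underS r \<alpha>. \<gamma> \<beta>))"
      unfolding \<gamma>_def lower_central_def by (subst wfrec[OF wf]) (rule HOL.refl)
    consider "underS r \<alpha> = {}" | \<beta> where "\<beta> \<in> underS r \<alpha>" "underS r \<alpha> = under r \<beta>"
      | "underS r \<alpha> \<noteq> {}" "\<not> (\<exists>\<beta> \<in> underS r \<alpha>. underS r \<alpha> = under r \<beta>)" by blast
    then show ?case
    proof cases
      case 1
      then show ?thesis unfolding unfold using assms(2) by simp
    next
      case (2 \<beta>)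
      have "(THE \<beta>. \<beta> \<in> underS r \<alpha> \<and> underS r \<alpha> = under r \<beta>) = \<beta>"
      proof (rule the_equality)
        fix \<delta> assume \<delta>: "\<delta> \<in> underS r \<alpha> \<and> underS r \<alpha> = under r \<delta>"
        then have "\<delta> \<in> under r \<beta>" "\<beta> \<in> under r \<delta>" using 2 by auto
        then show "\<delta> = \<beta>" using antisym by (auto simp: under_def antisym_def)
      qed (use 2 in blast)
      then have "lower_central G r \<alpha> = commutator_subgroup G (lower_central G r \<beta>) (carrier G)"
        unfolding unfold using 2 \<gamma> by auto
      then show ?thesis using group.commutator_subgroup_mono[OF assms(1) below[OF 2(1)], of "carrier G"] assms(3) by blast
    next
      case 3
      then show ?thesis unfolding unfold using below \<gamma> by auto
    qed
  qed
qed

section \<open>The localization of H\<close>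

lemma bezout_power_two: "\<exists>u v. u * int (2 ^ k) + 3 * v = 1"
proof -
  have "coprime (2 ^ k) (3::int)" by simp
  then show ?thesis using bezout_int[of "int (2 ^ k)" 3] by (metis coprime_imp_gcd_eq_1 mult.commute of_nat_numeral of_nat_power)
qed

text \<open>
  The group is countable, so a copy of it lives on the type \<open>'a + nat\<close> over which the universal property ranges.
\<close>

lemma local_heisenberg_group_exists:
  obtains \<Gamma> :: "('a + nat) monoid" and X B where "local_group \<Gamma>" "heisenberg_rel \<Gamma> 2 X B"
    "commutator \<Gamma> X (group.conj_by \<Gamma> B X) \<noteq> \<one>\<^bsub>\<Gamma>\<^esub>"
proof -
  interpret H: group heisenberg_group by (rule group_heisenberg_group)
  define j :: "qfield \<times> qfield \<times> quasicyclic \<Rightarrow> 'a + nat" where "j x = Inr (to_nat x)" for x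
  have inj: "inj_on j (carrier heisenberg_group)" by (rule inj_onI) (simp add: j_def)
  define \<Gamma> where "\<Gamma> = image_group j heisenberg_group"
  have \<Gamma>: "group \<Gamma>" unfolding \<Gamma>_def by (rule H.inj_imp_image_group_is_group[OF inj])
  have iso: "j \<in> iso heisenberg_group \<Gamma>" unfolding \<Gamma>_def by (rule inj_imp_image_group_iso[OF inj])
  then have hom: "j \<in> hom heisenberg_group \<Gamma>" by (simp add: iso_def)
  have "uniquely_solvable \<Gamma>"
    by (rule uniquely_solvable_iso[OF group_heisenberg_group \<Gamma> iso uniquely_solvable_heisenberg_group])
  then have "local_group \<Gamma>" by (rule uniquely_solvable_imp_local[OF \<Gamma>])
  note rels = heisenberg_relations[OF HOL.refl HOL.refl]
  let ?X = heisenberg_x and ?B = heisenberg_b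
  have rel: "heisenberg_rel heisenberg_group 2 ?X ?B"
    unfolding heisenberg_rel_def Let_def using rels(1-6) by simp
  have "commutator heisenberg_group ?X (H.conj_by ?B ?X) \<in> carrier heisenberg_group"
    using rels(1,2) by (intro H.commutator_closed H.conj_by_simps)
  moreover have "commutator heisenberg_group ?X (H.conj_by ?B ?X) \<noteq> \<one>\<^bsub>heisenberg_group\<^esub>"
    using rels(7) by (simp add: H.conj_by_def)
  ultimately have "j (commutator heisenberg_group ?X (H.conj_by ?B ?X)) \<noteq> j \<one>\<^bsub>heisenberg_group\<^esub>"
    using inj by (simp add: inj_on_eq_iff)
  then have "commutator \<Gamma> (j ?X) (group.conj_by \<Gamma> (j ?B) (j ?X)) \<noteq> \<one>\<^bsub>\<Gamma>\<^esub>"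
    using hom_heisenberg(3)[OF hom group_heisenberg_group \<Gamma> rel] hom_one[OF hom group_heisenberg_group \<Gamma>]
    by simp
  then show thesis
    using that[OF \<open>local_group \<Gamma>\<close> hom_heisenberg(1)[OF hom group_heisenberg_group \<Gamma> rel]] by blast
qed

theorem theorem1:
  fixes L :: "'a monoid" and l :: "nat word set \<Rightarrow> 'a"
  assumes localization: "vogel_levine_localization H_group L l"
  shows "\<not> transfinitely_nilpotent TYPE('o) L"
proof -
  have loc: "local_group L" and l: "l \<in> hom H_group L"
    and univ: "\<And>\<Gamma> :: ('a + nat) monoid. \<And>f. local_group \<Gamma> \<Longrightarrow> f \<in> hom H_group \<Gamma> \<Longrightarrow>
      \<exists>!p. p \<in> hom L \<Gamma> \<inter> extensional (carrier L) \<and> (\<forall>x\<in>carrier H_group. p (l x) = f x)"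
    using localization unfolding vogel_levine_localization_def by blast+
  have grp: "group L" using loc by (simp add: local_group_def)
  interpret L: group L by fact
  define a where "a = l H_a"
  define B where "B = l H_b"
  have rel_a: "heisenberg_rel L 1 a B"
    unfolding a_def B_def by (rule hom_heisenberg(1)[OF l group_H_group grp heisenberg_rel_H])
  have B: "B \<in> carrier L" using rel_a by (simp add: heisenberg_rel_def)
  have "\<exists>X. heisenberg_rel L (2 ^ k) X B \<and> root_product L (2 ^ k) X B = a" for k
    using bezout_power_two[of k] local_group_unique_root(1)[OF loc rel_a] by blast
  then obtain X where X: "\<And>k. heisenberg_rel L (2 ^ k) (X k) B" "\<And>k. root_product L (2 ^ k) (X k) B = a"
    by metis
  (* X k is the root for the exponent 2^k. *)
  define Z where "Z k = commutator L (X k) (L.conj_by B (X k))" for k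
  have X_closed: "X k \<in> carrier L" for k using X(1)[of k] by (simp add: heisenberg_rel_def)
  then have Z_closed: "Z k \<in> carrier L" for k
    unfolding Z_def using B by (intro L.commutator_closed L.conj_by_simps) auto
  have Z_step: "Z k = Z (Suc k) [^]\<^bsub>L\<^esub> (4::nat)" and Z_conj: "L.conj_by B (Z (Suc k)) = inv\<^bsub>L\<^esub> Z (Suc k)" for k
  proof -
    have rel: "heisenberg_rel L (2 * 2 ^ k) (X (Suc k)) B" using X(1)[of "Suc k"] by simp
    note double = L.heisenberg_rel_double[OF rel, folded Z_def]
    show "L.conj_by B (Z (Suc k)) = inv\<^bsub>L\<^esub> Z (Suc k)" by (rule double(4))
    let ?X = "X (Suc k) \<otimes>\<^bsub>L\<^esub> X (Suc k) \<otimes>\<^bsub>L\<^esub> Z (Suc k)"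
    (* X k and this product are both roots for the exponent 2^k. *)
    have "root_product L (2 ^ k) ?X B = a"
      using double(3) X(2)[of "Suc k"] by (simp add: root_product_def Z_def)
    then have "X k = ?X"
      using bezout_power_two[of k] local_group_unique_root(2)[OF loc rel_a _ X(1,2) double(1)] by blast
    then show "Z k = Z (Suc k) [^]\<^bsub>L\<^esub> (4::nat)" using double(2) by (simp add: Z_def)
  qed
  define N where "N = {Z k [^]\<^bsub>L\<^esub> (i::int) |k i. True}"
  have N_L: "N \<subseteq> carrier L" using Z_closed by (auto simp: N_def)
  have "N \<subseteq> commutator_subgroup L N (carrier L)"
  proof
    fix x assume "x \<in> N"
    then obtain k i where x: "x = Z k [^]\<^bsub>L\<^esub> (i::int)" by (auto simp: N_def)
    let ?Z = "Z (Suc k)" and ?w = "Z (Suc k) [^]\<^bsub>L\<^esub> (- 2 * i)"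
    have "commutator L ?w B = inv\<^bsub>L\<^esub> ?w \<otimes>\<^bsub>L\<^esub> L.conj_by B ?w"
      using Z_closed B by (simp add: commutator_def L.conj_by_def L.m_assoc)
    also have "L.conj_by B ?w = inv\<^bsub>L\<^esub> ?w"
      using L.conj_by_simps(4)[OF B Z_closed] Z_conj Z_closed by (simp add: L.int_pow_inv)
    also have "inv\<^bsub>L\<^esub> ?w = ?Z [^]\<^bsub>L\<^esub> (2 * i)" using Z_closed by (simp flip: L.int_pow_neg)
    also have "?Z [^]\<^bsub>L\<^esub> (2 * i) \<otimes>\<^bsub>L\<^esub> ?Z [^]\<^bsub>L\<^esub> (2 * i) = ?Z [^]\<^bsub>L\<^esub> (int 4 * i)"
      using Z_closed by (simp flip: L.int_pow_mult)
    also have "\<dots> = x"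
      unfolding x Z_step[of k] using L.int_pow_pow[OF Z_closed, of "Suc k" "int 4" i]
      by (simp only: int_pow_int)
    finally have "x = commutator L ?w B" by simp
    moreover have "?w \<in> N" by (auto simp: N_def)
    ultimately show "x \<in> commutator_subgroup L N (carrier L)"
      unfolding commutator_subgroup_def using B by (blast intro: generate.incl)
  qed
  then have central: "N \<subseteq> lower_central L r \<alpha>" if "Well_order r" for r :: "'o rel" and \<alpha>
    by (rule le_lower_central[OF grp N_L _ that])
  (* The homomorphism from L to the local group above maps X 1 to the root there, by uniqueness. *)
  have "Z 1 \<noteq> \<one>\<^bsub>L\<^esub>"
  proof -
    obtain \<Gamma> :: "('a + nat) monoid" and X' B' where \<Gamma>: "local_group \<Gamma>" and X': "heisenberg_rel \<Gamma> 2 X' B'"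
      and ne: "commutator \<Gamma> X' (group.conj_by \<Gamma> B' X') \<noteq> \<one>\<^bsub>\<Gamma>\<^esub>"
      by (rule local_heisenberg_group_exists)
    have grp\<Gamma>: "group \<Gamma>" using \<Gamma> by (simp add: local_group_def)
    interpret \<Gamma>: group \<Gamma> by fact
    interpret R: heisenberg_relations \<Gamma> 2 X' B' by unfold_locales (fact X')
    have "root_product \<Gamma> 2 X' B' = R.nf (int 2) 0 (triangular 2)"
      unfolding R.nf_def root_product_def using R.rels(1) by (simp only: int_pow_int R.Z_def R.Y_def int_pow_0
          \<Gamma>.r_one \<Gamma>.nat_pow_closed)
    then have rel1: "heisenberg_rel \<Gamma> 1 (root_product \<Gamma> 2 X' B') B'" using R.abelian_subrelation by simp
    obtain f where f: "f \<in> hom H_group \<Gamma>" "f H_a = root_product \<Gamma> 2 X' B'" "f H_b = B'"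
      by (rule H_hom_exists[OF grp\<Gamma> rel1])
    obtain p where p: "p \<in> hom L \<Gamma>" "\<And>x. x \<in> carrier H_group \<Longrightarrow> p (l x) = f x"
      using univ[OF \<Gamma> f(1)] by blast
    have pB: "p B = B'" using p(2)[OF H_generators(2)] f(3) by (simp add: B_def)
    have pa: "p a = root_product \<Gamma> 2 X' B'" using p(2)[OF H_generators(1)] f(2) by (simp add: a_def)
    have X1: "heisenberg_rel L 2 (X 1) B" "root_product L 2 (X 1) B = a" using X[of 1] by simp_all
    note pX = hom_heisenberg[OF p(1) grp grp\<Gamma> X1(1), unfolded pB]
    have "\<exists>u v. u * int 2 + 3 * v = 1" using bezout_power_two[of 1] by simp
    then have "p (X 1) = X'"
      using local_group_unique_root(2)[OF \<Gamma> rel1 _ pX(1) _ X' HOL.refl] pX(2) X1(2) pa by auto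
    then have "p (Z 1) \<noteq> \<one>\<^bsub>\<Gamma>\<^esub>" using pX(3) ne by (simp add: Z_def)
    then show ?thesis using hom_one[OF p(1) grp grp\<Gamma>] by auto
  qed
  moreover have "Z 1 \<in> N"
  proof -
    have "Z 1 [^]\<^bsub>L\<^esub> (1::int) \<in> N" unfolding N_def by blast
    then show ?thesis using L.int_pow_1[OF Z_closed[of 1]] by simp
  qed
  ultimately show ?thesis
    unfolding transfinitely_nilpotent_def using central by blast
qed

end
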